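(* Let $k$ be a commutative ring, let $\varepsilon\in k$ be invertible, let $v\in k$ be an invertible element and let $\delta=v+v^{-1}$. Let $\mathcal{M}_n(\delta,\varepsilon)$ be the Motzkin algebra over $k$. Then $$\mathrm{Tor}_q^{\mathcal{M}_{n}(\delta,\varepsilon)}(\mathbf{1},\mathbf{1})=0$$ for $1\leqslant q\leqslant n-2$ when $n$ is even and for $1\leqslant q\leqslant n-1$ when $n$ is odd. In particular, the maps $$\mathrm{Tor}_q^{\mathcal{M}_{n-1}(\delta,\varepsilon)}(\mathbf{1},\mathbf{1})\rightarrow \mathrm{Tor}_q^{\mathcal{M}_{n}(\delta,\varepsilon)}(\mathbf{1},\mathbf{1})$$ induced by the inclusion $\mathcal{M}_{n-1}(\delta,\varepsilon)\to\mathcal{M}_n(\delta,\varepsilon)$ are isomorphisms for $q\leqslant n-3$.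
   Context: A Motzkin $n$-diagram is a graph on two columns (left and right) of $n$ nodes in which each node is connected to at most one other node by an edge (left-to-left, right-to-right and left-to-right edges are all allowed, and nodes may be unconnected), and which is planar (edges can be drawn between the two columns without crossings). The Motzkin algebra $\mathcal{M}_n(\delta,\varepsilon)$ consists of formal $k$-linear combinations of Motzkin $n$-diagrams. The product $x\cdot y$ of two diagrams is the $k$-bilinear extension of: identify the right-hand nodes of $x$ with the left-hand nodes of $y$ and forget the middle nodes; replace each closed loop formed in the middle by a factor $\delta$; and replace each contractible component lying entirely in the middle (an isolated middle node, or an open path containing no node of the outer columns) by a factor $\varepsilon$. A path starting at an outer node and ending at a middle node is discarded without a factor, leaving the outer node unconnected. The inclusion $\mathcal{M}_{n-1}(\delta,\varepsilon)\to\mathcal{M}_n(\delta,\varepsilon)$ sends an $(n-1)$-diagram to the $n$-diagram obtained by adding an extra node at the end of each column and joining these two nodes by a horizontal edge. The trivial module $\mathbf{1}$ is a copy of $k$ (as a left and as a right module) on which diagrams with no missing edges, no left-to-left connections and no right-to-right connections act as $1$ and all other diagrams act as $0$. *)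

theory Defs
  imports "HOL-Algebra.Module" "HOL-Algebra.Free_Abelian_Groups"
begin

section \<open>Modules over a not necessarily commutative ring\<close>

text \<open>
  The locale \<^verbatim>\<open>module\<close> of HOL-Algebra requires a commutative ring. Its record type is reused here;
  the fields \<^verbatim>\<open>mult\<close> and \<^verbatim>\<open>one\<close> of a module carry no meaning.
\<close>

locale left_module = R?: ring R + M?: abelian_group M for R (structure) and M (structure) +
  assumes smult_closed:
      "\<lbrakk>a \<in> carrier R; x \<in> carrier M\<rbrakk> \<Longrightarrow> a \<odot>\<^bsub>M\<^esub> x \<in> carrier M"
    and smult_l_distr:
      "\<lbrakk>a \<in> carrier R; b \<in> carrier R; x \<in> carrier M\<rbrakk> \<Longrightarrow>
        (a \<oplus>\<^bsub>R\<^esub> b) \<odot>\<^bsub>M\<^esub> x = a \<odot>\<^bsub>M\<^esub> x \<oplus>\<^bsub>M\<^esub> b \<odot>\<^bsub>M\<^esub> x"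
    and smult_r_distr:
      "\<lbrakk>a \<in> carrier R; x \<in> carrier M; y \<in> carrier M\<rbrakk> \<Longrightarrow>
        a \<odot>\<^bsub>M\<^esub> (x \<oplus>\<^bsub>M\<^esub> y) = a \<odot>\<^bsub>M\<^esub> x \<oplus>\<^bsub>M\<^esub> a \<odot>\<^bsub>M\<^esub> y"
    and smult_assoc:
      "\<lbrakk>a \<in> carrier R; b \<in> carrier R; x \<in> carrier M\<rbrakk> \<Longrightarrow>
        (a \<otimes>\<^bsub>R\<^esub> b) \<odot>\<^bsub>M\<^esub> x = a \<odot>\<^bsub>M\<^esub> (b \<odot>\<^bsub>M\<^esub> x)"
    and smult_one:
      "x \<in> carrier M \<Longrightarrow> \<one>\<^bsub>R\<^esub> \<odot>\<^bsub>M\<^esub> x = x"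

definition semilinear_maps ::
  "('r, 'x) ring_scheme \<Rightarrow> ('r \<Rightarrow> 's) \<Rightarrow> ('r, 'm) module \<Rightarrow> ('s, 'n) module \<Rightarrow> ('m \<Rightarrow> 'n) set" where
  "semilinear_maps R \<rho> M N = {f \<in> carrier M \<rightarrow> carrier N.
     (\<forall>x\<in>carrier M. \<forall>y\<in>carrier M. f (x \<oplus>\<^bsub>M\<^esub> y) = f x \<oplus>\<^bsub>N\<^esub> f y) \<and>
     (\<forall>a\<in>carrier R. \<forall>x\<in>carrier M. f (a \<odot>\<^bsub>M\<^esub> x) = \<rho> a \<odot>\<^bsub>N\<^esub> f x)}"

definition linear_maps ::
  "('r, 'x) ring_scheme \<Rightarrow> ('r, 'm) module \<Rightarrow> ('r, 'n) module \<Rightarrow> ('m \<Rightarrow> 'n) set" where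
  "linear_maps R M N = semilinear_maps R (\<lambda>a. a) M N"

definition free_left_module :: "('r, 'x) ring_scheme \<Rightarrow> 'i set \<Rightarrow> ('r, 'i \<Rightarrow> 'r) module" where
  "free_left_module R I =
     \<lparr>carrier = {f \<in> I \<rightarrow>\<^sub>E carrier R. finite {i \<in> I. f i \<noteq> \<zero>\<^bsub>R\<^esub>}},
      monoid.mult = undefined, monoid.one = undefined,
      ring.zero = (\<lambda>i\<in>I. \<zero>\<^bsub>R\<^esub>),
      ring.add = (\<lambda>f g. \<lambda>i\<in>I. f i \<oplus>\<^bsub>R\<^esub> g i),
      smult = (\<lambda>a f. \<lambda>i\<in>I. a \<otimes>\<^bsub>R\<^esub> f i)\<rparr>"

text \<open>
  A module is projective if it is a direct summand of a free module. Taking the index set of the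
  free module in the type of the elements of \<^verbatim>\<open>P\<close> loses nothing: if \<^verbatim>\<open>P\<close> is a summand of any free
  module, then it is a summand of the free module on \<^verbatim>\<open>carrier P\<close>.
\<close>

definition projective_left_module :: "('r, 'x) ring_scheme \<Rightarrow> ('r, 'p) module \<Rightarrow> bool" where
  "projective_left_module R P \<longleftrightarrow> left_module R P \<and>
     (\<exists>I :: 'p set. \<exists>i \<in> linear_maps R P (free_left_module R I).
        \<exists>r \<in> linear_maps R (free_left_module R I) P. \<forall>x\<in>carrier P. r (i x) = x)"


section \<open>Projective resolutions\<close>

text \<open>
  \<^verbatim>\<open>bdry X i\<close> is the differential from degree \<^verbatim>\<open>i + 1\<close> to degree \<^verbatim>\<open>i\<close>, and \<^verbatim>\<open>augm X\<close> is the map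
  from degree \<^verbatim>\<open>0\<close> to the resolved module.
\<close>

record ('r, 'p, 'n) augmented_complex =
  obj :: "nat \<Rightarrow> ('r, 'p) module"
  bdry :: "nat \<Rightarrow> 'p \<Rightarrow> 'p"
  augm :: "'p \<Rightarrow> 'n"

definition projective_resolution ::
  "('r, 'x) ring_scheme \<Rightarrow> ('r, 'n) module \<Rightarrow> ('r, 'p, 'n) augmented_complex \<Rightarrow> bool" where
  "projective_resolution R N X \<longleftrightarrow>
     left_module R N \<and>
     (\<forall>i. projective_left_module R (obj X i)) \<and>
     (\<forall>i. bdry X i \<in> linear_maps R (obj X (Suc i)) (obj X i)) \<and>
     augm X \<in> linear_maps R (obj X 0) N \<and>
     augm X ` carrier (obj X 0) = carrier N \<and>
     bdry X 0 ` carrier (obj X 1) = {x \<in> carrier (obj X 0). augm X x = \<zero>\<^bsub>N\<^esub>} \<and>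
     (\<forall>i. bdry X (Suc i) ` carrier (obj X (Suc (Suc i))) =
            {x \<in> carrier (obj X (Suc i)). bdry X i x = \<zero>\<^bsub>obj X i\<^esub>})"

text \<open>
  Chain maps, semilinear along \<^verbatim>\<open>\<rho> : R \<rightarrow> S\<close>, from a complex over \<^verbatim>\<open>R\<close> to a complex over \<^verbatim>\<open>S\<close>, that
  lift the map \<^verbatim>\<open>\<phi>\<close> of augmentation modules.
\<close>

definition chain_lift ::
  "('r, 'x) ring_scheme \<Rightarrow> ('r \<Rightarrow> 's) \<Rightarrow> ('n \<Rightarrow> 'n') \<Rightarrow>
   ('r, 'p, 'n) augmented_complex \<Rightarrow> ('s, 'q, 'n') augmented_complex \<Rightarrow>
   (nat \<Rightarrow> 'p \<Rightarrow> 'q) \<Rightarrow> bool" where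
  "chain_lift R \<rho> \<phi> X Y f \<longleftrightarrow>
     (\<forall>i. f i \<in> semilinear_maps R \<rho> (obj X i) (obj Y i)) \<and>
     (\<forall>i. \<forall>x\<in>carrier (obj X (Suc i)). f i (bdry X i x) = bdry Y i (f (Suc i) x)) \<and>
     (\<forall>x\<in>carrier (obj X 0). augm Y (f 0 x) = \<phi> (augm X x))"


section \<open>Tensor products\<close>

text \<open>
  In the tensor product of \<^verbatim>\<open>M\<close> and \<^verbatim>\<open>P\<close> the first factor is a right module, whose action
  of \<^verbatim>\<open>a\<close> on \<^verbatim>\<open>m\<close> from the right is written \<^verbatim>\<open>a \<odot>\<^bsub>M\<^esub> m\<close>. The result is an abelian group in multiplicative
  notation, the quotient of the free abelian group on pairs by the usual relations.
\<close>

definition tensor_free :: "('r, 'm) module \<Rightarrow> ('r, 'p) module \<Rightarrow> ('m \<times> 'p \<Rightarrow>\<^sub>0 int) monoid" where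
  "tensor_free M P = free_Abelian_group (carrier M \<times> carrier P)"

definition tensor_rel ::
  "('r, 'x) ring_scheme \<Rightarrow> ('r, 'm) module \<Rightarrow> ('r, 'p) module \<Rightarrow> ('m \<times> 'p \<Rightarrow>\<^sub>0 int) set" where
  "tensor_rel R M P = generate (tensor_free M P)
    ({frag_of (m \<oplus>\<^bsub>M\<^esub> m', p) - frag_of (m, p) - frag_of (m', p) | m m' p.
        m \<in> carrier M \<and> m' \<in> carrier M \<and> p \<in> carrier P} \<union>
     {frag_of (m, p \<oplus>\<^bsub>P\<^esub> p') - frag_of (m, p) - frag_of (m, p') | m p p'.
        m \<in> carrier M \<and> p \<in> carrier P \<and> p' \<in> carrier P} \<union>
     {frag_of (a \<odot>\<^bsub>M\<^esub> m, p) - frag_of (m, a \<odot>\<^bsub>P\<^esub> p) | a m p.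
        a \<in> carrier R \<and> m \<in> carrier M \<and> p \<in> carrier P})"

definition tensor ::
  "('r, 'x) ring_scheme \<Rightarrow> ('r, 'm) module \<Rightarrow> ('r, 'p) module \<Rightarrow> ('m \<times> 'p \<Rightarrow>\<^sub>0 int) set monoid" where
  "tensor R M P = tensor_free M P Mod tensor_rel R M P"

text \<open>
  If \<^verbatim>\<open>h\<close> maps the subgroup \<^verbatim>\<open>K\<close> into the subgroup \<^verbatim>\<open>K'\<close> of \<^verbatim>\<open>G'\<close>, then the homomorphism induced by \<^verbatim>\<open>h\<close>
  on quotients sends the coset \<^verbatim>\<open>C\<close> of \<^verbatim>\<open>K\<close> to the product of \<^verbatim>\<open>K'\<close> with the image of \<^verbatim>\<open>C\<close>, which is
  the coset of \<^verbatim>\<open>K'\<close> containing that image.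
\<close>

definition quotient_map ::
  "('b, 'y) monoid_scheme \<Rightarrow> 'b set \<Rightarrow> ('a \<Rightarrow> 'b) \<Rightarrow> 'a set \<Rightarrow> 'b set" where
  "quotient_map G' K' h C = K' <#>\<^bsub>G'\<^esub> (h ` C)"

text \<open>The map \<^verbatim>\<open>u \<otimes> f\<close> into the tensor product of \<^verbatim>\<open>M'\<close> and \<^verbatim>\<open>P'\<close> over \<^verbatim>\<open>S\<close>.\<close>

definition tensor_map ::
  "('s, 'x) ring_scheme \<Rightarrow> ('s, 'm') module \<Rightarrow> ('s, 'p') module \<Rightarrow> ('m \<Rightarrow> 'm') \<Rightarrow> ('p \<Rightarrow> 'p') \<Rightarrow>
   ('m \<times> 'p \<Rightarrow>\<^sub>0 int) set \<Rightarrow> ('m' \<times> 'p' \<Rightarrow>\<^sub>0 int) set" where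
  "tensor_map S M' P' u f =
     quotient_map (tensor_free M' P') (tensor_rel S M' P')
       (frag_extend (\<lambda>(m, p). frag_of (u m, f p)))"


section \<open>Homology and Tor\<close>

text \<open>
  A nonnegatively graded chain complex of abelian groups is given by groups \<^verbatim>\<open>C i\<close> and differentials
  \<^verbatim>\<open>b i\<close> from degree \<^verbatim>\<open>i + 1\<close> to degree \<^verbatim>\<open>i\<close>; the differential out of degree \<^verbatim>\<open>0\<close> is zero.
\<close>

definition chain_cycles :: "(nat \<Rightarrow> 'g monoid) \<Rightarrow> (nat \<Rightarrow> 'g \<Rightarrow> 'g) \<Rightarrow> nat \<Rightarrow> 'g set" where
  "chain_cycles C b q =
     (case q of 0 \<Rightarrow> carrier (C 0) | Suc i \<Rightarrow> kernel (C (Suc i)) (C i) (b i))"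

definition chain_boundaries :: "(nat \<Rightarrow> 'g monoid) \<Rightarrow> (nat \<Rightarrow> 'g \<Rightarrow> 'g) \<Rightarrow> nat \<Rightarrow> 'g set" where
  "chain_boundaries C b q = b q ` carrier (C (Suc q))"

definition chain_homology :: "(nat \<Rightarrow> 'g monoid) \<Rightarrow> (nat \<Rightarrow> 'g \<Rightarrow> 'g) \<Rightarrow> nat \<Rightarrow> 'g set monoid" where
  "chain_homology C b q =
     (C q)\<lparr>carrier := chain_cycles C b q\<rparr> Mod chain_boundaries C b q"

text \<open>
  \<^verbatim>\<open>Tor R M X q\<close> is the group \<^verbatim>\<open>Tor\<^sub>q\<close> of the right module \<^verbatim>\<open>M\<close> and a left module \<^verbatim>\<open>N\<close> over \<^verbatim>\<open>R\<close>, computed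
  from a projective resolution \<^verbatim>\<open>X\<close> of \<^verbatim>\<open>N\<close>.
\<close>

definition Tor ::
  "('r, 'x) ring_scheme \<Rightarrow> ('r, 'm) module \<Rightarrow> ('r, 'p, 'n) augmented_complex \<Rightarrow> nat \<Rightarrow>
   ('m \<times> 'p \<Rightarrow>\<^sub>0 int) set set monoid" where
  "Tor R M X =
     chain_homology (\<lambda>i. tensor R M (obj X i)) (\<lambda>i. tensor_map R M (obj X i) (\<lambda>m. m) (bdry X i))"

text \<open>
  The map from Tor over another ring into \<^verbatim>\<open>Tor S M' Y q\<close> induced by a map \<^verbatim>\<open>u\<close> of right modules and
  a chain map \<^verbatim>\<open>f\<close> into the resolution \<^verbatim>\<open>Y\<close>, both semilinear along a ring homomorphism into \<^verbatim>\<open>S\<close>.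
\<close>

definition Tor_map ::
  "('s, 'x) ring_scheme \<Rightarrow> ('s, 'm') module \<Rightarrow> ('s, 'p', 'n') augmented_complex \<Rightarrow>
   ('m \<Rightarrow> 'm') \<Rightarrow> (nat \<Rightarrow> 'p \<Rightarrow> 'p') \<Rightarrow> nat \<Rightarrow>
   ('m \<times> 'p \<Rightarrow>\<^sub>0 int) set set \<Rightarrow> ('m' \<times> 'p' \<Rightarrow>\<^sub>0 int) set set" where
  "Tor_map S M' Y u f q =
     quotient_map (tensor S M' (obj Y q))
       (chain_boundaries (\<lambda>i. tensor S M' (obj Y i))
          (\<lambda>i. tensor_map S M' (obj Y i) (\<lambda>m. m) (bdry Y i)) q)
       (tensor_map S M' (obj Y q) u (f q))"


section \<open>Motzkin diagrams\<close>

text \<open>The nodes of each column are numbered \<^verbatim>\<open>0, \<dots>, n - 1\<close>; an edge is a two-element set of nodes.\<close>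

datatype node = Lft nat | Rgt nat

type_synonym diagram = "node set set"

definition nodes :: "nat \<Rightarrow> node set" where
  "nodes n = Lft ` {..<n} \<union> Rgt ` {..<n}"

text \<open>
  The order of the nodes along the boundary of the strip between the columns: along the left column
  by increasing number, then back along the right column by decreasing number. A diagram can be
  drawn between the columns without crossings iff no two of its edges interleave in this order.
\<close>

fun before :: "node \<Rightarrow> node \<Rightarrow> bool" where
  "before (Lft i) (Lft j) \<longleftrightarrow> i < j"
| "before (Lft i) (Rgt j) \<longleftrightarrow> True"
| "before (Rgt i) (Lft j) \<longleftrightarrow> False"
| "before (Rgt i) (Rgt j) \<longleftrightarrow> j < i"

definition planar_diagram :: "diagram \<Rightarrow> bool" where
  "planar_diagram d \<longleftrightarrow>
     \<not> (\<exists>a b c e. {a, c} \<in> d \<and> {b, e} \<in> d \<and> before a b \<and> before b c \<and> before c e)"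

definition motzkin_diagrams :: "nat \<Rightarrow> diagram set" where
  "motzkin_diagrams n =
     {d. d \<subseteq> {{a, b} | a b. a \<in> nodes n \<and> b \<in> nodes n \<and> a \<noteq> b} \<and>
         pairwise disjnt d \<and> planar_diagram d}"

definition identity_diagram :: "nat \<Rightarrow> diagram" where
  "identity_diagram n = {{Lft i, Rgt i} | i. i < n}"

text \<open>No missing edges, no left-to-left and no right-to-right connections.\<close>

definition permutation_like :: "nat \<Rightarrow> diagram \<Rightarrow> bool" where
  "permutation_like n d \<longleftrightarrow>
     \<Union> d = nodes n \<and> (\<forall>i j. {Lft i, Lft j} \<notin> d) \<and> (\<forall>i j. {Rgt i, Rgt j} \<notin> d)"

text \<open>
  Placing \<^verbatim>\<open>x\<close> to the left of \<^verbatim>\<open>y\<close> gives a graph on three columns. It can have two parallel edges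
  between middle nodes, one from \<^verbatim>\<open>x\<close> and one from \<^verbatim>\<open>y\<close>, so degrees are counted separately in the
  two sets of edges.
\<close>

datatype glued_node = GL nat | GM nat | GR nat

fun glue_left :: "node \<Rightarrow> glued_node" where
  "glue_left (Lft i) = GL i"
| "glue_left (Rgt i) = GM i"

fun glue_right :: "node \<Rightarrow> glued_node" where
  "glue_right (Lft i) = GM i"
| "glue_right (Rgt i) = GR i"

fun outer :: "node \<Rightarrow> glued_node" where
  "outer (Lft i) = GL i"
| "outer (Rgt i) = GR i"

definition left_edges :: "diagram \<Rightarrow> glued_node set set" where
  "left_edges x = (\<lambda>e. glue_left ` e) ` x"

definition right_edges :: "diagram \<Rightarrow> glued_node set set" where
  "right_edges y = (\<lambda>e. glue_right ` e) ` y"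

definition glued_connected :: "diagram \<Rightarrow> diagram \<Rightarrow> (glued_node \<times> glued_node) set" where
  "glued_connected x y = {(a, b). {a, b} \<in> left_edges x \<union> right_edges y}\<^sup>*"

definition glued_degree :: "diagram \<Rightarrow> diagram \<Rightarrow> glued_node \<Rightarrow> nat" where
  "glued_degree x y a = card {e \<in> left_edges x. a \<in> e} + card {e \<in> right_edges y. a \<in> e}"

definition middle_components :: "nat \<Rightarrow> diagram \<Rightarrow> diagram \<Rightarrow> glued_node set set" where
  "middle_components n x y =
     {C. C \<subseteq> range GM \<and> (\<exists>i<n. C = glued_connected x y `` {GM i})}"

text \<open>
  All degrees in the glued graph are at most two, so a component in the middle is a closed loop if
  all its nodes have degree two, and otherwise an open path, possibly a single node.
\<close>

definition closed_loops :: "nat \<Rightarrow> diagram \<Rightarrow> diagram \<Rightarrow> nat" where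
  "closed_loops n x y =
     card {C \<in> middle_components n x y. \<forall>a\<in>C. glued_degree x y a = 2}"

definition open_paths :: "nat \<Rightarrow> diagram \<Rightarrow> diagram \<Rightarrow> nat" where
  "open_paths n x y =
     card {C \<in> middle_components n x y. \<exists>a\<in>C. glued_degree x y a \<noteq> 2}"

definition compose_diagrams :: "nat \<Rightarrow> diagram \<Rightarrow> diagram \<Rightarrow> diagram" where
  "compose_diagrams n x y =
     {{a, b} | a b. a \<in> nodes n \<and> b \<in> nodes n \<and> a \<noteq> b \<and>
        (outer a, outer b) \<in> glued_connected x y}"


section \<open>Motzkin algebras\<close>

definition motzkin_algebra ::
  "('k, 'x) ring_scheme \<Rightarrow> nat \<Rightarrow> 'k \<Rightarrow> 'k \<Rightarrow> (diagram \<Rightarrow> 'k) ring" where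
  "motzkin_algebra k n \<delta> \<epsilon> =
     \<lparr>carrier = motzkin_diagrams n \<rightarrow>\<^sub>E carrier k,
      monoid.mult = (\<lambda>f g. \<lambda>d\<in>motzkin_diagrams n.
        finsum k
          (\<lambda>(x, y). (f x \<otimes>\<^bsub>k\<^esub> g y) \<otimes>\<^bsub>k\<^esub>
             (\<delta> [^]\<^bsub>k\<^esub> closed_loops n x y \<otimes>\<^bsub>k\<^esub> \<epsilon> [^]\<^bsub>k\<^esub> open_paths n x y))
          {(x, y). x \<in> motzkin_diagrams n \<and> y \<in> motzkin_diagrams n \<and> compose_diagrams n x y = d}),
      monoid.one = (\<lambda>d\<in>motzkin_diagrams n. if d = identity_diagram n then \<one>\<^bsub>k\<^esub> else \<zero>\<^bsub>k\<^esub>),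
      ring.zero = (\<lambda>d\<in>motzkin_diagrams n. \<zero>\<^bsub>k\<^esub>),
      ring.add = (\<lambda>f g. \<lambda>d\<in>motzkin_diagrams n. f d \<oplus>\<^bsub>k\<^esub> g d)\<rparr>"

text \<open>
  The inclusion of the algebra on \<^verbatim>\<open>n - 1\<close> strands into the one on \<^verbatim>\<open>n\<close> strands, for \<^verbatim>\<open>n \<ge> 1\<close>. The nodes
  of the added edge are the last ones of their columns.
\<close>

definition motzkin_inclusion ::
  "('k, 'x) ring_scheme \<Rightarrow> nat \<Rightarrow> (diagram \<Rightarrow> 'k) \<Rightarrow> (diagram \<Rightarrow> 'k)" where
  "motzkin_inclusion k n f = (\<lambda>d\<in>motzkin_diagrams n.
     (\<Oplus>\<^bsub>k\<^esub>x \<in> {x \<in> motzkin_diagrams (n - 1). insert {Lft (n - 1), Rgt (n - 1)} x = d}. f x))"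

text \<open>
  The trivial module. As the base ring is commutative, the same record also describes the
  trivial right module.
\<close>

definition trivial_module ::
  "('k, 'x) ring_scheme \<Rightarrow> nat \<Rightarrow> (diagram \<Rightarrow> 'k, 'k) module" where
  "trivial_module k n =
     \<lparr>carrier = carrier k, monoid.mult = monoid.mult k, monoid.one = monoid.one k,
      ring.zero = ring.zero k, ring.add = ring.add k,
      smult = (\<lambda>f c. (\<Oplus>\<^bsub>k\<^esub>d \<in> {d \<in> motzkin_diagrams n. permutation_like n d}. f d) \<otimes>\<^bsub>k\<^esub> c)\<rparr>"

end

theory Submission
  imports Defs "HOL-Algebra.AbelCoset"
begin

text \<open>
  A diagram other than the identity has an unconnected left node or an edge between two consecutive
  left nodes. Each of these conditions defines a right ideal spanned by diagrams, and since \<^verbatim>\<open>\<epsilon>\<close> is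
  invertible this right ideal is generated by an idempotent: a left node is dealt with by the
  diagram that leaves it and its mirror image unconnected, and an edge between left nodes by the
  diagram that has this edge and leaves the two mirror images unconnected. Two such idempotents
  either act on disjoint nodes, so that their product generates the intersection, or their right
  ideals intersect in \<^verbatim>\<open>0\<close>. As the idempotents act as \<^verbatim>\<open>0\<close> on the trivial module, all these
  intersections \<^verbatim>\<open>U\<close> satisfy \<^verbatim>\<open>Tor(U, 1) = 0\<close> in every degree. By Mayer-Vietoris the same holds for
  their sum, the augmentation ideal, and therefore \<^verbatim>\<open>Tor(1, 1)\<close> vanishes in all positive degrees, for
  every \<^verbatim>\<open>n\<close>.
\<close>

section \<open>Functionals on projective modules\<close>

text \<open>The mirror images of an edge between left nodes stay unconnected for a reason. Joining
  them too would close a loop as soon as the diagram is multiplied with itself, and the resulting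
  factor \<delta> may fail to be invertible. With unconnected mirror images the middle component is
  an open path instead, and its factor \<epsilon> can be cancelled. Projective modules are flat, so
  for a right ideal \<open>U\<close> and a resolution \<open>X\<close> the groups Tor(U, 1) are the
  homology of the subcomplex \<open>U X\<close> of \<open>X\<close>. Working inside \<open>X\<close>
  avoids tensor products with right ideals and lets one fixed but arbitrary resolution serve
  throughout. For the augmentation ideal \<open>I\<close> of the algebra \<open>A\<close>, the
  sequence \<open>0 -> I -> A -> 1 -> 0\<close> embeds Tor(1, 1) in degree \<open>q \<ge> 1\<close>
  into Tor(I, 1) in degree \<open>q - 1\<close>. This is why vanishing for \<open>I\<close> is
  required in degree 0 as well. In degree 0 the group Tor(1, 1) is \<open>k\<close>, and a chain map
  that respects the augmentations induces an isomorphism there.\<close>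

lemma linear_mapsD:
  assumes "f \<in> linear_maps R M N"
  shows "x \<in> carrier M \<Longrightarrow> f x \<in> carrier N"
    and "\<lbrakk>x \<in> carrier M; y \<in> carrier M\<rbrakk> \<Longrightarrow> f (x \<oplus>\<^bsub>M\<^esub> y) = f x \<oplus>\<^bsub>N\<^esub> f y"
    and "\<lbrakk>a \<in> carrier R; x \<in> carrier M\<rbrakk> \<Longrightarrow> f (a \<odot>\<^bsub>M\<^esub> x) = a \<odot>\<^bsub>N\<^esub> f x"
  using assms by (auto simp: linear_maps_def semilinear_maps_def)

lemma additive_zero:
  assumes "abelian_group M" "abelian_group N" "f \<in> carrier M \<rightarrow> carrier N"
    and "\<And>x y. \<lbrakk>x \<in> carrier M; y \<in> carrier M\<rbrakk> \<Longrightarrow> f (x \<oplus>\<^bsub>M\<^esub> y) = f x \<oplus>\<^bsub>N\<^esub> f y"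
  shows "f \<zero>\<^bsub>M\<^esub> = \<zero>\<^bsub>N\<^esub>"
proof -
  interpret M: abelian_group M by fact
  interpret N: abelian_group N by fact
  have "f \<zero>\<^bsub>M\<^esub> \<oplus>\<^bsub>N\<^esub> f \<zero>\<^bsub>M\<^esub> = f \<zero>\<^bsub>M\<^esub>"
    using assms(4)[of "\<zero>\<^bsub>M\<^esub>" "\<zero>\<^bsub>M\<^esub>"] by simp
  then show ?thesis
    using assms(3) N.add.l_cancel_one[of "f \<zero>\<^bsub>M\<^esub>" "f \<zero>\<^bsub>M\<^esub>"] by (auto simp: Pi_def)
qed

lemma additive_minus:
  assumes "abelian_group M" "abelian_group N" "f \<in> carrier M \<rightarrow> carrier N"
    and "\<And>x y. \<lbrakk>x \<in> carrier M; y \<in> carrier M\<rbrakk> \<Longrightarrow> f (x \<oplus>\<^bsub>M\<^esub> y) = f x \<oplus>\<^bsub>N\<^esub> f y"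
    and "x \<in> carrier M" "y \<in> carrier M"
  shows "f (x \<ominus>\<^bsub>M\<^esub> y) = f x \<ominus>\<^bsub>N\<^esub> f y"
proof -
  interpret M: abelian_group M by fact
  interpret N: abelian_group N by fact
  have c: "f x \<in> carrier N" "f y \<in> carrier N" "f (x \<ominus>\<^bsub>M\<^esub> y) \<in> carrier N"
    using assms(3,5,6) by (auto simp: Pi_def)
  have "f (x \<ominus>\<^bsub>M\<^esub> y) \<oplus>\<^bsub>N\<^esub> f y = f ((x \<ominus>\<^bsub>M\<^esub> y) \<oplus>\<^bsub>M\<^esub> y)"
    using assms(4)[of "x \<ominus>\<^bsub>M\<^esub> y" y] assms(5,6) by simp
  also have "(x \<ominus>\<^bsub>M\<^esub> y) \<oplus>\<^bsub>M\<^esub> y = x"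
    using assms(5,6) by (simp add: M.minus_eq M.a_assoc M.l_neg)
  finally have "f (x \<ominus>\<^bsub>M\<^esub> y) \<oplus>\<^bsub>N\<^esub> f y = f x" .
  then have "f x \<ominus>\<^bsub>N\<^esub> f y = (f (x \<ominus>\<^bsub>M\<^esub> y) \<oplus>\<^bsub>N\<^esub> f y) \<ominus>\<^bsub>N\<^esub> f y" by simp
  also have "\<dots> = f (x \<ominus>\<^bsub>M\<^esub> y)"
    using c by (simp add: N.minus_eq N.a_assoc N.r_neg)
  finally show ?thesis by simp
qed

lemma minus_eq_zeroD:
  assumes "abelian_group M" "x \<in> carrier M" "y \<in> carrier M" "x \<ominus>\<^bsub>M\<^esub> y = \<zero>\<^bsub>M\<^esub>"
  shows "x = y"
proof -
  interpret M: abelian_group M by fact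
  have "x = (x \<ominus>\<^bsub>M\<^esub> y) \<oplus>\<^bsub>M\<^esub> y"
    using assms(2,3) by (simp add: M.minus_eq M.a_assoc M.l_neg)
  then show ?thesis using assms by simp
qed

lemma left_module_zero_smult:
  assumes "left_module R M" "x \<in> carrier M"
  shows "\<zero>\<^bsub>R\<^esub> \<odot>\<^bsub>M\<^esub> x = \<zero>\<^bsub>M\<^esub>"
proof -
  interpret M: left_module R M by fact
  show ?thesis
    using additive_zero[of R M "\<lambda>a. a \<odot>\<^bsub>M\<^esub> x"] M.smult_l_distr M.smult_closed assms(2)
      M.M.abelian_group_axioms M.R.abelian_group_axioms
    by (auto simp: Pi_def)
qed

lemma linear_maps_minus:
  assumes "left_module R M" "left_module R N" "f \<in> linear_maps R M N"
    and "x \<in> carrier M" "y \<in> carrier M"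
  shows "f (x \<ominus>\<^bsub>M\<^esub> y) = f x \<ominus>\<^bsub>N\<^esub> f y"
  using assms linear_mapsD[OF assms(3)]
  by (intro additive_minus) (auto simp: left_module_def)

text \<open>The values lie in the ring itself rather than in a \<open>module\<close> record for
  \<open>R\<close> over itself, so that they can be tested directly for membership in right
  ideals.\<close>

definition functionals :: "('r, 'x) ring_scheme \<Rightarrow> ('r, 'p) module \<Rightarrow> ('p \<Rightarrow> 'r) set" where
  "functionals R P = {\<phi> \<in> carrier P \<rightarrow> carrier R.
     (\<forall>x\<in>carrier P. \<forall>y\<in>carrier P. \<phi> (x \<oplus>\<^bsub>P\<^esub> y) = \<phi> x \<oplus>\<^bsub>R\<^esub> \<phi> y) \<and>
     (\<forall>a\<in>carrier R. \<forall>x\<in>carrier P. \<phi> (a \<odot>\<^bsub>P\<^esub> x) = a \<otimes>\<^bsub>R\<^esub> \<phi> x)}"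

lemma functionalsD:
  assumes "\<phi> \<in> functionals R P"
  shows "x \<in> carrier P \<Longrightarrow> \<phi> x \<in> carrier R"
    and "\<lbrakk>x \<in> carrier P; y \<in> carrier P\<rbrakk> \<Longrightarrow> \<phi> (x \<oplus>\<^bsub>P\<^esub> y) = \<phi> x \<oplus>\<^bsub>R\<^esub> \<phi> y"
    and "\<lbrakk>a \<in> carrier R; x \<in> carrier P\<rbrakk> \<Longrightarrow> \<phi> (a \<odot>\<^bsub>P\<^esub> x) = a \<otimes>\<^bsub>R\<^esub> \<phi> x"
  using assms by (auto simp: functionals_def)

lemma functionals_zero:
  assumes "left_module R P" "\<phi> \<in> functionals R P"
  shows "\<phi> \<zero>\<^bsub>P\<^esub> = \<zero>\<^bsub>R\<^esub>"
  using assms functionalsD[OF assms(2)]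
  by (intro additive_zero) (auto simp: left_module_def ring_def)

lemma functionals_minus:
  assumes "left_module R P" "\<phi> \<in> functionals R P"
    and "x \<in> carrier P" "y \<in> carrier P"
  shows "\<phi> (x \<ominus>\<^bsub>P\<^esub> y) = \<phi> x \<ominus>\<^bsub>R\<^esub> \<phi> y"
  using assms functionalsD[OF assms(2)]
  by (intro additive_minus) (auto simp: left_module_def ring_def)

lemma functionals_comp:
  assumes "f \<in> linear_maps R P Q" "\<phi> \<in> functionals R Q"
  shows "(\<lambda>x. \<phi> (f x)) \<in> functionals R P"
  using linear_mapsD[OF assms(1)] assms(2) by (auto simp: functionals_def)

lemma functionals_free: "j \<in> I \<Longrightarrow> (\<lambda>f. f j) \<in> functionals R (free_left_module R I)"
  by (auto simp: functionals_def free_left_module_def)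

text \<open>A retract of a free module embeds into it, and the coordinates of the free module pull
  back to functionals. Hence equations in a projective module may be checked on functionals.\<close>

lemma projective_separated:
  fixes P :: "('r, 'p) module"
  assumes "projective_left_module R P" "x \<in> carrier P" "y \<in> carrier P"
    and "\<And>\<phi>. \<phi> \<in> functionals R P \<Longrightarrow> \<phi> x = \<phi> y"
  shows "x = y"
proof -
  from assms(1) obtain I :: "'p set" and i r where i: "i \<in> linear_maps R P (free_left_module R I)"
    and r: "\<forall>x\<in>carrier P. r (i x) = x"
    unfolding projective_left_module_def by blast
  have "i x j = i y j" if "j \<in> I" for j
    using assms(4)[OF functionals_comp[OF i functionals_free[OF that]]] .
  moreover have "i x \<in> I \<rightarrow>\<^sub>E carrier R" "i y \<in> I \<rightarrow>\<^sub>E carrier R"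
    using linear_mapsD(1)[OF i] assms(2,3) by (auto simp: free_left_module_def)
  ultimately have "i x = i y" by (intro PiE_ext)
  then show ?thesis using r assms(2,3) by metis
qed

text \<open>
  For a projective module \<^verbatim>\<open>P\<close> and a right ideal \<^verbatim>\<open>U\<close> this is the additive subgroup \<^verbatim>\<open>U P\<close>. Defining it through
  functionals makes it compatible with intersections of right ideals.
\<close>

definition ideal_multiples ::
  "('r, 'x) ring_scheme \<Rightarrow> 'r set \<Rightarrow> ('r, 'p) module \<Rightarrow> 'p set" where
  "ideal_multiples R U P = {p \<in> carrier P. \<forall>\<phi>\<in>functionals R P. \<phi> p \<in> U}"

lemma ideal_multiples_carrier: "p \<in> ideal_multiples R U P \<Longrightarrow> p \<in> carrier P"
  by (simp add: ideal_multiples_def)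

lemma ideal_multiplesD: "\<lbrakk>p \<in> ideal_multiples R U P; \<phi> \<in> functionals R P\<rbrakk> \<Longrightarrow> \<phi> p \<in> U"
  by (simp add: ideal_multiples_def)

lemma ideal_multiples_Int:
  "ideal_multiples R (U \<inter> V) P = ideal_multiples R U P \<inter> ideal_multiples R V P"
  by (auto simp: ideal_multiples_def)

text \<open>A functional on \<open>Q\<close> pulls back along \<open>f\<close> to one on
  \<open>P\<close>. For a resolution \<open>X\<close> this makes the groups \<open>U X\<close> a
  subcomplex.\<close>

lemma ideal_multiples_linear:
  assumes "f \<in> linear_maps R P Q" "p \<in> ideal_multiples R U P"
  shows "f p \<in> ideal_multiples R U Q"
proof -
  have "\<phi> (f p) \<in> U" if "\<phi> \<in> functionals R Q" for \<phi>
    by (rule ideal_multiplesD[OF assms(2) functionals_comp[OF assms(1) that]])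
  then show ?thesis
    using linear_mapsD(1)[OF assms(1)] assms(2) by (simp add: ideal_multiples_def)
qed

text \<open>The dual basis lemma, in the form of an induction rule.\<close>

lemma projective_induct [consumes 3, case_names zero add]:
  fixes P :: "('r, 'p) module"
  assumes proj: "projective_left_module R P" and p: "p \<in> ideal_multiples R V P"
    and V: "\<zero>\<^bsub>R\<^esub> \<in> V" and zero: "Q \<zero>\<^bsub>P\<^esub>"
    and add: "\<And>x a b. \<lbrakk>x \<in> carrier P; Q x; a \<in> carrier R; a \<in> V; b \<in> carrier P\<rbrakk> \<Longrightarrow>
      Q (x \<oplus>\<^bsub>P\<^esub> a \<odot>\<^bsub>P\<^esub> b)"
  shows "Q p"
proof -
  from proj obtain I :: "'p set" and i r where i: "i \<in> linear_maps R P (free_left_module R I)"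
    and r: "r \<in> linear_maps R (free_left_module R I) P"
    and ri: "\<forall>x\<in>carrier P. r (i x) = x" and lm: "left_module R P"
    unfolding projective_left_module_def by blast
  interpret P: left_module R P by (fact lm)
  let ?F = "free_left_module R I"
  \<comment> \<open>The standard basis of the free module.\<close>
  define \<delta> where "\<delta> j = (\<lambda>l\<in>I. if l = j then \<one>\<^bsub>R\<^esub> else \<zero>\<^bsub>R\<^esub>)" for j
  have \<delta>: "\<delta> j \<in> carrier ?F" for j
    by (auto simp: \<delta>_def free_left_module_def intro: finite_subset[of _ "{j}"])
  have zF: "(\<lambda>l\<in>I. \<zero>\<^bsub>R\<^esub>) \<in> carrier ?F"
    by (auto simp: free_left_module_def)
  have "r (\<lambda>l\<in>I. \<zero>\<^bsub>R\<^esub>) = \<zero>\<^bsub>P\<^esub>"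
  proof -
    have "\<zero>\<^bsub>R\<^esub> \<odot>\<^bsub>?F\<^esub> (\<lambda>l\<in>I. \<zero>\<^bsub>R\<^esub>) = (\<lambda>l\<in>I. \<zero>\<^bsub>R\<^esub>)"
      by (auto simp: free_left_module_def)
    then have "r (\<lambda>l\<in>I. \<zero>\<^bsub>R\<^esub>) = \<zero>\<^bsub>R\<^esub> \<odot>\<^bsub>P\<^esub> r (\<lambda>l\<in>I. \<zero>\<^bsub>R\<^esub>)"
      using linear_mapsD(3)[OF r, of "\<zero>\<^bsub>R\<^esub>", OF _ zF] by simp
    then show ?thesis
      using left_module_zero_smult[OF lm] linear_mapsD(1)[OF r zF] by simp
  qed
  note r0 = this
  \<comment> \<open>Induction on the support, for all families with entries in \<open>V\<close>;
    each step splits off one coordinate \<open>j\<close> as a multiple of the basis vector.\<close>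
  have main: "\<lbrakk>f \<in> carrier ?F; \<forall>j\<in>I. f j \<in> V; S = {j \<in> I. f j \<noteq> \<zero>\<^bsub>R\<^esub>}\<rbrakk> \<Longrightarrow> Q (r f)"
    if "finite S" for S f
    using that
  proof (induction S arbitrary: f rule: finite_induct)
    case empty
    then have "f = (\<lambda>l\<in>I. \<zero>\<^bsub>R\<^esub>)"
      by (intro PiE_ext[of f I "\<lambda>_. carrier R"]) (auto simp: free_left_module_def)
    then show ?case using r0 zero by (simp only:)
  next
    case (insert j S)
    define g where "g = (\<lambda>l\<in>I. if l = j then \<zero>\<^bsub>R\<^esub> else f l)"
    have j: "j \<in> I" "f j \<in> carrier R" "f j \<noteq> \<zero>\<^bsub>R\<^esub>"
      using insert.prems by (auto simp: free_left_module_def PiE_mem)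
    have fI: "f \<in> I \<rightarrow>\<^sub>E carrier R" using insert.prems by (simp add: free_left_module_def)
    have S: "{l \<in> I. g l \<noteq> \<zero>\<^bsub>R\<^esub>} = S"
      using insert.prems(3) insert.hyps(2) by (auto simp: g_def split: if_splits)
    have gF: "g \<in> carrier ?F"
      using fI S insert.hyps(1) by (auto simp: free_left_module_def g_def PiE_mem)
    have fg: "f = g \<oplus>\<^bsub>?F\<^esub> f j \<odot>\<^bsub>?F\<^esub> \<delta> j"
    proof (rule PiE_ext[OF fI])
      show "g \<oplus>\<^bsub>?F\<^esub> f j \<odot>\<^bsub>?F\<^esub> \<delta> j \<in> I \<rightarrow>\<^sub>E carrier R"
        using gF \<delta>[of j] j by (auto simp: free_left_module_def PiE_mem simp del: PiE_iff intro!: P.R.a_closed P.R.m_closed)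
    qed (use PiE_mem[OF fI] j in \<open>auto simp: free_left_module_def g_def \<delta>_def\<close>)
    have smF: "f j \<odot>\<^bsub>?F\<^esub> \<delta> j \<in> carrier ?F"
      using j by (auto simp: \<delta>_def free_left_module_def intro: finite_subset[of _ "{j}"])
    have rf: "r f = r g \<oplus>\<^bsub>P\<^esub> f j \<odot>\<^bsub>P\<^esub> r (\<delta> j)"
      using linear_mapsD(2)[OF r gF smF] linear_mapsD(3)[OF r j(2) \<delta>] fg by metis
    have "Q (r g)"
      using insert.prems(2) V S by (intro insert.IH[OF gF]) (auto simp: g_def)
    moreover have "f j \<in> V" using insert.prems(2) j(1) by simp
    ultimately show ?case
      unfolding rf by (intro add linear_mapsD(1)[OF r] gF \<delta> j(2))
  qed
  \<comment> \<open>The coordinates of \<open>i p\<close> are functionals of \<open>p\<close>; this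
    is how membership in \<open>ideal_multiples\<close> provides coefficients in
    \<open>V\<close>.\<close>
  have "\<forall>j\<in>I. i p j \<in> V"
    using ideal_multiplesD[OF p functionals_comp[OF i functionals_free]] by blast
  moreover have pc: "p \<in> carrier P" using p by (rule ideal_multiples_carrier)
  moreover from this have "i p \<in> carrier ?F" using linear_mapsD(1)[OF i] by simp
  moreover from this have "finite {j \<in> I. i p j \<noteq> \<zero>\<^bsub>R\<^esub>}" by (simp add: free_left_module_def)
  ultimately have "Q (r (i p))" by (intro main[OF _ _ _ refl])
  with ri pc show ?thesis by simp
qed

section \<open>Right ideals and their multiples in a module\<close>

definition right_ideal :: "('r, 'x) ring_scheme \<Rightarrow> 'r set \<Rightarrow> bool" where
  "right_ideal R U \<longleftrightarrow> U \<subseteq> carrier R \<and> \<zero>\<^bsub>R\<^esub> \<in> U \<and>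
     (\<forall>a\<in>U. \<forall>b\<in>U. a \<oplus>\<^bsub>R\<^esub> b \<in> U) \<and> (\<forall>a\<in>U. \<forall>b\<in>carrier R. a \<otimes>\<^bsub>R\<^esub> b \<in> U)"

text \<open>\<open>right_ideal\<close> asks for sums and right multiples only; a negative is the
  right multiple by \<open>-1\<close>.\<close>

lemma right_ideal_minus:
  assumes "ring R" "right_ideal R U" "a \<in> U" "b \<in> U"
  shows "a \<ominus>\<^bsub>R\<^esub> b \<in> U"
proof -
  interpret R: ring R by fact
  have "b \<otimes>\<^bsub>R\<^esub> (\<ominus>\<^bsub>R\<^esub> \<one>\<^bsub>R\<^esub>) \<in> U" "b \<in> carrier R"
    using assms by (auto simp: right_ideal_def)
  then have "\<ominus>\<^bsub>R\<^esub> b \<in> U" by (simp add: R.r_minus)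
  then show ?thesis using assms unfolding right_ideal_def R.minus_eq by blast
qed

lemma right_ideal_Int:
  "\<lbrakk>right_ideal R U; right_ideal R V\<rbrakk> \<Longrightarrow> right_ideal R (U \<inter> V)"
  by (auto simp: right_ideal_def)

context
  fixes R :: "('r, 'x) ring_scheme" and P :: "('r, 'p) module"
  assumes mod: "left_module R P"
begin

interpretation P: left_module R P by (fact mod)

lemma zero_ideal_multiples: "right_ideal R U \<Longrightarrow> \<zero>\<^bsub>P\<^esub> \<in> ideal_multiples R U P"
  by (simp add: ideal_multiples_def right_ideal_def functionals_zero[OF mod])

lemma add_ideal_multiples:
  "\<lbrakk>right_ideal R U; x \<in> ideal_multiples R U P; y \<in> ideal_multiples R U P\<rbrakk> \<Longrightarrow>
    x \<oplus>\<^bsub>P\<^esub> y \<in> ideal_multiples R U P"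
  by (simp add: ideal_multiples_def right_ideal_def functionals_def)

lemma minus_ideal_multiples:
  "\<lbrakk>right_ideal R U; x \<in> ideal_multiples R U P; y \<in> ideal_multiples R U P\<rbrakk> \<Longrightarrow>
    x \<ominus>\<^bsub>P\<^esub> y \<in> ideal_multiples R U P"
  by (simp add: ideal_multiples_def functionals_minus[OF mod] right_ideal_minus[OF P.R.ring_axioms])

lemma smult_ideal_multiples:
  "\<lbrakk>right_ideal R U; a \<in> U; x \<in> carrier P\<rbrakk> \<Longrightarrow> a \<odot>\<^bsub>P\<^esub> x \<in> ideal_multiples R U P"
  by (simp add: ideal_multiples_def right_ideal_def functionals_def P.smult_closed Pi_iff subset_iff)

end

lemma projective_left_moduleD: "projective_left_module R P \<Longrightarrow> left_module R P"
  by (simp add: projective_left_module_def)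

text \<open>Splitting the value of each functional separately would not produce elements of
  \<open>P\<close>. The dual basis expansion writes \<open>p\<close> as a sum of terms
  \<open>a b\<close> with \<open>a\<close> in \<open>U + V\<close>, and \<open>a = u + v\<close>
  splits each term.\<close>

lemma ideal_multiples_set_add:
  assumes proj: "projective_left_module R P" and U: "right_ideal R U" and V: "right_ideal R V"
    and "p \<in> ideal_multiples R (U <+>\<^bsub>R\<^esub> V) P"
  shows "\<exists>x\<in>ideal_multiples R U P. \<exists>y\<in>ideal_multiples R V P. p = x \<oplus>\<^bsub>P\<^esub> y"
proof -
  note lm = projective_left_moduleD[OF proj]
  interpret P: left_module R P by (fact lm)
  have "\<zero>\<^bsub>R\<^esub> \<in> U <+>\<^bsub>R\<^esub> V"
    using U V P.R.r_zero[OF P.R.zero_closed] unfolding set_add_def' right_ideal_def by force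
  with proj assms(4) show ?thesis
  proof (induction rule: projective_induct)
    case zero
    show ?case
      using zero_ideal_multiples[OF lm U] zero_ideal_multiples[OF lm V] by force
  next
    case (add p a b)
    from add.hyps(3) obtain u v where uv: "u \<in> U" "v \<in> V" "a = u \<oplus>\<^bsub>R\<^esub> v"
      unfolding set_add_def' by auto
    from add.IH obtain x y where xy: "x \<in> ideal_multiples R U P" "y \<in> ideal_multiples R V P"
      "p = x \<oplus>\<^bsub>P\<^esub> y" by blast
    have c: "u \<in> carrier R" "v \<in> carrier R" "x \<in> carrier P" "y \<in> carrier P"
      using uv xy U V by (auto simp: right_ideal_def ideal_multiples_def)
    have "p \<oplus>\<^bsub>P\<^esub> a \<odot>\<^bsub>P\<^esub> b = (x \<oplus>\<^bsub>P\<^esub> u \<odot>\<^bsub>P\<^esub> b) \<oplus>\<^bsub>P\<^esub> (y \<oplus>\<^bsub>P\<^esub> v \<odot>\<^bsub>P\<^esub> b)"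
      using c add.hyps uv xy by (simp add: P.smult_l_distr P.smult_closed P.M.add.m_ac)
    moreover have "x \<oplus>\<^bsub>P\<^esub> u \<odot>\<^bsub>P\<^esub> b \<in> ideal_multiples R U P" "y \<oplus>\<^bsub>P\<^esub> v \<odot>\<^bsub>P\<^esub> b \<in> ideal_multiples R V P"
      using uv xy U V add.hyps by (auto intro!: add_ideal_multiples smult_ideal_multiples lm)
    ultimately show ?case by blast
  qed
qed

text \<open>Every functional satisfies \<open>\<phi> (f p) = f \<phi>(p) = \<phi>(p)\<close> because
  \<open>\<phi>(p)\<close> lies in \<open>U\<close>, and functionals separate points.\<close>

lemma ideal_multiples_left_unit:
  assumes proj: "projective_left_module R P" and f: "f \<in> carrier R" "\<And>u. u \<in> U \<Longrightarrow> f \<otimes>\<^bsub>R\<^esub> u = u"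
    and p: "p \<in> ideal_multiples R U P"
  shows "f \<odot>\<^bsub>P\<^esub> p = p"
proof -
  interpret P: left_module R P by (rule projective_left_moduleD[OF proj])
  have pc: "p \<in> carrier P" using p by (rule ideal_multiples_carrier)
  show ?thesis
  proof (rule projective_separated[OF proj _ pc])
    show "f \<odot>\<^bsub>P\<^esub> p \<in> carrier P" using f pc by (simp add: P.smult_closed)
    show "\<phi> (f \<odot>\<^bsub>P\<^esub> p) = \<phi> p" if "\<phi> \<in> functionals R P" for \<phi>
      using functionalsD(3)[OF that f(1) pc] f(2) p that by (simp add: ideal_multiples_def)
  qed
qed


section \<open>Right ideals acyclic for a resolution\<close>

text \<open>
  For a projective resolution \<^verbatim>\<open>X\<close> of \<^verbatim>\<open>N\<close> this says that \<^verbatim>\<open>Tor(U, N)\<close> vanishes in all degrees, including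
  degree \<^verbatim>\<open>0\<close>.
\<close>

definition acyclic_ideal ::
  "('r, 'x) ring_scheme \<Rightarrow> ('r, 'p, 'n) augmented_complex \<Rightarrow> 'r set \<Rightarrow> bool" where
  "acyclic_ideal R X U \<longleftrightarrow>
     (\<forall>q. \<forall>x\<in>ideal_multiples R U (obj X q).
        (\<forall>i. q = Suc i \<longrightarrow> bdry X i x = \<zero>\<^bsub>obj X i\<^esub>) \<longrightarrow>
        (\<exists>y\<in>ideal_multiples R U (obj X (Suc q)). bdry X q y = x))"

lemma acyclic_idealD:
  assumes "acyclic_ideal R X U" "x \<in> ideal_multiples R U (obj X q)"
    and "\<And>i. q = Suc i \<Longrightarrow> bdry X i x = \<zero>\<^bsub>obj X i\<^esub>"
  obtains y where "y \<in> ideal_multiples R U (obj X (Suc q))" "bdry X q y = x"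
  using assms unfolding acyclic_ideal_def by meson

context
  fixes R :: "('r, 'x) ring_scheme" and N :: "('r, 'n) module"
    and X :: "('r, 'p, 'n) augmented_complex"
  assumes res: "projective_resolution R N X"
begin

lemma resolution_projective: "projective_left_module R (obj X i)"
  and resolution_bdry: "bdry X i \<in> linear_maps R (obj X (Suc i)) (obj X i)"
  and resolution_augm: "augm X \<in> linear_maps R (obj X 0) N"
  and resolution_left_module: "left_module R N"
  using res by (auto simp: projective_resolution_def)

lemma resolution_module: "left_module R (obj X i)"
  by (rule projective_left_moduleD[OF resolution_projective])

lemma resolution_kernel:
  "bdry X (Suc i) ` carrier (obj X (Suc (Suc i))) =
    {x \<in> carrier (obj X (Suc i)). bdry X i x = \<zero>\<^bsub>obj X i\<^esub>}"
  and resolution_kernel_0: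
  "bdry X 0 ` carrier (obj X 1) = {x \<in> carrier (obj X 0). augm X x = \<zero>\<^bsub>N\<^esub>}"
  and resolution_augm_image: "augm X ` carrier (obj X 0) = carrier N"
  using res by (simp_all add: projective_resolution_def)

lemma resolution_bdry_bdry:
  assumes "x \<in> carrier (obj X (Suc (Suc i)))"
  shows "bdry X i (bdry X (Suc i) x) = \<zero>\<^bsub>obj X i\<^esub>"
  using imageI[OF assms, of "bdry X (Suc i)"] unfolding resolution_kernel by simp

lemma resolution_augm_bdry:
  assumes "x \<in> carrier (obj X 1)"
  shows "augm X (bdry X 0 x) = \<zero>\<^bsub>N\<^esub>"
  using imageI[OF assms, of "bdry X 0"] unfolding resolution_kernel_0 by simp

lemma resolution_exact:
  assumes "x \<in> carrier (obj X (Suc i))" "bdry X i x = \<zero>\<^bsub>obj X i\<^esub>"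
  shows "\<exists>y\<in>carrier (obj X (Suc (Suc i))). bdry X (Suc i) y = x"
proof -
  have "x \<in> bdry X (Suc i) ` carrier (obj X (Suc (Suc i)))"
    using assms unfolding resolution_kernel by simp
  then show ?thesis by (elim imageE) (rule bexI, rule sym)
qed

lemma resolution_exact_0:
  assumes "x \<in> carrier (obj X 0)" "augm X x = \<zero>\<^bsub>N\<^esub>"
  shows "\<exists>y\<in>carrier (obj X 1). bdry X 0 y = x"
proof -
  have "x \<in> bdry X 0 ` carrier (obj X 1)"
    using assms unfolding resolution_kernel_0 by simp
  then show ?thesis by (elim imageE) (rule bexI, rule sym)
qed

lemma resolution_augm_surj:
  assumes "c \<in> carrier N"
  shows "\<exists>x\<in>carrier (obj X 0). augm X x = c"
proof -
  have "c \<in> augm X ` carrier (obj X 0)"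
    using assms unfolding resolution_augm_image by simp
  then show ?thesis by (elim imageE) (rule bexI, rule sym)
qed

text \<open>On \<open>U X\<close> the element \<open>f\<close> acts as the identity, on
  \<open>N\<close> as zero. Therefore a cycle of \<open>U X\<close> is a boundary in
  \<open>X\<close>, and multiplying a preimage by \<open>f\<close> moves it into \<open>U X\<close>
  without changing its boundary.\<close>

lemma acyclic_ideal_left_unit:
  assumes U: "right_ideal R U" and f: "f \<in> U" "\<And>u. u \<in> U \<Longrightarrow> f \<otimes>\<^bsub>R\<^esub> u = u"
    and fN: "\<And>c. c \<in> carrier N \<Longrightarrow> f \<odot>\<^bsub>N\<^esub> c = \<zero>\<^bsub>N\<^esub>"
  shows "acyclic_ideal R X U"
  unfolding acyclic_ideal_def
proof (intro allI ballI impI)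
  fix q x assume x: "x \<in> ideal_multiples R U (obj X q)"
    and cyc: "\<forall>i. q = Suc i \<longrightarrow> bdry X i x = \<zero>\<^bsub>obj X i\<^esub>"
  have fR: "f \<in> carrier R" using f U by (auto simp: right_ideal_def)
  note fx = ideal_multiples_left_unit[OF resolution_projective fR f(2) x]
  note xc = ideal_multiples_carrier[OF x]
  have "\<exists>y\<in>carrier (obj X (Suc q)). bdry X q y = x"
  proof (cases q)
    case 0
    \<comment> \<open>In degree 0 there is no cycle condition; instead \<open>x = f x\<close> forces
      the augmentation of \<open>x\<close> to vanish.\<close>
    have "augm X x = f \<odot>\<^bsub>N\<^esub> augm X x"
      using linear_mapsD(3)[OF resolution_augm fR, of x] fx xc 0 by simp
    then have "augm X x = \<zero>\<^bsub>N\<^esub>"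
      using fN linear_mapsD(1)[OF resolution_augm] xc 0 by simp
    then show ?thesis using resolution_exact_0 xc 0 by simp
  next
    case (Suc i)
    then show ?thesis using resolution_exact xc cyc by simp
  qed
  then obtain y where y: "y \<in> carrier (obj X (Suc q))" "bdry X q y = x" by blast
  have "bdry X q (f \<odot>\<^bsub>obj X (Suc q)\<^esub> y) = x"
    using linear_mapsD(3)[OF resolution_bdry fR y(1)] y(2) fx by simp
  moreover have "f \<odot>\<^bsub>obj X (Suc q)\<^esub> y \<in> ideal_multiples R U (obj X (Suc q))"
    using smult_ideal_multiples[OF resolution_module U f(1) y(1)] .
  ultimately show "\<exists>y\<in>ideal_multiples R U (obj X (Suc q)). bdry X q y = x" by blast
qed

text \<open>
  Mayer-Vietoris: if \<^verbatim>\<open>x + y\<close> is a cycle, then the boundaries of \<^verbatim>\<open>x\<close> and \<^verbatim>\<open>y\<close> agree up to sign, so they lie in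
  \<^verbatim>\<open>(U \<inter> V) X\<close>.
\<close>

lemma acyclic_ideal_set_add:
  assumes U: "right_ideal R U" and V: "right_ideal R V"
    and acU: "acyclic_ideal R X U" and acV: "acyclic_ideal R X V"
    and acI: "acyclic_ideal R X (U \<inter> V)"
  shows "acyclic_ideal R X (U <+>\<^bsub>R\<^esub> V)"
  unfolding acyclic_ideal_def
proof (intro allI ballI impI)
  fix q p assume p: "p \<in> ideal_multiples R (U <+>\<^bsub>R\<^esub> V) (obj X q)"
    and cyc: "\<forall>i. q = Suc i \<longrightarrow> bdry X i p = \<zero>\<^bsub>obj X i\<^esub>"
  note lm = resolution_module
  interpret Xq: left_module R "obj X q" by (rule lm)
  interpret XS: left_module R "obj X (Suc q)" by (rule lm)
  have UV: "right_ideal R (U \<inter> V)" using U V by (rule right_ideal_Int)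
  from ideal_multiples_set_add[OF resolution_projective U V p]
  obtain x y where x: "x \<in> ideal_multiples R U (obj X q)" and y: "y \<in> ideal_multiples R V (obj X q)"
    and pxy: "p = x \<oplus>\<^bsub>obj X q\<^esub> y" by blast
  note xc = ideal_multiples_carrier[OF x] and yc = ideal_multiples_carrier[OF y]
  \<comment> \<open>The boundary of \<open>x\<close> is a cycle of \<open>(U \<inter> V) X\<close>.
    A preimage \<open>z\<close> there turns \<open>x - z\<close> and \<open>y + z\<close> into
    cycles of \<open>U X\<close> and \<open>V X\<close> that still add up to \<open>p\<close>. In
    degree 0 nothing is required of \<open>z\<close>, and zero will do.\<close>
  have "\<exists>z\<in>ideal_multiples R (U \<inter> V) (obj X q). \<forall>i. q = Suc i \<longrightarrow> bdry X i z = bdry X i x"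
  proof (cases q)
    case 0
    then show ?thesis using zero_ideal_multiples[OF lm UV] by blast
  next
    case (Suc i)
    interpret Xi: left_module R "obj X i" by (rule lm)
    note b = resolution_bdry[of i]
    have bc: "bdry X i x \<in> carrier (obj X i)" "bdry X i y \<in> carrier (obj X i)"
      using linear_mapsD(1)[OF b] xc yc Suc by auto
    have "bdry X i x \<oplus>\<^bsub>obj X i\<^esub> bdry X i y = \<zero>\<^bsub>obj X i\<^esub>"
      using linear_mapsD(2)[OF b] xc yc Suc cyc pxy by simp
    then have "bdry X i x = \<ominus>\<^bsub>obj X i\<^esub> bdry X i y"
      using bc Xi.M.minus_equality by metis
    \<comment> \<open>The negative is written as a difference to fit
      \<open>minus_ideal_multiples\<close>, which then puts the boundary of \<open>x\<close> into
      \<open>V X\<close> as well.\<close>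
    then have xy: "bdry X i x = \<zero>\<^bsub>obj X i\<^esub> \<ominus>\<^bsub>obj X i\<^esub> bdry X i y"
      using bc by (simp add: Xi.M.minus_eq)
    have "bdry X i x \<in> ideal_multiples R U (obj X i)" "bdry X i y \<in> ideal_multiples R V (obj X i)"
      using ideal_multiples_linear[OF b] x y Suc by auto
    moreover from this(2) have "bdry X i x \<in> ideal_multiples R V (obj X i)"
      unfolding xy using minus_ideal_multiples[OF lm V] zero_ideal_multiples[OF lm V] by blast
    ultimately have "bdry X i x \<in> ideal_multiples R (U \<inter> V) (obj X i)"
      by (simp add: ideal_multiples_Int)
    moreover have "bdry X l (bdry X i x) = \<zero>\<^bsub>obj X l\<^esub>" if "i = Suc l" for l
      using resolution_bdry_bdry[of x l] xc Suc that by simp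
    ultimately obtain z where "z \<in> ideal_multiples R (U \<inter> V) (obj X (Suc i))" "bdry X i z = bdry X i x"
      by (rule acyclic_idealD[OF acI])
    with Suc show ?thesis by (intro bexI[of _ z]) auto
  qed
  then obtain z where z: "z \<in> ideal_multiples R (U \<inter> V) (obj X q)"
    and dz: "\<And>i. q = Suc i \<Longrightarrow> bdry X i z = bdry X i x" by blast
  have zU: "z \<in> ideal_multiples R U (obj X q)" and zV: "z \<in> ideal_multiples R V (obj X q)"
    using z by (simp_all add: ideal_multiples_Int)
  note zc = ideal_multiples_carrier[OF z]
  have dxz: "bdry X i (x \<ominus>\<^bsub>obj X q\<^esub> z) = \<zero>\<^bsub>obj X i\<^esub>" if q: "q = Suc i" for i
  proof -
    interpret Xi: left_module R "obj X i" by (rule lm)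
    show "bdry X i (x \<ominus>\<^bsub>obj X q\<^esub> z) = \<zero>\<^bsub>obj X i\<^esub>"
      using linear_maps_minus[OF lm lm resolution_bdry] dz[OF q] xc zc linear_mapsD(1)[OF resolution_bdry] q
      by (simp add: Xi.M.r_neg Xi.M.minus_eq)
  qed
  from acyclic_idealD[OF acU minus_ideal_multiples[OF lm U x zU] dxz] obtain s where
    s: "s \<in> ideal_multiples R U (obj X (Suc q))" "bdry X q s = x \<ominus>\<^bsub>obj X q\<^esub> z" .
  have dyz: "bdry X i (y \<oplus>\<^bsub>obj X q\<^esub> z) = \<zero>\<^bsub>obj X i\<^esub>" if q: "q = Suc i" for i
  proof -
    interpret Xi: left_module R "obj X i" by (rule lm)
    have "bdry X i (y \<oplus>\<^bsub>obj X q\<^esub> z) = bdry X i y \<oplus>\<^bsub>obj X i\<^esub> bdry X i x"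
      using linear_mapsD(2)[OF resolution_bdry] dz[OF q] yc zc q by simp
    also have "\<dots> = bdry X i p"
      using linear_mapsD(1,2)[OF resolution_bdry] xc yc q pxy by (simp add: Xi.M.a_comm)
    finally show "bdry X i (y \<oplus>\<^bsub>obj X q\<^esub> z) = \<zero>\<^bsub>obj X i\<^esub>" using cyc q by simp
  qed
  from acyclic_idealD[OF acV add_ideal_multiples[OF lm V y zV] dyz] obtain t where
    t: "t \<in> ideal_multiples R V (obj X (Suc q))" "bdry X q t = y \<oplus>\<^bsub>obj X q\<^esub> z" .
  note sc = ideal_multiples_carrier[OF s(1)] and tc = ideal_multiples_carrier[OF t(1)]
  have "bdry X q (s \<oplus>\<^bsub>obj X (Suc q)\<^esub> t) = (x \<ominus>\<^bsub>obj X q\<^esub> z) \<oplus>\<^bsub>obj X q\<^esub> (y \<oplus>\<^bsub>obj X q\<^esub> z)"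
    using linear_mapsD(2)[OF resolution_bdry sc tc] s(2) t(2) by simp
  also have "\<dots> = p"
  proof -
    have "(x \<ominus>\<^bsub>obj X q\<^esub> z) \<oplus>\<^bsub>obj X q\<^esub> (y \<oplus>\<^bsub>obj X q\<^esub> z) =
        (x \<oplus>\<^bsub>obj X q\<^esub> y) \<oplus>\<^bsub>obj X q\<^esub> (z \<oplus>\<^bsub>obj X q\<^esub> \<ominus>\<^bsub>obj X q\<^esub> z)"
      using xc yc zc by (simp add: Xq.M.minus_eq Xq.M.add.m_ac)
    also have "\<dots> = x \<oplus>\<^bsub>obj X q\<^esub> y"
      using xc yc zc by (simp add: Xq.M.r_neg)
    finally show ?thesis by (simp add: pxy)
  qed
  finally have "bdry X q (s \<oplus>\<^bsub>obj X (Suc q)\<^esub> t) = p" .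
  moreover have "s \<oplus>\<^bsub>obj X (Suc q)\<^esub> t \<in> ideal_multiples R (U <+>\<^bsub>R\<^esub> V) (obj X (Suc q))"
    using s(1) t(1) by (auto simp: ideal_multiples_def set_add_def' functionals_def)
  ultimately show "\<exists>y\<in>ideal_multiples R (U <+>\<^bsub>R\<^esub> V) (obj X (Suc q)). bdry X q y = p" by blast
qed

end

section \<open>Quotient groups\<close>

text \<open>As \<open>h\<close> maps \<open>K\<close> into \<open>K'\<close>, the product of
  \<open>K'\<close> with the image of the coset of \<open>x\<close> collapses to the single coset of
  \<open>h x\<close>.\<close>

lemma quotient_map_rcos:
  assumes G: "group G" and G': "group G'" and K: "subgroup K G" and K': "subgroup K' G'"
    and h: "h \<in> hom G G'" and hK: "h ` K \<subseteq> K'" and x: "x \<in> carrier G"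
  shows "quotient_map G' K' h (K #>\<^bsub>G\<^esub> x) = K' #>\<^bsub>G'\<^esub> h x"
proof -
  interpret G': group G' by fact
  interpret K: subgroup K G by fact
  interpret K': subgroup K' G' by fact
  interpret h: group_hom G G' h using G G' h by (intro group_hom.intro) (auto simp: group_hom_axioms_def)
  note c = K.mem_carrier K'.mem_carrier h.hom_closed[OF x]
  show ?thesis
  proof (intro subset_antisym subsetI)
    fix y assume "y \<in> quotient_map G' K' h (K #>\<^bsub>G\<^esub> x)"
    then obtain l g where lg: "l \<in> K'" "g \<in> K" "y = l \<otimes>\<^bsub>G'\<^esub> h (g \<otimes>\<^bsub>G\<^esub> x)"
      unfolding quotient_map_def set_mult_def r_coset_def by blast
    then have "y = (l \<otimes>\<^bsub>G'\<^esub> h g) \<otimes>\<^bsub>G'\<^esub> h x"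
      using x c by (simp add: G'.m_assoc)
    moreover have "l \<otimes>\<^bsub>G'\<^esub> h g \<in> K'" using lg hK by blast
    ultimately show "y \<in> K' #>\<^bsub>G'\<^esub> h x" unfolding r_coset_def by blast
  next
    fix y assume "y \<in> K' #>\<^bsub>G'\<^esub> h x"
    then obtain l where l: "l \<in> K'" "y = l \<otimes>\<^bsub>G'\<^esub> h x" unfolding r_coset_def by blast
    moreover have "x \<in> K #>\<^bsub>G\<^esub> x"
      using group.rcos_self[OF G x K] .
    ultimately show "y \<in> quotient_map G' K' h (K #>\<^bsub>G\<^esub> x)"
      unfolding quotient_map_def set_mult_def by blast
  qed
qed

lemma quotient_map_hom:
  assumes G: "comm_group G" and G': "comm_group G'" and K: "subgroup K G" and K': "subgroup K' G'"
    and h: "h \<in> hom G G'" and hK: "h ` K \<subseteq> K'"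
  shows "quotient_map G' K' h \<in> hom (G Mod K) (G' Mod K')"
proof -
  interpret G: comm_group G by fact
  interpret G': comm_group G' by fact
  interpret K: normal K G using G.subgroup_imp_normal[OF K] .
  interpret K': normal K' G' using G'.subgroup_imp_normal[OF K'] .
  interpret h: group_hom G G' h using h by (intro group_hom.intro) (auto simp: group_hom_axioms_def)
  note q = quotient_map_rcos[OF G.is_group G'.is_group K K' h hK]
  show ?thesis
  proof (rule homI)
    fix C assume "C \<in> carrier (G Mod K)"
    then obtain x where x: "x \<in> carrier G" "C = K #>\<^bsub>G\<^esub> x" by (auto simp: carrier_FactGroup)
    then show "quotient_map G' K' h C \<in> carrier (G' Mod K')"
      using q[OF x(1)] by (auto simp: carrier_FactGroup)
    fix D assume "D \<in> carrier (G Mod K)"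
    then obtain y where y: "y \<in> carrier G" "D = K #>\<^bsub>G\<^esub> y" by (auto simp: carrier_FactGroup)
    show "quotient_map G' K' h (C \<otimes>\<^bsub>G Mod K\<^esub> D) =
        quotient_map G' K' h C \<otimes>\<^bsub>G' Mod K'\<^esub> quotient_map G' K' h D"
      using x y by (simp add: K.rcos_sum K'.rcos_sum q)
  qed
qed


section \<open>Tensor products with the trivial module\<close>

lemma comm_group_tensor_free: "comm_group (tensor_free M P)"
  unfolding tensor_free_def by (rule abelian_free_Abelian_group)

lemma tensor_free_simps [simp]:
  "x \<in> carrier (tensor_free M P) \<longleftrightarrow> Poly_Mapping.keys x \<subseteq> carrier M \<times> carrier P"
  "\<one>\<^bsub>tensor_free M P\<^esub> = 0"
  "x \<otimes>\<^bsub>tensor_free M P\<^esub> y = x + y"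
  "Poly_Mapping.keys x \<subseteq> carrier M \<times> carrier P \<Longrightarrow> inv\<^bsub>tensor_free M P\<^esub> x = - x"
  by (simp_all add: tensor_free_def)

lemma keys_diff_subset: "\<lbrakk>Poly_Mapping.keys x \<subseteq> S; Poly_Mapping.keys y \<subseteq> S\<rbrakk> \<Longrightarrow> Poly_Mapping.keys (x - y) \<subseteq> S"
  using keys_diff[of x y] by blast

context
  fixes R :: "('r, 'x) ring_scheme" and M :: "('r, 'm) module" and P :: "('r, 'p) module"
  assumes M: "left_module R M" and P: "left_module R P"
begin

interpretation M: left_module R M by (fact M)
interpretation P: left_module R P by (fact P)

lemma tensor_rel_subgroup: "subgroup (tensor_rel R M P) (tensor_free M P)"
  unfolding tensor_rel_def
  by (rule group.generate_is_subgroup)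
    (auto simp: comm_group.axioms(2) comm_group_tensor_free M.smult_closed P.smult_closed dest!: subsetD[OF keys_diff])

lemma comm_group_tensor: "comm_group (tensor R M P)"
  unfolding tensor_def by (rule comm_group.abelian_FactGroup[OF comm_group_tensor_free tensor_rel_subgroup])

lemma tensor_rel_add_left:
  "\<lbrakk>m \<in> carrier M; m' \<in> carrier M; p \<in> carrier P\<rbrakk> \<Longrightarrow>
    frag_of (m \<oplus>\<^bsub>M\<^esub> m', p) - frag_of (m, p) - frag_of (m', p) \<in> tensor_rel R M P"
  unfolding tensor_rel_def by (rule generate.incl) blast

lemma tensor_rel_add_right:
  "\<lbrakk>m \<in> carrier M; p \<in> carrier P; p' \<in> carrier P\<rbrakk> \<Longrightarrow>
    frag_of (m, p \<oplus>\<^bsub>P\<^esub> p') - frag_of (m, p) - frag_of (m, p') \<in> tensor_rel R M P"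
  unfolding tensor_rel_def by (rule generate.incl) blast

lemma tensor_rel_smult:
  "\<lbrakk>a \<in> carrier R; m \<in> carrier M; p \<in> carrier P\<rbrakk> \<Longrightarrow>
    frag_of (a \<odot>\<^bsub>M\<^esub> m, p) - frag_of (m, a \<odot>\<^bsub>P\<^esub> p) \<in> tensor_rel R M P"
  unfolding tensor_rel_def by (rule generate.incl) blast

lemma tensor_rel_zero: "0 \<in> tensor_rel R M P"
  using subgroup.one_closed[OF tensor_rel_subgroup] by simp

lemma tensor_rel_add:
  "\<lbrakk>x \<in> tensor_rel R M P; y \<in> tensor_rel R M P\<rbrakk> \<Longrightarrow> x + y \<in> tensor_rel R M P"
  using subgroup.m_closed[OF tensor_rel_subgroup] by simp

lemma tensor_rel_keys: "x \<in> tensor_rel R M P \<Longrightarrow> Poly_Mapping.keys x \<subseteq> carrier M \<times> carrier P"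
  using subgroup.mem_carrier[OF tensor_rel_subgroup, of x] by simp

lemma tensor_rel_uminus: "x \<in> tensor_rel R M P \<Longrightarrow> - x \<in> tensor_rel R M P"
  using subgroup.m_inv_closed[OF tensor_rel_subgroup, of x] tensor_rel_keys[of x] by simp

lemma tensor_rel_diff:
  "\<lbrakk>x \<in> tensor_rel R M P; y \<in> tensor_rel R M P\<rbrakk> \<Longrightarrow> x - y \<in> tensor_rel R M P"
  using tensor_rel_add[of x "- y"] tensor_rel_uminus[of y] by simp

lemma tensor_rel_zero_left:
  assumes "p \<in> carrier P" shows "frag_of (\<zero>\<^bsub>M\<^esub>, p) \<in> tensor_rel R M P"
  using tensor_rel_uminus[OF tensor_rel_add_left[of "\<zero>\<^bsub>M\<^esub>" "\<zero>\<^bsub>M\<^esub>" p]] assms by simp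

lemma tensor_rel_zero_right:
  assumes "m \<in> carrier M" shows "frag_of (m, \<zero>\<^bsub>P\<^esub>) \<in> tensor_rel R M P"
  using tensor_rel_uminus[OF tensor_rel_add_right[of m "\<zero>\<^bsub>P\<^esub>" "\<zero>\<^bsub>P\<^esub>"]] assms by simp

lemma tensor_rel_minus_right:
  assumes "m \<in> carrier M" "p \<in> carrier P" "p' \<in> carrier P"
  shows "frag_of (m, p \<ominus>\<^bsub>P\<^esub> p') - frag_of (m, p) + frag_of (m, p') \<in> tensor_rel R M P"
proof -
  have "(p \<ominus>\<^bsub>P\<^esub> p') \<oplus>\<^bsub>P\<^esub> p' = p"
    using assms by (simp add: P.minus_eq P.a_assoc P.l_neg)
  then show ?thesis
    using tensor_rel_uminus[OF tensor_rel_add_right[of m "p \<ominus>\<^bsub>P\<^esub> p'" p']] assms by (simp add: algebra_simps)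
qed

lemma tensor_rcos_eq_iff:
  assumes "Poly_Mapping.keys x \<subseteq> carrier M \<times> carrier P" "Poly_Mapping.keys y \<subseteq> carrier M \<times> carrier P"
  shows "tensor_rel R M P #>\<^bsub>tensor_free M P\<^esub> x = tensor_rel R M P #>\<^bsub>tensor_free M P\<^esub> y \<longleftrightarrow>
    x - y \<in> tensor_rel R M P"
proof -
  interpret F: comm_group "tensor_free M P" by (rule comm_group_tensor_free)
  interpret K: subgroup "tensor_rel R M P" "tensor_free M P" by (rule tensor_rel_subgroup)
  have "tensor_rel R M P #>\<^bsub>tensor_free M P\<^esub> x = tensor_rel R M P #>\<^bsub>tensor_free M P\<^esub> y \<longleftrightarrow>
      x \<in> tensor_rel R M P #>\<^bsub>tensor_free M P\<^esub> y"
    using F.repr_independence[of x "tensor_rel R M P" y] F.rcos_self[of x "tensor_rel R M P"]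
      assms K.subgroup_axioms by auto
  also have "\<dots> \<longleftrightarrow> x \<otimes>\<^bsub>tensor_free M P\<^esub> inv\<^bsub>tensor_free M P\<^esub> y \<in> tensor_rel R M P"
    using K.rcos_module[OF F.is_group] assms by simp
  finally show ?thesis using assms by simp
qed

end

text \<open>An augmentation \<eta> of \<open>R\<close> onto \<open>k\<close>, with \<open>N\<close>
  the module \<open>k\<close> on which \<open>R\<close> acts through \<eta>. Carrier, addition and
  zero of \<open>N\<close> are those of \<open>k\<close>, so elements pass freely between the two
  records; as \<open>k\<close> is commutative, \<open>N\<close> also serves as the right
  module.\<close>

locale trivial_action = left_module R N + k: cring k
  for R :: "('r, 'x) ring_scheme" (structure) and k :: "('k, 'y) ring_scheme"
    and N :: "('r, 'k) module" and \<eta> :: "'r \<Rightarrow> 'k" +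
  assumes carrier_N: "carrier N = carrier k"
    and add_N: "x \<oplus>\<^bsub>N\<^esub> y = x \<oplus>\<^bsub>k\<^esub> y"
    and zero_N: "\<zero>\<^bsub>N\<^esub> = \<zero>\<^bsub>k\<^esub>"
    and \<eta>_closed: "a \<in> carrier R \<Longrightarrow> \<eta> a \<in> carrier k"
    and smult_N: "\<lbrakk>a \<in> carrier R; c \<in> carrier k\<rbrakk> \<Longrightarrow> a \<odot>\<^bsub>N\<^esub> c = \<eta> a \<otimes>\<^bsub>k\<^esub> c"
    and \<eta>_surj: "c \<in> carrier k \<Longrightarrow> \<exists>a\<in>carrier R. \<eta> a = c"
begin

lemmas module_axioms = left_module_axioms

text \<open>Additivity and multiplicativity of \<eta> are read off from the module axioms at the
  element \<open>1\<close> of \<open>k\<close>.\<close>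

lemma \<eta>_add: "\<lbrakk>a \<in> carrier R; b \<in> carrier R\<rbrakk> \<Longrightarrow> \<eta> (a \<oplus>\<^bsub>R\<^esub> b) = \<eta> a \<oplus>\<^bsub>k\<^esub> \<eta> b"
  using smult_l_distr[of a b "\<one>\<^bsub>k\<^esub>"] by (simp add: carrier_N smult_N add_N \<eta>_closed)

lemma \<eta>_mult: "\<lbrakk>a \<in> carrier R; b \<in> carrier R\<rbrakk> \<Longrightarrow> \<eta> (a \<otimes>\<^bsub>R\<^esub> b) = \<eta> a \<otimes>\<^bsub>k\<^esub> \<eta> b"
  using smult_assoc[of a b "\<one>\<^bsub>k\<^esub>"] by (simp add: carrier_N smult_N \<eta>_closed)

text \<open>Surjectivity of \<eta> writes a scalar \<open>c\<close> as \<open>\<eta> a\<close>, and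
  then \<open>c \<otimes> p = 1 \<otimes> a p\<close>. All later computations can therefore be done
  with elements \<open>1 \<otimes> p\<close>.\<close>

lemma tensor_eq_one_tensor:
  assumes P: "left_module R P" and "Poly_Mapping.keys z \<subseteq> carrier N \<times> carrier P"
  shows "\<exists>p\<in>carrier P. z - frag_of (\<one>\<^bsub>k\<^esub>, p) \<in> tensor_rel R N P"
proof -
  interpret P: left_module R P by (fact P)
  note M = left_module_axioms
  have one: "\<one>\<^bsub>k\<^esub> \<in> carrier N" by (simp add: carrier_N)
  show ?thesis
    using assms(2)
  proof (induction z rule: free_Abelian_group_induct[consumes 1, case_names zero diff frag])
    case zero
    have "0 - frag_of (\<one>\<^bsub>k\<^esub>, \<zero>\<^bsub>P\<^esub>) \<in> tensor_rel R N P"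
      using tensor_rel_uminus[OF M P tensor_rel_zero_right[OF M P one]] by simp
    then show ?case by blast
  next
    case (diff x y)
    then obtain p q where p: "p \<in> carrier P" "x - frag_of (\<one>\<^bsub>k\<^esub>, p) \<in> tensor_rel R N P"
      and q: "q \<in> carrier P" "y - frag_of (\<one>\<^bsub>k\<^esub>, q) \<in> tensor_rel R N P" by blast
    have "(x - frag_of (\<one>\<^bsub>k\<^esub>, p)) - (y - frag_of (\<one>\<^bsub>k\<^esub>, q)) -
        (frag_of (\<one>\<^bsub>k\<^esub>, p \<ominus>\<^bsub>P\<^esub> q) - frag_of (\<one>\<^bsub>k\<^esub>, p) + frag_of (\<one>\<^bsub>k\<^esub>, q)) \<in> tensor_rel R N P"
      by (rule tensor_rel_diff[OF M P tensor_rel_diff[OF M P p(2) q(2)]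
            tensor_rel_minus_right[OF M P one p(1) q(1)]])
    then have "x - y - frag_of (\<one>\<^bsub>k\<^esub>, p \<ominus>\<^bsub>P\<^esub> q) \<in> tensor_rel R N P"
      by (simp add: algebra_simps)
    then show ?case using p q by blast
  next
    case (frag cp)
    then obtain c p where cp: "cp = (c, p)" "c \<in> carrier k" "p \<in> carrier P"
      by (auto simp: carrier_N)
    obtain a where a: "a \<in> carrier R" "\<eta> a = c" using \<eta>_surj cp by blast
    have "a \<odot>\<^bsub>N\<^esub> \<one>\<^bsub>k\<^esub> = c" using a cp by (simp add: smult_N)
    then have "frag_of cp - frag_of (\<one>\<^bsub>k\<^esub>, a \<odot>\<^bsub>P\<^esub> p) \<in> tensor_rel R N P"
      using tensor_rel_smult[OF M P a(1) one cp(3)] cp by simp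
    then show ?case using P.smult_closed[OF a(1) cp(3)] by blast
  qed
qed

text \<open>Sending \<open>c \<otimes> p\<close> to \<open>c h(p)\<close> is well defined on the
  tensor product, and \<open>1 \<otimes> p\<close> goes to \<open>h p\<close>.\<close>

lemma one_tensor_rel_linear_map:
  assumes P: "left_module R P" and h: "h \<in> linear_maps R P N" and p: "p \<in> carrier P"
    and rel: "frag_of (\<one>\<^bsub>k\<^esub>, p) \<in> tensor_rel R N P"
  shows "h p = \<zero>\<^bsub>k\<^esub>"
proof -
  interpret P: left_module R P by (fact P)
  let ?S = "carrier N \<times> carrier P"
  have hc: "h x \<in> carrier k" if "x \<in> carrier P" for x
    using linear_mapsD(1)[OF h that] by (simp add: carrier_N)
  define g where "g = (\<lambda>(c, p). c \<otimes>\<^bsub>k\<^esub> h p)"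
  have "g ` ?S \<subseteq> carrier (add_monoid k)"
    using hc by (auto simp: carrier_N g_def)
  from comm_group.free_Abelian_group_universal[OF k.a_comm_group this]
  obtain \<Theta> where hom: "\<Theta> \<in> hom (free_Abelian_group ?S) (add_monoid k)"
    and g: "\<And>x. x \<in> ?S \<Longrightarrow> \<Theta> (frag_of x) = g x" by metis
  have \<Theta>: "\<Theta> (frag_of (c, p)) = c \<otimes>\<^bsub>k\<^esub> h p" if "c \<in> carrier N" "p \<in> carrier P" for c p
    using g[of "(c, p)"] that by (simp add: g_def)
  interpret \<Theta>: group_hom "free_Abelian_group ?S" "add_monoid k" \<Theta>
    using hom by (intro group_hom.intro) (auto simp: group_hom_axioms_def)
  have diff: "\<Theta> (x - y) = \<Theta> x \<ominus>\<^bsub>k\<^esub> \<Theta> y" if "Poly_Mapping.keys x \<subseteq> ?S" "Poly_Mapping.keys y \<subseteq> ?S" for x y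
    using \<Theta>.hom_mult[of x "- y"] \<Theta>.hom_inv[of y] that by (simp add: a_inv_def k.minus_eq)
  have "\<Theta> z = \<zero>\<^bsub>k\<^esub>" if "z \<in> tensor_rel R N P" for z
  proof -
    let ?rels = "{frag_of (m \<oplus>\<^bsub>N\<^esub> m', p) - frag_of (m, p) - frag_of (m', p) | m m' p.
        m \<in> carrier N \<and> m' \<in> carrier N \<and> p \<in> carrier P} \<union>
     {frag_of (m, p \<oplus>\<^bsub>P\<^esub> p') - frag_of (m, p) - frag_of (m, p') | m p p'.
        m \<in> carrier N \<and> p \<in> carrier P \<and> p' \<in> carrier P} \<union>
     {frag_of (a \<odot>\<^bsub>N\<^esub> m, p) - frag_of (m, a \<odot>\<^bsub>P\<^esub> p) | a m p.
        a \<in> carrier R \<and> m \<in> carrier N \<and> p \<in> carrier P}"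
    have N_closed: "c \<oplus>\<^bsub>N\<^esub> d \<in> carrier N" if "c \<in> carrier N" "d \<in> carrier N" for c d using that by simp
    have rels: "Poly_Mapping.keys r \<subseteq> ?S \<and> \<Theta> r = \<zero>\<^bsub>k\<^esub>" if "r \<in> ?rels" for r
      using that
    proof (elim UnE)
      assume "r \<in> {frag_of (m \<oplus>\<^bsub>N\<^esub> m', p) - frag_of (m, p) - frag_of (m', p) | m m' p.
        m \<in> carrier N \<and> m' \<in> carrier N \<and> p \<in> carrier P}"
      then obtain m m' p where r: "r = frag_of (m \<oplus>\<^bsub>N\<^esub> m', p) - frag_of (m, p) - frag_of (m', p)"
        and c: "m \<in> carrier N" "m' \<in> carrier N" "p \<in> carrier P" by blast
      have ks: "Poly_Mapping.keys (frag_of (m \<oplus>\<^bsub>N\<^esub> m', p) - frag_of (m, p)) \<subseteq> ?S"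
        using c by (intro keys_diff_subset) auto
      have "\<Theta> r = (m \<oplus>\<^bsub>k\<^esub> m') \<otimes>\<^bsub>k\<^esub> h p \<ominus>\<^bsub>k\<^esub> m \<otimes>\<^bsub>k\<^esub> h p \<ominus>\<^bsub>k\<^esub> m' \<otimes>\<^bsub>k\<^esub> h p"
        unfolding r using c ks N_closed[OF c(1,2)] by (simp add: diff \<Theta> add_N[symmetric])
      also have "\<dots> = \<zero>\<^bsub>k\<^esub>"
        using c hc[OF c(3)] unfolding carrier_N by algebra
      finally show ?thesis using keys_diff_subset[OF ks] c unfolding r by simp
    next
      assume "r \<in> {frag_of (m, p \<oplus>\<^bsub>P\<^esub> p') - frag_of (m, p) - frag_of (m, p') | m p p'.
        m \<in> carrier N \<and> p \<in> carrier P \<and> p' \<in> carrier P}"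
      then obtain m p p' where r: "r = frag_of (m, p \<oplus>\<^bsub>P\<^esub> p') - frag_of (m, p) - frag_of (m, p')"
        and c: "m \<in> carrier N" "p \<in> carrier P" "p' \<in> carrier P" by blast
      have ks: "Poly_Mapping.keys (frag_of (m, p \<oplus>\<^bsub>P\<^esub> p') - frag_of (m, p)) \<subseteq> ?S"
        using c by (intro keys_diff_subset) auto
      have "\<Theta> r = m \<otimes>\<^bsub>k\<^esub> (h p \<oplus>\<^bsub>k\<^esub> h p') \<ominus>\<^bsub>k\<^esub> m \<otimes>\<^bsub>k\<^esub> h p \<ominus>\<^bsub>k\<^esub> m \<otimes>\<^bsub>k\<^esub> h p'"
        unfolding r using c ks linear_mapsD(2)[OF h c(2,3)] by (simp add: diff \<Theta> add_N)
      also have "\<dots> = \<zero>\<^bsub>k\<^esub>"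
        using c hc[OF c(3)] hc[OF c(2)] unfolding carrier_N by algebra
      finally show ?thesis using keys_diff_subset[OF ks] c unfolding r by simp
    next
      assume "r \<in> {frag_of (a \<odot>\<^bsub>N\<^esub> m, p) - frag_of (m, a \<odot>\<^bsub>P\<^esub> p) | a m p.
        a \<in> carrier R \<and> m \<in> carrier N \<and> p \<in> carrier P}"
      then obtain a m p where r: "r = frag_of (a \<odot>\<^bsub>N\<^esub> m, p) - frag_of (m, a \<odot>\<^bsub>P\<^esub> p)"
        and c: "a \<in> carrier R" "m \<in> carrier N" "p \<in> carrier P" by blast
      have ap: "a \<odot>\<^bsub>P\<^esub> p \<in> carrier P" "a \<odot>\<^bsub>N\<^esub> m \<in> carrier N"
        using c P.smult_closed smult_closed by auto
      \<comment> \<open>Balancedness: \<open>a\<close> acts on \<open>N\<close> through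
        \<open>\<eta> a\<close>, \<open>h\<close> is linear, and \<open>k\<close> is
        commutative.\<close>
      have "\<Theta> r = (\<eta> a \<otimes>\<^bsub>k\<^esub> m) \<otimes>\<^bsub>k\<^esub> h p \<ominus>\<^bsub>k\<^esub> m \<otimes>\<^bsub>k\<^esub> (\<eta> a \<otimes>\<^bsub>k\<^esub> h p)"
        unfolding r using c ap linear_mapsD(3)[OF h c(1,3)] linear_mapsD(1)[OF h c(3)]
        by (simp add: diff \<Theta> smult_N carrier_N)
      also have "\<dots> = \<zero>\<^bsub>k\<^esub>"
        using c hc[OF c(3)] \<eta>_closed[OF c(1)] unfolding carrier_N by algebra
      finally show ?thesis using ap c unfolding r by (intro conjI keys_diff_subset) simp_all
    qed
    \<comment> \<open>The support bound has to travel along, since \<Theta> is a homomorphism only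
      on elements with keys in \<open>?S\<close>.\<close>
    have "Poly_Mapping.keys z \<subseteq> ?S \<and> \<Theta> z = \<zero>\<^bsub>k\<^esub>"
      using that unfolding tensor_rel_def
    proof (induction rule: generate.induct)
      case one
      show ?case using \<Theta>.hom_one by simp
    next
      case (incl r)
      show ?case by (rule rels[OF incl])
    next
      case (inv r)
      have r: "Poly_Mapping.keys r \<subseteq> ?S" "\<Theta> r = \<zero>\<^bsub>k\<^esub>" using rels[OF inv] by simp_all
      then show ?case using \<Theta>.hom_inv[of r] by (simp add: a_inv_def[symmetric])
    next
      case (eng x y)
      then show ?case using \<Theta>.hom_mult[of x y] keys_add[of x y] by auto
    qed
    then show ?thesis ..
  qed
  then have "\<Theta> (frag_of (\<one>\<^bsub>k\<^esub>, p)) = \<zero>\<^bsub>k\<^esub>" using rel .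
  then show ?thesis using p hc[OF p] by (simp add: \<Theta> carrier_N)
qed

definition augmentation_ideal :: "'r set" where
  "augmentation_ideal = {a \<in> carrier R. \<eta> a = \<zero>\<^bsub>k\<^esub>}"

text \<open>In one direction, functionals followed by \<eta> are linear maps to \<open>N\<close> and
  hence kill \<open>p\<close>. In the other, \<open>p\<close> is expanded in a dual basis and each
  term satisfies \<open>1 \<otimes> a b = \<eta> a \<otimes> b = 0\<close>. Together this identifies
  the tensor product with \<open>P / I P\<close>, where \<open>I\<close> is the augmentation
  ideal.\<close>

lemma one_tensor_rel_iff:
  assumes proj: "projective_left_module R P" and p: "p \<in> carrier P"
  shows "frag_of (\<one>\<^bsub>k\<^esub>, p) \<in> tensor_rel R N P \<longleftrightarrow> p \<in> ideal_multiples R augmentation_ideal P"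
proof
  note P = projective_left_moduleD[OF proj]
  interpret P: left_module R P by (fact P)
  note M = left_module_axioms
  have one: "\<one>\<^bsub>k\<^esub> \<in> carrier N" by (simp add: carrier_N)
  {
    assume rel: "frag_of (\<one>\<^bsub>k\<^esub>, p) \<in> tensor_rel R N P"
    have "\<phi> p \<in> augmentation_ideal" if \<phi>: "\<phi> \<in> functionals R P" for \<phi>
    proof -
      have "(\<lambda>x. \<eta> (\<phi> x)) \<in> linear_maps R P N"
        using functionalsD[OF \<phi>]
        by (auto simp: linear_maps_def semilinear_maps_def carrier_N add_N smult_N \<eta>_closed \<eta>_add \<eta>_mult)
      from one_tensor_rel_linear_map[OF P this p rel] show ?thesis
        using functionalsD(1)[OF \<phi> p] by (simp add: augmentation_ideal_def)
    qed
    then show "p \<in> ideal_multiples R augmentation_ideal P"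
      using p by (simp add: ideal_multiples_def)
  next
    assume "p \<in> ideal_multiples R augmentation_ideal P"
    have "\<eta> \<zero>\<^bsub>R\<^esub> = \<zero>\<^bsub>k\<^esub>"
      by (rule additive_zero) (auto simp: R.abelian_group_axioms k.abelian_group_axioms \<eta>_closed \<eta>_add)
    then have "\<zero>\<^bsub>R\<^esub> \<in> augmentation_ideal" by (simp add: augmentation_ideal_def)
    with proj \<open>p \<in> ideal_multiples R augmentation_ideal P\<close>
    show "frag_of (\<one>\<^bsub>k\<^esub>, p) \<in> tensor_rel R N P"
    proof (induction rule: projective_induct)
      case zero
      show ?case by (rule tensor_rel_zero_right[OF M P one])
    next
      case (add x a b)
      have ab: "a \<odot>\<^bsub>P\<^esub> b \<in> carrier P" using add.hyps P.smult_closed by simp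
      have "a \<odot>\<^bsub>N\<^esub> \<one>\<^bsub>k\<^esub> = \<zero>\<^bsub>N\<^esub>"
        using add.hyps by (simp add: augmentation_ideal_def smult_N zero_N)
      then have "frag_of (\<zero>\<^bsub>N\<^esub>, b) - frag_of (\<one>\<^bsub>k\<^esub>, a \<odot>\<^bsub>P\<^esub> b) \<in> tensor_rel R N P"
        using tensor_rel_smult[OF M P, of a "\<one>\<^bsub>k\<^esub>" b] add.hyps one by simp
      from tensor_rel_diff[OF M P tensor_rel_zero_left[OF M P add.hyps(4)] this]
      have "frag_of (\<one>\<^bsub>k\<^esub>, a \<odot>\<^bsub>P\<^esub> b) \<in> tensor_rel R N P" using add.hyps by simp
      from tensor_rel_add[OF M P tensor_rel_add[OF M P tensor_rel_add_right[OF M P one add.hyps(1) ab] add.IH] this]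
      show ?case by simp
    qed
  }
qed

end

definition one_tensor ::
  "('r, 'x) ring_scheme \<Rightarrow> ('k, 'y) ring_scheme \<Rightarrow> ('r, 'k) module \<Rightarrow> ('r, 'p) module \<Rightarrow> 'p \<Rightarrow>
    ('k \<times> 'p \<Rightarrow>\<^sub>0 int) set" where
  "one_tensor R k N P p = tensor_rel R N P #>\<^bsub>tensor_free N P\<^esub> frag_of (\<one>\<^bsub>k\<^esub>, p)"

section \<open>Calculus of the classes of \<open>1 \<otimes> p\<close>\<close>

context trivial_action
begin

lemma one_N: "\<one>\<^bsub>k\<^esub> \<in> carrier N"
  by (simp add: carrier_N)

lemma one_tensor_eq_iff:
  assumes "left_module R P" "p \<in> carrier P" "q \<in> carrier P"
  shows "one_tensor R k N P p = one_tensor R k N P q \<longleftrightarrow>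
    frag_of (\<one>\<^bsub>k\<^esub>, p) - frag_of (\<one>\<^bsub>k\<^esub>, q) \<in> tensor_rel R N P"
  unfolding one_tensor_def
  using assms one_N by (intro tensor_rcos_eq_iff[OF module_axioms assms(1)]) auto

lemma one_tensor_eq_one_iff:
  assumes P: "left_module R P" and p: "p \<in> carrier P"
  shows "one_tensor R k N P p = \<one>\<^bsub>tensor R N P\<^esub> \<longleftrightarrow> frag_of (\<one>\<^bsub>k\<^esub>, p) \<in> tensor_rel R N P"
proof -
  interpret F: comm_group "tensor_free N P" by (rule comm_group_tensor_free)
  note K = tensor_rel_subgroup[OF module_axioms P]
  have "tensor_rel R N P #>\<^bsub>tensor_free N P\<^esub> 0 = \<one>\<^bsub>tensor R N P\<^esub>"
    using F.coset_mult_one[OF subgroup.subset[OF K]] by (simp add: tensor_def)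
  then show ?thesis
    using tensor_rcos_eq_iff[OF module_axioms P, of "frag_of (\<one>\<^bsub>k\<^esub>, p)" 0] p one_N
    by (simp add: one_tensor_def)
qed

lemma one_tensor_closed:
  "p \<in> carrier P \<Longrightarrow> one_tensor R k N P p \<in> carrier (tensor R N P)"
  unfolding one_tensor_def tensor_def carrier_FactGroup using one_N by (intro imageI) simp

lemma one_tensor_surj:
  assumes P: "left_module R P" and C: "C \<in> carrier (tensor R N P)"
  shows "\<exists>p\<in>carrier P. C = one_tensor R k N P p"
proof -
  from C obtain z where z: "Poly_Mapping.keys z \<subseteq> carrier N \<times> carrier P"
    "C = tensor_rel R N P #>\<^bsub>tensor_free N P\<^esub> z"
    by (auto simp: tensor_def carrier_FactGroup)
  from tensor_eq_one_tensor[OF P z(1)] obtain p where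
    p: "p \<in> carrier P" "z - frag_of (\<one>\<^bsub>k\<^esub>, p) \<in> tensor_rel R N P" by blast
  then have "C = one_tensor R k N P p"
    using tensor_rcos_eq_iff[OF module_axioms P z(1), of "frag_of (\<one>\<^bsub>k\<^esub>, p)"] one_N z(2)
    by (simp add: one_tensor_def)
  with p(1) show ?thesis by blast
qed

lemma one_tensor_zero:
  assumes "left_module R P"
  shows "one_tensor R k N P \<zero>\<^bsub>P\<^esub> = \<one>\<^bsub>tensor R N P\<^esub>"
proof -
  interpret P: left_module R P by fact
  show ?thesis
    using one_tensor_eq_one_iff[OF assms P.M.zero_closed] tensor_rel_zero_right[OF module_axioms assms one_N]
    by simp
qed

lemma one_tensor_add:
  assumes P: "left_module R P" and pq: "p \<in> carrier P" "q \<in> carrier P"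
  shows "one_tensor R k N P (p \<oplus>\<^bsub>P\<^esub> q) = one_tensor R k N P p \<otimes>\<^bsub>tensor R N P\<^esub> one_tensor R k N P q"
proof -
  interpret P: left_module R P by (fact P)
  interpret F: comm_group "tensor_free N P" by (rule comm_group_tensor_free)
  note K = tensor_rel_subgroup[OF module_axioms P]
  have "one_tensor R k N P p \<otimes>\<^bsub>tensor R N P\<^esub> one_tensor R k N P q =
      tensor_rel R N P #>\<^bsub>tensor_free N P\<^esub> (frag_of (\<one>\<^bsub>k\<^esub>, p) + frag_of (\<one>\<^bsub>k\<^esub>, q))"
    using normal.rcos_sum[OF F.subgroup_imp_normal[OF K], of "frag_of (\<one>\<^bsub>k\<^esub>, p)" "frag_of (\<one>\<^bsub>k\<^esub>, q)"]
      pq one_N by (simp add: one_tensor_def tensor_def)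
  moreover have "Poly_Mapping.keys (frag_of (\<one>\<^bsub>k\<^esub>, p) + frag_of (\<one>\<^bsub>k\<^esub>, q)) \<subseteq> carrier N \<times> carrier P"
    using pq one_N by (intro order_trans[OF keys_add]) simp
  moreover have "Poly_Mapping.keys (frag_of (\<one>\<^bsub>k\<^esub>, p \<oplus>\<^bsub>P\<^esub> q)) \<subseteq> carrier N \<times> carrier P"
    using pq one_N by simp
  moreover have "frag_of (\<one>\<^bsub>k\<^esub>, p \<oplus>\<^bsub>P\<^esub> q) - (frag_of (\<one>\<^bsub>k\<^esub>, p) + frag_of (\<one>\<^bsub>k\<^esub>, q)) \<in> tensor_rel R N P"
    using tensor_rel_add_right[OF module_axioms P one_N pq] by (simp add: diff_diff_add)
  ultimately show ?thesis
    unfolding one_tensor_def using tensor_rcos_eq_iff[OF module_axioms P] by metis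
qed

text \<open>Linear maps into \<open>N\<close> factor through the tensor product. Applied to the
  augmentation of a resolution, this detects classes in degree 0.\<close>

lemma one_tensor_eqD:
  assumes P: "left_module R P" and h: "h \<in> linear_maps R P N" and pq: "p \<in> carrier P" "q \<in> carrier P"
    and eq: "one_tensor R k N P p = one_tensor R k N P q"
  shows "h p = h q"
proof -
  interpret P: left_module R P by (fact P)
  have "frag_of (\<one>\<^bsub>k\<^esub>, p \<ominus>\<^bsub>P\<^esub> q) - frag_of (\<one>\<^bsub>k\<^esub>, p) + frag_of (\<one>\<^bsub>k\<^esub>, q) +
      (frag_of (\<one>\<^bsub>k\<^esub>, p) - frag_of (\<one>\<^bsub>k\<^esub>, q)) \<in> tensor_rel R N P"
    by (rule tensor_rel_add[OF module_axioms P tensor_rel_minus_right[OF module_axioms P one_N pq]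
          one_tensor_eq_iff[OF P pq, THEN iffD1, OF eq]])
  then have "frag_of (\<one>\<^bsub>k\<^esub>, p \<ominus>\<^bsub>P\<^esub> q) \<in> tensor_rel R N P" by simp
  then have "h (p \<ominus>\<^bsub>P\<^esub> q) = \<zero>\<^bsub>N\<^esub>"
    using one_tensor_rel_linear_map[OF P h] pq by (simp add: zero_N)
  then have "h p \<ominus>\<^bsub>N\<^esub> h q = \<zero>\<^bsub>N\<^esub>"
    using linear_maps_minus[OF P module_axioms h pq] by simp
  then show ?thesis
    by (rule minus_eq_zeroD[OF M.abelian_group_axioms linear_mapsD(1)[OF h pq(1)] linear_mapsD(1)[OF h pq(2)]])
qed

lemma one_tensor_eqI:
  assumes proj: "projective_left_module R P" and pq: "p \<in> carrier P" "q \<in> carrier P"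
    and mem: "p \<ominus>\<^bsub>P\<^esub> q \<in> ideal_multiples R augmentation_ideal P"
  shows "one_tensor R k N P p = one_tensor R k N P q"
proof -
  note P = projective_left_moduleD[OF proj]
  interpret P: left_module R P by (fact P)
  have "frag_of (\<one>\<^bsub>k\<^esub>, p \<ominus>\<^bsub>P\<^esub> q) \<in> tensor_rel R N P"
    using one_tensor_rel_iff[OF proj, of "p \<ominus>\<^bsub>P\<^esub> q"] pq mem by simp
  from tensor_rel_diff[OF module_axioms P this tensor_rel_minus_right[OF module_axioms P one_N pq]]
  show ?thesis
    using one_tensor_eq_iff[OF P pq] by simp
qed

end

text \<open>The condition \<open>\<eta>' (\<rho> a) = \<eta> a\<close> says that the identity of
  \<open>k\<close> is semilinear along \<rho> between the two trivial modules; it is the map of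
  right modules along which Tor is compared.\<close>

locale trivial_action_map = A: trivial_action R k N \<eta> + B: trivial_action S k N' \<eta>'
  for R :: "('r, 'x) ring_scheme" and k :: "('k, 'y) ring_scheme" and N :: "('r, 'k) module" and \<eta>
    and S :: "('s, 'z) ring_scheme" and N' :: "('s, 'k) module" and \<eta>' +
  fixes \<rho> :: "'r \<Rightarrow> 's"
  assumes \<rho>_closed: "a \<in> carrier R \<Longrightarrow> \<rho> a \<in> carrier S"
    and \<eta>_\<rho>: "a \<in> carrier R \<Longrightarrow> \<eta>' (\<rho> a) = \<eta> a"
begin

context
  fixes P :: "('r, 'p) module" and Q :: "('s, 'q) module" and f :: "'p \<Rightarrow> 'q"
  assumes P: "left_module R P" and Q: "left_module S Q" and f: "f \<in> semilinear_maps R \<rho> P Q"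
begin

interpretation P: left_module R P by (fact P)
interpretation Q: left_module S Q by (fact Q)

lemma frag_map_hom:
  "frag_extend (\<lambda>(c, p). frag_of (c, f p)) \<in> hom (tensor_free N P) (tensor_free N' Q)"
proof (rule homI)
  fix z assume "z \<in> carrier (tensor_free N P)"
  then have z: "Poly_Mapping.keys z \<subseteq> carrier N \<times> carrier P" by simp
  have fc: "f p \<in> carrier Q" if "p \<in> carrier P" for p using f that by (auto simp: semilinear_maps_def)
  have "Poly_Mapping.keys ((\<lambda>(c, p). frag_of (c, f p)) x) \<subseteq> carrier N' \<times> carrier Q"
    if "x \<in> Poly_Mapping.keys z" for x
    using subsetD[OF z that] fc by (cases x) (simp add: A.carrier_N B.carrier_N)
  then have "(\<Union>x \<in> Poly_Mapping.keys z. Poly_Mapping.keys ((\<lambda>(c, p). frag_of (c, f p)) x)) \<subseteq>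
      carrier N' \<times> carrier Q" by (rule UN_least)
  then show "frag_extend (\<lambda>(c, p). frag_of (c, f p)) z \<in> carrier (tensor_free N' Q)"
    unfolding tensor_free_simps by (rule order_trans[OF keys_frag_extend])
qed (simp add: frag_extend_add)

text \<open>Each defining relation goes to one of the same kind. For the balancing relation this
  uses that \<open>\<rho> a\<close> acts on \<open>N'\<close> as \<open>a\<close> does on
  \<open>N\<close>.\<close>

lemma frag_map_rel:
  "frag_extend (\<lambda>(c, p). frag_of (c, f p)) ` tensor_rel R N P \<subseteq> tensor_rel S N' Q"
proof (rule image_subsetI)
  let ?h = "frag_extend (\<lambda>(c, p). frag_of (c, f p))"
  note M' = B.module_axioms
  have fc: "f p \<in> carrier Q" if "p \<in> carrier P" for p using f that by (auto simp: semilinear_maps_def)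
  have fa: "f (p \<oplus>\<^bsub>P\<^esub> q) = f p \<oplus>\<^bsub>Q\<^esub> f q" if "p \<in> carrier P" "q \<in> carrier P" for p q
    using f that by (auto simp: semilinear_maps_def)
  have fs: "f (a \<odot>\<^bsub>P\<^esub> p) = \<rho> a \<odot>\<^bsub>Q\<^esub> f p" if "p \<in> carrier P" "a \<in> carrier R" for p a
    using f that by (auto simp: semilinear_maps_def)
  have smult: "\<rho> a \<odot>\<^bsub>N'\<^esub> m = a \<odot>\<^bsub>N\<^esub> m" if "a \<in> carrier R" "m \<in> carrier N" for a m
    using that by (simp add: A.carrier_N A.smult_N B.smult_N \<rho>_closed \<eta>_\<rho>)
  note NN = A.carrier_N B.carrier_N
  have rels: "?h r \<in> tensor_rel S N' Q" if "r \<in> {frag_of (m \<oplus>\<^bsub>N\<^esub> m', p) - frag_of (m, p) - frag_of (m', p) | m m' p.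
        m \<in> carrier N \<and> m' \<in> carrier N \<and> p \<in> carrier P} \<union>
     {frag_of (m, p \<oplus>\<^bsub>P\<^esub> p') - frag_of (m, p) - frag_of (m, p') | m p p'.
        m \<in> carrier N \<and> p \<in> carrier P \<and> p' \<in> carrier P} \<union>
     {frag_of (a \<odot>\<^bsub>N\<^esub> m, p) - frag_of (m, a \<odot>\<^bsub>P\<^esub> p) | a m p.
        a \<in> carrier R \<and> m \<in> carrier N \<and> p \<in> carrier P}" for r
    using that
  proof (elim UnE CollectE exE conjE)
    fix m m' p assume r: "r = frag_of (m \<oplus>\<^bsub>N\<^esub> m', p) - frag_of (m, p) - frag_of (m', p)"
      and c: "m \<in> carrier N" "m' \<in> carrier N" "p \<in> carrier P"
    have "m \<oplus>\<^bsub>N\<^esub> m' = m \<oplus>\<^bsub>N'\<^esub> m'" by (simp add: A.add_N B.add_N)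
    then show ?thesis
      unfolding r using tensor_rel_add_left[OF M' Q, of m m' "f p"] c fc by (simp add: frag_extend_diff NN)
  next
    fix m p p' assume r: "r = frag_of (m, p \<oplus>\<^bsub>P\<^esub> p') - frag_of (m, p) - frag_of (m, p')"
      and c: "m \<in> carrier N" "p \<in> carrier P" "p' \<in> carrier P"
    show ?thesis
      unfolding r using tensor_rel_add_right[OF M' Q, of m "f p" "f p'"] c fc
      by (simp add: frag_extend_diff NN fa)
  next
    fix a m p assume r: "r = frag_of (a \<odot>\<^bsub>N\<^esub> m, p) - frag_of (m, a \<odot>\<^bsub>P\<^esub> p)"
      and c: "a \<in> carrier R" "m \<in> carrier N" "p \<in> carrier P"
    show ?thesis
      unfolding r using tensor_rel_smult[OF M' Q, of "\<rho> a" m "f p"] c fc \<rho>_closed smult[OF c(1,2)]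
      by (simp add: frag_extend_diff NN fs)
  qed
  fix z assume "z \<in> tensor_rel R N P"
  then have "?h z \<in> tensor_rel S N' Q \<and> Poly_Mapping.keys z \<subseteq> carrier N \<times> carrier P"
    unfolding tensor_rel_def[of R]
  proof (induction rule: generate.induct)
    case one
    show ?case using tensor_rel_zero[OF M' Q] by simp
  next
    case (incl r)
    then have "r \<in> tensor_rel R N P" unfolding tensor_rel_def by (rule generate.incl)
    then show ?case using tensor_rel_keys[OF A.module_axioms P, of r] rels[OF incl] by blast
  next
    case (inv r)
    then have "r \<in> tensor_rel R N P" unfolding tensor_rel_def by (rule generate.incl)
    then have k: "Poly_Mapping.keys r \<subseteq> carrier N \<times> carrier P"
      by (rule tensor_rel_keys[OF A.module_axioms P])
    then show ?case
      using tensor_rel_uminus[OF M' Q rels[OF inv]] by (simp add: frag_extend_minus)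
  next
    case (eng x y)
    then show ?case
      using tensor_rel_add[OF M' Q, of "?h x" "?h y"] keys_add[of x y] by (auto simp: frag_extend_add)
  qed
  then show "?h z \<in> tensor_rel S N' Q" ..
qed

lemma tensor_map_hom:
  "tensor_map S N' Q (\<lambda>c. c) f \<in> hom (tensor R N P) (tensor S N' Q)"
  unfolding tensor_map_def tensor_def
  by (rule quotient_map_hom[OF comm_group_tensor_free comm_group_tensor_free
        tensor_rel_subgroup[OF A.module_axioms P] tensor_rel_subgroup[OF B.module_axioms Q]
        frag_map_hom frag_map_rel])

lemma tensor_map_one_tensor:
  assumes p: "p \<in> carrier P"
  shows "tensor_map S N' Q (\<lambda>c. c) f (one_tensor R k N P p) = one_tensor S k N' Q (f p)"
proof -
  have "frag_of (\<one>\<^bsub>k\<^esub>, p) \<in> carrier (tensor_free N P)" using p A.one_N by simp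
  from quotient_map_rcos[OF comm_group.axioms(2)[OF comm_group_tensor_free]
      comm_group.axioms(2)[OF comm_group_tensor_free] tensor_rel_subgroup[OF A.module_axioms P]
      tensor_rel_subgroup[OF B.module_axioms Q] frag_map_hom frag_map_rel this]
  show ?thesis unfolding tensor_map_def one_tensor_def by simp
qed

end

end

section \<open>Homology of complexes of abelian groups\<close>

locale abelian_chain_complex =
  fixes C :: "nat \<Rightarrow> 'g monoid" and b :: "nat \<Rightarrow> 'g \<Rightarrow> 'g"
  assumes comm: "comm_group (C i)" and hom: "b i \<in> hom (C (Suc i)) (C i)"
    and square: "x \<in> carrier (C (Suc (Suc i))) \<Longrightarrow> b i (b (Suc i) x) = \<one>\<^bsub>C i\<^esub>"
begin

lemma bdry_group_hom: "group_hom (C (Suc i)) (C i) (b i)"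
  using comm_group.axioms(2)[OF comm] hom by (intro group_hom.intro) (auto simp: group_hom_axioms_def)

lemma chain_cycles_subgroup: "subgroup (chain_cycles C b q) (C q)"
proof (cases q)
  case 0
  then show ?thesis
    using group.subgroup_self[OF comm_group.axioms(2)[OF comm]] by (simp add: chain_cycles_def)
next
  case (Suc i)
  then show ?thesis using group_hom.subgroup_kernel[OF bdry_group_hom] by (simp add: chain_cycles_def)
qed

lemma chain_boundaries_subset: "chain_boundaries C b q \<subseteq> chain_cycles C b q"
proof (rule subsetI)
  fix z assume "z \<in> chain_boundaries C b q"
  then obtain x where x: "x \<in> carrier (C (Suc q))" "z = b q x" unfolding chain_boundaries_def by blast
  have "z \<in> carrier (C q)" unfolding x(2) by (rule group_hom.hom_closed[OF bdry_group_hom x(1)])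
  moreover have "b i z = \<one>\<^bsub>C i\<^esub>" if "q = Suc i" for i
    using square[of x i] x that by simp
  ultimately show "z \<in> chain_cycles C b q"
    by (cases q) (simp_all add: chain_cycles_def kernel_def)
qed

lemma chain_boundaries_subgroup:
  "subgroup (chain_boundaries C b q) ((C q)\<lparr>carrier := chain_cycles C b q\<rparr>)"
  by (intro group.subgroup_incl[OF comm_group.axioms(2)[OF comm]] chain_cycles_subgroup chain_boundaries_subset)
    (simp add: chain_boundaries_def group_hom.img_is_subgroup[OF bdry_group_hom])

lemma chain_cycles_comm_group: "comm_group ((C q)\<lparr>carrier := chain_cycles C b q\<rparr>)"
proof (rule group.group_comm_groupI)
  interpret C: comm_group "C q" by (rule comm)
  show "group ((C q)\<lparr>carrier := chain_cycles C b q\<rparr>)"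
    by (rule C.subgroup_imp_group[OF chain_cycles_subgroup])
  show "x \<otimes>\<^bsub>(C q)\<lparr>carrier := chain_cycles C b q\<rparr>\<^esub> y = y \<otimes>\<^bsub>(C q)\<lparr>carrier := chain_cycles C b q\<rparr>\<^esub> x"
    if "x \<in> carrier ((C q)\<lparr>carrier := chain_cycles C b q\<rparr>)" "y \<in> carrier ((C q)\<lparr>carrier := chain_cycles C b q\<rparr>)"
    for x y
    using that subgroup.mem_carrier[OF chain_cycles_subgroup] C.m_comm by simp
qed

lemma chain_homology_comm_group: "comm_group (chain_homology C b q)"
  unfolding chain_homology_def
  by (rule comm_group.abelian_FactGroup[OF chain_cycles_comm_group chain_boundaries_subgroup])

lemma chain_homology_trivial:
  assumes "chain_cycles C b q \<subseteq> chain_boundaries C b q"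
  shows "trivial_group (chain_homology C b q)"
proof -
  interpret Z: comm_group "(C q)\<lparr>carrier := chain_cycles C b q\<rparr>" by (rule chain_cycles_comm_group)
  have "C' = chain_boundaries C b q" if "C' \<in> carrier (chain_homology C b q)" for C'
  proof -
    from that obtain z where z: "z \<in> chain_cycles C b q"
      "C' = chain_boundaries C b q #>\<^bsub>(C q)\<lparr>carrier := chain_cycles C b q\<rparr>\<^esub> z"
      unfolding chain_homology_def by (auto simp: carrier_FactGroup)
    moreover have "z \<in> chain_boundaries C b q" using assms z(1) by blast
    ultimately show ?thesis
      using Z.coset_join2[of z, OF _ chain_boundaries_subgroup] by simp
  qed
  then show ?thesis
    using comm_group.axioms(2)[OF chain_homology_comm_group]
    by (subst group.trivial_group_subset) (auto simp: chain_homology_def)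
qed

end

section \<open>Tor of the trivial module\<close>

context trivial_action
begin

lemma trivial_action_map_id: "trivial_action_map R k N \<eta> R N \<eta> (\<lambda>a. a)"
  by (intro trivial_action_map.intro trivial_action_axioms trivial_action_map_axioms.intro) simp_all

context
  fixes X :: "('r, 'p, 'k) augmented_complex"
  assumes res: "projective_resolution R N X"
begin

abbreviation (input) "tor_complex \<equiv> (\<lambda>i. tensor R N (obj X i))"
abbreviation (input) "tor_bdry \<equiv> (\<lambda>i. tensor_map R N (obj X i) (\<lambda>m. m) (bdry X i))"

lemma tor_bdry_one_tensor:
  assumes "x \<in> carrier (obj X (Suc i))"
  shows "tensor_map R N (obj X i) (\<lambda>m. m) (bdry X i) (one_tensor R k N (obj X (Suc i)) x) =
    one_tensor R k N (obj X i) (bdry X i x)"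
  using trivial_action_map.tensor_map_one_tensor[OF trivial_action_map_id resolution_module[OF res]
      resolution_module[OF res] _ assms] resolution_bdry[OF res]
  by (simp add: linear_maps_def)

lemma tor_complex: "abelian_chain_complex tor_complex tor_bdry"
proof (rule abelian_chain_complex.intro)
  note lm = resolution_module[OF res]
  show "comm_group (tensor R N (obj X i))" for i
    by (rule comm_group_tensor[OF module_axioms lm])
  show "tensor_map R N (obj X i) (\<lambda>m. m) (bdry X i) \<in> hom (tensor R N (obj X (Suc i))) (tensor R N (obj X i))" for i
    using trivial_action_map.tensor_map_hom[OF trivial_action_map_id lm lm] resolution_bdry[OF res]
    by (simp add: linear_maps_def)
  show "tensor_map R N (obj X i) (\<lambda>m. m) (bdry X i)
      (tensor_map R N (obj X (Suc i)) (\<lambda>m. m) (bdry X (Suc i)) x) = \<one>\<^bsub>tensor R N (obj X i)\<^esub>"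
    if x: "x \<in> carrier (tensor R N (obj X (Suc (Suc i))))" for i x
  proof -
    obtain y where y: "y \<in> carrier (obj X (Suc (Suc i)))" "x = one_tensor R k N (obj X (Suc (Suc i))) y"
      using one_tensor_surj[OF lm x] by blast
    then show ?thesis
      using linear_mapsD(1)[OF resolution_bdry[OF res] y(1)] resolution_bdry_bdry[OF res y(1)]
      by (simp add: tor_bdry_one_tensor one_tensor_zero[OF lm])
  qed
qed

text \<open>Every element of the tensor product has the form \<open>1 \<otimes> y\<close>, and the
  differential sends it to \<open>1 \<otimes> d y\<close>; so boundaries can be described by chains
  of \<open>X\<close>.\<close>

lemma tor_boundaries:
  "chain_boundaries tor_complex tor_bdry q =
    (\<lambda>y. one_tensor R k N (obj X q) (bdry X q y)) ` carrier (obj X (Suc q))"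
proof (intro subset_antisym subsetI)
  fix z assume "z \<in> chain_boundaries tor_complex tor_bdry q"
  then obtain w where w: "w \<in> carrier (tensor R N (obj X (Suc q)))"
    "z = tensor_map R N (obj X q) (\<lambda>m. m) (bdry X q) w" unfolding chain_boundaries_def by blast
  from one_tensor_surj[OF resolution_module[OF res] w(1)]
  obtain y where "y \<in> carrier (obj X (Suc q))" "w = one_tensor R k N (obj X (Suc q)) y" by blast
  with w(2) show "z \<in> (\<lambda>y. one_tensor R k N (obj X q) (bdry X q y)) ` carrier (obj X (Suc q))"
    by (simp add: tor_bdry_one_tensor)
next
  fix z assume "z \<in> (\<lambda>y. one_tensor R k N (obj X q) (bdry X q y)) ` carrier (obj X (Suc q))"
  then obtain y where y: "y \<in> carrier (obj X (Suc q))" "z = one_tensor R k N (obj X q) (bdry X q y)"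
    by blast
  then have "z = tensor_map R N (obj X q) (\<lambda>m. m) (bdry X q) (one_tensor R k N (obj X (Suc q)) y)"
    by (simp add: tor_bdry_one_tensor)
  then show "z \<in> chain_boundaries tor_complex tor_bdry q"
    unfolding chain_boundaries_def using one_tensor_closed[OF y(1)] by (intro image_eqI)
qed

lemma tor_cycle_elem:
  assumes "z \<in> chain_cycles tor_complex tor_bdry q"
  shows "\<exists>x\<in>carrier (obj X q). z = one_tensor R k N (obj X q) x"
proof -
  have "z \<in> carrier (tensor R N (obj X q))"
    using assms subgroup.mem_carrier[OF abelian_chain_complex.chain_cycles_subgroup[OF tor_complex]]
    by blast
  then show ?thesis by (rule one_tensor_surj[OF resolution_module[OF res]])
qed

lemma tor_comm_group: "comm_group (Tor R N X q)"
  unfolding Tor_def by (rule abelian_chain_complex.chain_homology_comm_group[OF tor_complex])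

text \<open>Dimension shifting on elements: a cycle \<open>1 \<otimes> x\<close> has
  \<open>d x\<close> in \<open>I X\<close>, acyclicity corrects \<open>x\<close> by some
  \<open>w\<close> in \<open>I X\<close> to a cycle of \<open>X\<close>, and exactness of
  \<open>X\<close> makes that cycle a boundary. The correction vanishes in the tensor
  product.\<close>

theorem tor_trivial:
  assumes ac: "acyclic_ideal R X augmentation_ideal" and q: "1 \<le> q"
  shows "trivial_group (Tor R N X q)"
proof -
  from q obtain i where i: "q = Suc i" by (cases q) auto
  note lm = resolution_module[OF res]
  interpret Xq: left_module R "obj X q" by (rule lm)
  have "z \<in> chain_boundaries tor_complex tor_bdry q" if z: "z \<in> chain_cycles tor_complex tor_bdry q" for z
  proof -
    obtain x where x: "x \<in> carrier (obj X q)" "z = one_tensor R k N (obj X q) x"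
      using tor_cycle_elem[OF z] by blast
    note dx = linear_mapsD(1)[OF resolution_bdry[OF res], of x i]
    have "tensor_map R N (obj X i) (\<lambda>m. m) (bdry X i) z = \<one>\<^bsub>tensor R N (obj X i)\<^esub>"
      using z by (simp add: chain_cycles_def i kernel_def)
    then have "one_tensor R k N (obj X i) (bdry X i x) = \<one>\<^bsub>tensor R N (obj X i)\<^esub>"
      using x by (simp add: i tor_bdry_one_tensor)
    then have dxI: "bdry X i x \<in> ideal_multiples R augmentation_ideal (obj X i)"
      using one_tensor_eq_one_iff[OF lm] one_tensor_rel_iff[OF resolution_projective[OF res]] dx x i by simp
    \<comment> \<open>For \<open>q = 1\<close> there is no such \<open>l\<close>, and acyclicity in
      degree 0 is what enters.\<close>
    have "bdry X l (bdry X i x) = \<zero>\<^bsub>obj X l\<^esub>" if "i = Suc l" for l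
      using resolution_bdry_bdry[OF res, of x l] x i that by simp
    from acyclic_idealD[OF ac dxI this] obtain w where
      w: "w \<in> ideal_multiples R augmentation_ideal (obj X (Suc i))" "bdry X i w = bdry X i x" .
    interpret Xi: left_module R "obj X i" by (rule lm)
    have wc: "w \<in> carrier (obj X q)" using ideal_multiples_carrier[OF w(1)] by (simp add: i)
    have "bdry X i (x \<ominus>\<^bsub>obj X q\<^esub> w) = \<zero>\<^bsub>obj X i\<^esub>"
      using linear_maps_minus[OF lm lm resolution_bdry[OF res], of x i w] x(1) wc w(2) dx i
      by (simp add: Xi.M.r_neg Xi.M.minus_eq)
    moreover have xw: "x \<ominus>\<^bsub>obj X q\<^esub> w \<in> carrier (obj X q)" using x wc by simp
    ultimately obtain y where y: "y \<in> carrier (obj X (Suc q))" "bdry X q y = x \<ominus>\<^bsub>obj X q\<^esub> w"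
      using resolution_exact[OF res, of "x \<ominus>\<^bsub>obj X q\<^esub> w" i] unfolding i by blast
    \<comment> \<open>The chains \<open>x\<close> and \<open>bdry X q y\<close> differ by
      \<open>w\<close>, an element of \<open>I X\<close>, so they have the same class.\<close>
    have "x \<ominus>\<^bsub>obj X q\<^esub> (x \<ominus>\<^bsub>obj X q\<^esub> w) = w"
      using x wc by (simp add: Xq.M.minus_eq Xq.M.minus_add Xq.M.r_neg Xq.M.r_neg1 Xq.M.r_neg2 Xq.M.add.m_ac)
    then have "one_tensor R k N (obj X q) x = one_tensor R k N (obj X q) (bdry X q y)"
      unfolding y(2) using w(1)[folded i] xw x(1)
      by (intro one_tensor_eqI[OF resolution_projective[OF res]]) simp_all
    then show ?thesis unfolding tor_boundaries x(2) using y(1) by (rule image_eqI)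
  qed
  then show ?thesis
    unfolding Tor_def
    by (intro abelian_chain_complex.chain_homology_trivial[OF tor_complex] subsetI)
qed

end

end

section \<open>Comparison maps on Tor\<close>

context trivial_action_map
begin

context
  fixes X :: "('r, 'p, 'k) augmented_complex" and Y :: "('s, 'q, 'k) augmented_complex" and f
  assumes X: "projective_resolution R N X" and Y: "projective_resolution S N' Y"
    and f: "chain_lift R \<rho> (\<lambda>c. c) X Y f"
begin

lemma chain_liftD:
  shows "f i \<in> semilinear_maps R \<rho> (obj X i) (obj Y i)"
    and "x \<in> carrier (obj X (Suc i)) \<Longrightarrow> f i (bdry X i x) = bdry Y i (f (Suc i) x)"
    and "x \<in> carrier (obj X 0) \<Longrightarrow> augm Y (f 0 x) = augm X x"
    and "x \<in> carrier (obj X i) \<Longrightarrow> f i x \<in> carrier (obj Y i)"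
  using f by (auto simp: chain_lift_def semilinear_maps_def)

lemma chain_lift_one_tensor:
  "x \<in> carrier (obj X i) \<Longrightarrow>
    tensor_map S N' (obj Y i) (\<lambda>c. c) (f i) (one_tensor R k N (obj X i) x) =
      one_tensor S k N' (obj Y i) (f i x)"
  by (rule tensor_map_one_tensor[OF resolution_module[OF X] resolution_module[OF Y] chain_liftD(1)])

abbreviation (input) "cX \<equiv> (\<lambda>i. tensor R N (obj X i))"
abbreviation (input) "bX \<equiv> (\<lambda>i. tensor_map R N (obj X i) (\<lambda>m. m) (bdry X i))"
abbreviation (input) "cY \<equiv> (\<lambda>i. tensor S N' (obj Y i))"
abbreviation (input) "bY \<equiv> (\<lambda>i. tensor_map S N' (obj Y i) (\<lambda>m. m) (bdry Y i))"

lemma chain_lift_boundaries: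
  "tensor_map S N' (obj Y q) (\<lambda>c. c) (f q) ` chain_boundaries cX bX q \<subseteq> chain_boundaries cY bY q"
proof (rule image_subsetI)
  fix z assume "z \<in> chain_boundaries cX bX q"
  then obtain x where x: "x \<in> carrier (obj X (Suc q))" "z = one_tensor R k N (obj X q) (bdry X q x)"
    unfolding A.tor_boundaries[OF X] by blast
  have "tensor_map S N' (obj Y q) (\<lambda>c. c) (f q) z = one_tensor S k N' (obj Y q) (bdry Y q (f (Suc q) x))"
    using chain_lift_one_tensor[OF linear_mapsD(1)[OF resolution_bdry[OF X] x(1)]] x chain_liftD(2)
    by simp
  then show "tensor_map S N' (obj Y q) (\<lambda>c. c) (f q) z \<in> chain_boundaries cY bY q"
    unfolding B.tor_boundaries[OF Y] using chain_liftD(4)[OF x(1)] by (rule image_eqI)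
qed

lemma chain_lift_cycles:
  "tensor_map S N' (obj Y q) (\<lambda>c. c) (f q) ` chain_cycles cX bX q \<subseteq> chain_cycles cY bY q"
proof (rule image_subsetI)
  fix z assume z: "z \<in> chain_cycles cX bX q"
  then obtain x where x: "x \<in> carrier (obj X q)" "z = one_tensor R k N (obj X q) x"
    using A.tor_cycle_elem[OF X] by blast
  have fz: "tensor_map S N' (obj Y q) (\<lambda>c. c) (f q) z = one_tensor S k N' (obj Y q) (f q x)"
    using chain_lift_one_tensor x by simp
  show "tensor_map S N' (obj Y q) (\<lambda>c. c) (f q) z \<in> chain_cycles cY bY q"
  proof (cases q)
    case 0
    then show ?thesis
      using B.one_tensor_closed[OF chain_liftD(4)[OF x(1)]] fz by (simp add: chain_cycles_def)
  next
    case (Suc i)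
    have fx: "f (Suc i) x \<in> carrier (obj Y (Suc i))" using chain_liftD(4) x Suc by simp
    have dx: "bdry X i x \<in> carrier (obj X i)"
      using linear_mapsD(1)[OF resolution_bdry[OF X]] x Suc by simp
    have "one_tensor R k N (obj X i) (bdry X i x) = \<one>\<^bsub>tensor R N (obj X i)\<^esub>"
      using z x A.tor_bdry_one_tensor[OF X, of x i] by (simp add: chain_cycles_def Suc kernel_def)
    then have "one_tensor S k N' (obj Y i) (f i (bdry X i x)) = \<one>\<^bsub>tensor S N' (obj Y i)\<^esub>"
      using chain_lift_one_tensor[OF dx]
        hom_one[OF tensor_map_hom[OF resolution_module[OF X] resolution_module[OF Y] chain_liftD(1)],
          OF comm_group.axioms(2)[OF comm_group_tensor[OF A.module_axioms resolution_module[OF X]]]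
          comm_group.axioms(2)[OF comm_group_tensor[OF B.module_axioms resolution_module[OF Y]]], of i]
      by simp
    then have "tensor_map S N' (obj Y i) (\<lambda>m. m) (bdry Y i) (one_tensor S k N' (obj Y (Suc i)) (f (Suc i) x)) =
        \<one>\<^bsub>tensor S N' (obj Y i)\<^esub>"
      using B.tor_bdry_one_tensor[OF Y fx] chain_liftD(2)[of x i] x Suc by simp
    then show ?thesis
      using fz Suc B.one_tensor_closed[OF fx] by (simp add: chain_cycles_def kernel_def)
  qed
qed

lemma tensor_map_cycles_hom:
  "tensor_map S N' (obj Y q) (\<lambda>c. c) (f q) \<in>
    hom ((cX q)\<lparr>carrier := chain_cycles cX bX q\<rparr>) ((cY q)\<lparr>carrier := chain_cycles cY bY q\<rparr>)"
proof (rule homI)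
  have hom: "tensor_map S N' (obj Y q) (\<lambda>c. c) (f q) \<in> hom (cX q) (cY q)"
    by (rule tensor_map_hom[OF resolution_module[OF X] resolution_module[OF Y] chain_liftD(1)])
  note sub = subgroup.mem_carrier[OF abelian_chain_complex.chain_cycles_subgroup[OF A.tor_complex[OF X]]]
  show "tensor_map S N' (obj Y q) (\<lambda>c. c) (f q) x \<in> carrier ((cY q)\<lparr>carrier := chain_cycles cY bY q\<rparr>)"
    if "x \<in> carrier ((cX q)\<lparr>carrier := chain_cycles cX bX q\<rparr>)" for x
    using that chain_lift_cycles by auto
  show "tensor_map S N' (obj Y q) (\<lambda>c. c) (f q) (x \<otimes>\<^bsub>(cX q)\<lparr>carrier := chain_cycles cX bX q\<rparr>\<^esub> y) =
      tensor_map S N' (obj Y q) (\<lambda>c. c) (f q) x \<otimes>\<^bsub>(cY q)\<lparr>carrier := chain_cycles cY bY q\<rparr>\<^esub>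
      tensor_map S N' (obj Y q) (\<lambda>c. c) (f q) y"
    if "x \<in> carrier ((cX q)\<lparr>carrier := chain_cycles cX bX q\<rparr>)"
      "y \<in> carrier ((cX q)\<lparr>carrier := chain_cycles cX bX q\<rparr>)" for x y
    using that sub hom_mult[OF hom] by simp
qed

text \<open>Multiplication of sets reads only the group operation, so restricting the carrier to the
  cycles changes nothing. The restricted form is the one to which the lemmas on quotient groups
  apply.\<close>

lemma Tor_map_eq:
  "Tor_map S N' Y (\<lambda>c. c) f q = quotient_map ((cY q)\<lparr>carrier := chain_cycles cY bY q\<rparr>)
     (chain_boundaries cY bY q) (tensor_map S N' (obj Y q) (\<lambda>c. c) (f q))"
  by (simp add: Tor_map_def quotient_map_def fun_eq_iff)

lemma Tor_map_hom: "Tor_map S N' Y (\<lambda>c. c) f q \<in> hom (Tor R N X q) (Tor S N' Y q)"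
  unfolding Tor_map_eq Tor_def chain_homology_def
  by (intro quotient_map_hom tensor_map_cycles_hom chain_lift_boundaries
      abelian_chain_complex.chain_cycles_comm_group abelian_chain_complex.chain_boundaries_subgroup
      A.tor_complex B.tor_complex X Y)

lemma Tor_map_rcos:
  assumes "z \<in> chain_cycles cX bX q"
  shows "Tor_map S N' Y (\<lambda>c. c) f q (chain_boundaries cX bX q #>\<^bsub>cX q\<^esub> z) =
    chain_boundaries cY bY q #>\<^bsub>cY q\<^esub> tensor_map S N' (obj Y q) (\<lambda>c. c) (f q) z"
proof -
  have "z \<in> carrier ((cX q)\<lparr>carrier := chain_cycles cX bX q\<rparr>)" using assms by simp
  from quotient_map_rcos[OF comm_group.axioms(2)[OF abelian_chain_complex.chain_cycles_comm_group[OF A.tor_complex[OF X]]]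
      comm_group.axioms(2)[OF abelian_chain_complex.chain_cycles_comm_group[OF B.tor_complex[OF Y]]]
      abelian_chain_complex.chain_boundaries_subgroup[OF A.tor_complex[OF X]]
      abelian_chain_complex.chain_boundaries_subgroup[OF B.tor_complex[OF Y]]
      tensor_map_cycles_hom chain_lift_boundaries this]
  show ?thesis unfolding Tor_map_eq by simp
qed

lemma Tor_map_group_hom: "group_hom (Tor R N X q) (Tor S N' Y q) (Tor_map S N' Y (\<lambda>c. c) f q)"
  using Tor_map_hom A.tor_comm_group[OF X] B.tor_comm_group[OF Y]
  by (intro group_hom.intro) (auto simp: group_hom_axioms_def comm_group_def)

lemma Tor_map_iso_trivial:
  assumes "trivial_group (Tor R N X q)" "trivial_group (Tor S N' Y q)"
  shows "Tor_map S N' Y (\<lambda>c. c) f q \<in> iso (Tor R N X q) (Tor S N' Y q)"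
proof -
  interpret h: group_hom "Tor R N X q" "Tor S N' Y q" "Tor_map S N' Y (\<lambda>c. c) f q"
    by (rule Tor_map_group_hom)
  show ?thesis
    unfolding h.iso_iff using assms by (simp add: trivial_group_def)
qed

text \<open>In degree \<^verbatim>\<open>0\<close> both sides are identified with \<^verbatim>\<open>k\<close> by the augmentations.\<close>

lemma Tor_map_iso_0: "Tor_map S N' Y (\<lambda>c. c) f 0 \<in> iso (Tor R N X 0) (Tor S N' Y 0)"
proof -
  interpret h: group_hom "Tor R N X 0" "Tor S N' Y 0" "Tor_map S N' Y (\<lambda>c. c) f 0"
    by (rule Tor_map_group_hom)
  note lX = resolution_module[OF X] and lY = resolution_module[OF Y]
  have cyc: "chain_cycles cX bX 0 = carrier (cX 0)" "chain_cycles cY bY 0 = carrier (cY 0)"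
    by (simp_all add: chain_cycles_def)
  interpret CX: comm_group "cX 0" by (rule comm_group_tensor[OF A.module_axioms lX])
  interpret CY: comm_group "cY 0" by (rule comm_group_tensor[OF B.module_axioms lY])
  have BX: "subgroup (chain_boundaries cX bX 0) (cX 0)"
    using abelian_chain_complex.chain_boundaries_subgroup[OF A.tor_complex[OF X], of 0] by (simp add: cyc)
  have BY: "subgroup (chain_boundaries cY bY 0) (cY 0)"
    using abelian_chain_complex.chain_boundaries_subgroup[OF B.tor_complex[OF Y], of 0] by (simp add: cyc)
  have carX: "carrier (Tor R N X 0) = (\<lambda>x. chain_boundaries cX bX 0 #>\<^bsub>cX 0\<^esub> x) ` carrier (cX 0)"
    unfolding Tor_def chain_homology_def carrier_FactGroup by (simp add: cyc)
  have carY: "carrier (Tor S N' Y 0) = (\<lambda>x. chain_boundaries cY bY 0 #>\<^bsub>cY 0\<^esub> x) ` carrier (cY 0)"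
    unfolding Tor_def chain_homology_def carrier_FactGroup by (simp add: cyc)
  have oneX: "\<one>\<^bsub>Tor R N X 0\<^esub> = chain_boundaries cX bX 0"
    and oneY: "\<one>\<^bsub>Tor S N' Y 0\<^esub> = chain_boundaries cY bY 0"
    by (simp_all add: Tor_def chain_homology_def)
  have map: "Tor_map S N' Y (\<lambda>c. c) f 0 (chain_boundaries cX bX 0 #>\<^bsub>cX 0\<^esub> one_tensor R k N (obj X 0) x) =
      chain_boundaries cY bY 0 #>\<^bsub>cY 0\<^esub> one_tensor S k N' (obj Y 0) (f 0 x)" if "x \<in> carrier (obj X 0)" for x
    using Tor_map_rcos[of "one_tensor R k N (obj X 0) x" 0] A.one_tensor_closed[OF that]
      chain_lift_one_tensor[OF that] by (simp add: cyc)
  show ?thesis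
    unfolding h.iso_iff
  proof (intro conjI ballI impI subsetI)
    fix D assume "D \<in> carrier (Tor S N' Y 0)"
    then obtain w where w: "w \<in> carrier (cY 0)" "D = chain_boundaries cY bY 0 #>\<^bsub>cY 0\<^esub> w"
      unfolding carY by blast
    then obtain y where y: "y \<in> carrier (obj Y 0)" "w = one_tensor S k N' (obj Y 0) y"
      using B.one_tensor_surj[OF lY] by blast
    \<comment> \<open>Surjectivity: the augmentation of \<open>y\<close> is lifted to some
      \<open>x\<close> in \<open>X\<close>. Then \<open>f 0 x\<close> differs from \<open>y\<close>
      by an element of the kernel of the augmentation, that is, by a boundary.\<close>
    have "augm Y y \<in> carrier N"
      using linear_mapsD(1)[OF resolution_augm[OF Y] y(1)] by (simp add: A.carrier_N B.carrier_N)
    then obtain x where x: "x \<in> carrier (obj X 0)" "augm X x = augm Y y"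
      using resolution_augm_surj[OF X] by blast
    have fx: "f 0 x \<in> carrier (obj Y 0)" by (rule chain_liftD(4)[OF x(1)])
    interpret Y0: left_module S "obj Y 0" by (rule lY)
    have "augm Y (y \<ominus>\<^bsub>obj Y 0\<^esub> f 0 x) = \<zero>\<^bsub>N'\<^esub>"
      using linear_maps_minus[OF lY B.module_axioms resolution_augm[OF Y] y(1) fx] chain_liftD(3)[OF x(1)] x(2)
        linear_mapsD(1)[OF resolution_augm[OF Y] y(1)]
      by (simp add: B.M.minus_eq B.M.r_neg)
    then obtain v where v: "v \<in> carrier (obj Y 1)" "bdry Y 0 v = y \<ominus>\<^bsub>obj Y 0\<^esub> f 0 x"
      using resolution_exact_0[OF Y] y(1) fx by blast
    have vb: "one_tensor S k N' (obj Y 0) (bdry Y 0 v) \<in> chain_boundaries cY bY 0"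
      unfolding B.tor_boundaries[OF Y] using v(1) by (intro imageI) simp
    have "w = one_tensor S k N' (obj Y 0) (bdry Y 0 v) \<otimes>\<^bsub>cY 0\<^esub> one_tensor S k N' (obj Y 0) (f 0 x)"
      unfolding y(2) v(2) using y(1) fx B.one_tensor_add[OF lY[of 0], of "y \<ominus>\<^bsub>obj Y 0\<^esub> f 0 x" "f 0 x", symmetric]
      by (simp add: Y0.M.minus_eq Y0.M.a_assoc Y0.M.l_neg)
    then have "w \<in> chain_boundaries cY bY 0 #>\<^bsub>cY 0\<^esub> one_tensor S k N' (obj Y 0) (f 0 x)"
      using vb unfolding r_coset_def by blast
    then have "D = chain_boundaries cY bY 0 #>\<^bsub>cY 0\<^esub> one_tensor S k N' (obj Y 0) (f 0 x)"
      using CY.repr_independence[OF _ B.one_tensor_closed[OF fx] BY] w(2) by simp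
    then have "D = Tor_map S N' Y (\<lambda>c. c) f 0 (chain_boundaries cX bX 0 #>\<^bsub>cX 0\<^esub> one_tensor R k N (obj X 0) x)"
      using map[OF x(1)] by simp
    then show "D \<in> Tor_map S N' Y (\<lambda>c. c) f 0 ` carrier (Tor R N X 0)"
      unfolding carX using A.one_tensor_closed[OF x(1)] by blast
  next
    fix D assume "D \<in> carrier (Tor R N X 0)" and one: "Tor_map S N' Y (\<lambda>c. c) f 0 D = \<one>\<^bsub>Tor S N' Y 0\<^esub>"
    then obtain w where w: "w \<in> carrier (cX 0)" "D = chain_boundaries cX bX 0 #>\<^bsub>cX 0\<^esub> w"
      unfolding carX by blast
    then obtain x where x: "x \<in> carrier (obj X 0)" "w = one_tensor R k N (obj X 0) x"
      using A.one_tensor_surj[OF lX] by blast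
    have fx: "f 0 x \<in> carrier (obj Y 0)" by (rule chain_liftD(4)[OF x(1)])
    \<comment> \<open>Injectivity: the augmentation depends only on the class in the tensor product
      and kills boundaries. If the class of \<open>f 0 x\<close> is a boundary, then
      \<open>x\<close> has augmentation zero and is itself a boundary.\<close>
    have "chain_boundaries cY bY 0 #>\<^bsub>cY 0\<^esub> one_tensor S k N' (obj Y 0) (f 0 x) = chain_boundaries cY bY 0"
      using map[OF x(1)] one w(2) x(2) oneY by simp
    then have "one_tensor S k N' (obj Y 0) (f 0 x) \<in> chain_boundaries cY bY 0"
      using CY.rcos_self[OF B.one_tensor_closed[OF fx] BY] by simp
    then obtain y where y: "y \<in> carrier (obj Y 1)"
      "one_tensor S k N' (obj Y 0) (f 0 x) = one_tensor S k N' (obj Y 0) (bdry Y 0 y)"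
      by (auto simp: B.tor_boundaries[OF Y])
    have "bdry Y 0 y \<in> carrier (obj Y 0)"
      using linear_mapsD(1)[OF resolution_bdry[OF Y, of 0], of y] y(1) by simp
    then have "augm Y (f 0 x) = augm Y (bdry Y 0 y)"
      using B.one_tensor_eqD[OF lY resolution_augm[OF Y] fx _ y(2)] by simp
    then have "augm X x = \<zero>\<^bsub>N\<^esub>"
      using chain_liftD(3)[OF x(1)] resolution_augm_bdry[OF Y y(1)] by (simp add: A.zero_N B.zero_N)
    then obtain v where v: "v \<in> carrier (obj X 1)" "bdry X 0 v = x"
      using resolution_exact_0[OF X x(1)] by blast
    then have "w \<in> chain_boundaries cX bX 0"
      unfolding A.tor_boundaries[OF X] using x(2) by (intro image_eqI[of _ _ v]) auto
    then show "D = \<one>\<^bsub>Tor R N X 0\<^esub>"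
      using CX.coset_join2[OF w(1) BX] w(2) oneX by simp
  qed
qed

end

end

section \<open>Generating Motzkin diagrams\<close>

lemma motzkin_diagram_edge:
  assumes "d \<in> motzkin_diagrams n" "e \<in> d"
  obtains a b where "e = {a, b}" "a \<noteq> b" "a \<in> nodes n" "b \<in> nodes n"
  using assms unfolding motzkin_diagrams_def by blast

lemma motzkin_diagram_edge_unique:
  assumes "d \<in> motzkin_diagrams n" "e \<in> d" "e' \<in> d" "x \<in> e" "x \<in> e'"
  shows "e = e'"
proof (rule ccontr)
  assume "e \<noteq> e'"
  then have "disjnt e e'" using assms(1-3) by (auto simp: motzkin_diagrams_def pairwise_def)
  then show False using assms(4,5) by (auto simp: disjnt_def)
qed

lemma motzkin_diagram_no_loop: "d \<in> motzkin_diagrams n \<Longrightarrow> {a, a} \<in> d \<Longrightarrow> False"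
  by (erule motzkin_diagram_edge, assumption) (auto simp: doubleton_eq_iff)

lemma motzkin_diagram_nodes: "d \<in> motzkin_diagrams n \<Longrightarrow> e \<in> d \<Longrightarrow> e \<subseteq> nodes n"
  by (auto elim: motzkin_diagram_edge)

lemma finite_motzkin_diagrams: "finite (motzkin_diagrams n)"
proof (rule finite_subset)
  show "motzkin_diagrams n \<subseteq> Pow (Pow (nodes n))"
    using motzkin_diagram_nodes by blast
qed (simp add: nodes_def)

text \<open>
  A generator \<^verbatim>\<open>(N, c)\<close> prescribes the edges \<^verbatim>\<open>c\<close> at a set \<^verbatim>\<open>N\<close> of left nodes: either one left node is
  unconnected, or two consecutive left nodes are connected.
\<close>

definition generators :: "nat \<Rightarrow> (node set \<times> diagram) set" where
  "generators n = {({Lft j}, {}) | j. j < n} \<union>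
     {({Lft i, Lft (Suc i)}, {{Lft i, Lft (Suc i)}}) | i. Suc i < n}"

text \<open>Prescribing the whole set of edges that meet \<open>fst g\<close> treats both kinds of
  generators alike: the empty set means an unconnected node, a nonempty one an edge.\<close>

definition generated_diagrams :: "nat \<Rightarrow> node set \<times> diagram \<Rightarrow> diagram set" where
  "generated_diagrams n g = {d \<in> motzkin_diagrams n. {e \<in> d. e \<inter> fst g \<noteq> {}} = snd g}"

text \<open>Since the mirror images of \<open>fst g\<close> are unconnected, the middle copies of
  \<open>fst g\<close> receive no edge from this diagram when it is the left factor of a
  product.\<close>

definition generator_diagram :: "nat \<Rightarrow> node set \<times> diagram \<Rightarrow> diagram" where
  "generator_diagram n g = snd g \<union> {{Lft l, Rgt l} | l. l < n \<and> Lft l \<notin> fst g}"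

lemma generator_cases:
  assumes "g \<in> generators n"
  obtains (missing) j where "j < n" "fst g = {Lft j}" "snd g = {}"
  | (cap) i where "Suc i < n" "fst g = {Lft i, Lft (Suc i)}" "snd g = {{Lft i, Lft (Suc i)}}"
  using assms unfolding generators_def by auto

lemma generator_fst: "g \<in> generators n \<Longrightarrow> fst g \<subseteq> Lft ` {..<n}"
  and generator_fst_nonempty: "g \<in> generators n \<Longrightarrow> fst g \<noteq> {}"
  and generator_snd: "g \<in> generators n \<Longrightarrow> snd g \<subseteq> {fst g}"
  by (auto elim!: generator_cases)

lemma finite_generators: "finite (generators n)"
proof -
  have "generators n \<subseteq> (\<lambda>j. ({Lft j}, {})) ` {..<n} \<union>
      (\<lambda>i. ({Lft i, Lft (Suc i)}, {{Lft i, Lft (Suc i)}})) ` {..<n}"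
    unfolding generators_def by auto
  then show ?thesis by (rule finite_subset) simp
qed

lemma generator_diagram_touching:
  assumes "g \<in> generators n"
  shows "{e \<in> generator_diagram n g. e \<inter> fst g \<noteq> {}} = snd g"
  using assms by (cases rule: generator_cases) (auto simp: generator_diagram_def)

lemma generator_diagram_in:
  assumes g: "g \<in> generators n"
  shows "generator_diagram n g \<in> motzkin_diagrams n"
proof -
  have "pairwise disjnt (generator_diagram n g)"
    using g by (cases rule: generator_cases)
      (auto simp: generator_diagram_def pairwise_def disjnt_def)
  moreover have "generator_diagram n g \<subseteq> {{a, b} | a b. a \<in> nodes n \<and> b \<in> nodes n \<and> a \<noteq> b}"
  proof
    fix e assume "e \<in> generator_diagram n g"
    with g consider i where "Suc i < n" "e = {Lft i, Lft (Suc i)}" | l where "l < n" "e = {Lft l, Rgt l}"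
      by (cases rule: generator_cases) (auto simp: generator_diagram_def)
    then show "e \<in> {{a, b} | a b. a \<in> nodes n \<and> b \<in> nodes n \<and> a \<noteq> b}"
    proof cases
      case 1
      then have "Lft i \<in> nodes n" "Lft (Suc i) \<in> nodes n" "Lft i \<noteq> Lft (Suc i)" by (auto simp: nodes_def)
      with 1 show ?thesis by blast
    next
      case 2
      then have "Lft l \<in> nodes n" "Rgt l \<in> nodes n" "Lft l \<noteq> Rgt l" by (auto simp: nodes_def)
      with 2 show ?thesis by blast
    qed
  qed
  moreover have "planar_diagram (generator_diagram n g)"
    unfolding planar_diagram_def
  proof (rule notI, elim exE conjE)
    fix a b c e assume ac: "{a, c} \<in> generator_diagram n g" and be: "{b, e} \<in> generator_diagram n g"
      and o: "before a b" "before b c" "before c e"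
    \<comment> \<open>Such edges cannot cross: consecutive left nodes have no node between them, and
      horizontal edges are nested in the boundary order.\<close>
    have edge: "(\<exists>i. {u, v} = {Lft i, Lft (Suc i)}) \<or> (\<exists>l. {u, v} = {Lft l, Rgt l})"
      if "{u, v} \<in> generator_diagram n g" for u v
      using g that by (cases rule: generator_cases) (auto simp: generator_diagram_def)
    show False
      using edge[OF ac] edge[OF be] o
      by (cases a; cases b; cases c; cases e) (auto simp: doubleton_eq_iff)
  qed
  ultimately show ?thesis by (simp add: motzkin_diagrams_def)
qed

lemma generator_diagram_generated: "g \<in> generators n \<Longrightarrow> generator_diagram n g \<in> generated_diagrams n g"
  by (simp add: generated_diagrams_def generator_diagram_in generator_diagram_touching)

text \<open>A prescribed edge covers all of \<open>fst g\<close>, so the condition can be read off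
  at any single node of \<open>fst g\<close>.\<close>

lemma generated_diagram_at:
  assumes g: "g \<in> generators n" and d: "d \<in> generated_diagrams n g" and x: "x \<in> fst g"
  shows "{e \<in> d. x \<in> e} = snd g"
proof -
  have t: "{e \<in> d. e \<inter> fst g \<noteq> {}} = snd g" using d by (simp add: generated_diagrams_def)
  show ?thesis
  proof (intro subset_antisym subsetI)
    fix e assume "e \<in> {e \<in> d. x \<in> e}"
    then show "e \<in> snd g" unfolding t[symmetric] using x by blast
  next
    fix e assume e: "e \<in> snd g"
    then have "e = fst g" using generator_snd[OF g] by blast
    moreover have "e \<in> d" using e unfolding t[symmetric] by simp
    ultimately show "e \<in> {e \<in> d. x \<in> e}" using x by simp
  qed
qed

lemma generator_fst_eq:
  assumes "g \<in> generators n" "x \<in> fst g"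
  shows "fst g = (if snd g = {} then {x} else the_elem (snd g))"
  using assms by (cases rule: generator_cases) simp_all

text \<open>A diagram in both sets has only one set of edges at a shared node, and a generator is
  determined by one of its nodes together with its edges.\<close>

lemma generators_disjoint:
  assumes g: "g \<in> generators n" and h: "h \<in> generators n" and "g \<noteq> h"
  shows "fst g \<inter> fst h = {} \<or> generated_diagrams n g \<inter> generated_diagrams n h = {}"
proof (rule ccontr)
  assume "\<not> ?thesis"
  then obtain x d where x: "x \<in> fst g" "x \<in> fst h"
    and d: "d \<in> generated_diagrams n g" "d \<in> generated_diagrams n h" by blast
  have s: "snd g = snd h"
    using generated_diagram_at[OF g d(1) x(1)] generated_diagram_at[OF h d(2) x(2)] by simp
  moreover have "fst g = fst h"
    using generator_fst_eq[OF g x(1)] generator_fst_eq[OF h x(2)] s by simp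
  ultimately show False using \<open>g \<noteq> h\<close> by (simp add: prod_eq_iff)
qed


section \<open>Products with generating diagrams\<close>

text \<open>The tool for bounding components from above: a set that contains every edge it meets
  contains the component of each of its members.\<close>

lemma glued_connected_closed:
  assumes "(a, b) \<in> glued_connected x y" "a \<in> Q"
    and "\<And>e. e \<in> left_edges x \<union> right_edges y \<Longrightarrow> e \<inter> Q \<noteq> {} \<Longrightarrow> e \<subseteq> Q"
  shows "b \<in> Q"
  using assms(1) unfolding glued_connected_def
proof (induction rule: rtrancl_induct)
  case (step u v)
  then show ?case using assms(3)[of "{u, v}"] by auto
qed (rule assms(2))

lemma glued_connected_sym: "(a, b) \<in> glued_connected x y \<Longrightarrow> (b, a) \<in> glued_connected x y"
proof -
  have "sym {(a, b). {a, b} \<in> left_edges x \<union> right_edges y}"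
    by (auto simp: sym_def insert_commute)
  then show "(a, b) \<in> glued_connected x y \<Longrightarrow> (b, a) \<in> glued_connected x y"
    unfolding glued_connected_def by (rule symD[OF sym_rtrancl])
qed

lemma glued_connected_trans:
  "(a, b) \<in> glued_connected x y \<Longrightarrow> (b, c) \<in> glued_connected x y \<Longrightarrow> (a, c) \<in> glued_connected x y"
  unfolding glued_connected_def by (rule rtrancl_trans)

lemma glued_connected_left:
  assumes "{a, b} \<in> x"
  shows "(glue_left a, glue_left b) \<in> glued_connected x y"
proof -
  have "{glue_left a, glue_left b} \<in> left_edges x"
    unfolding left_edges_def by (rule image_eqI[OF _ assms]) simp
  then show ?thesis
    unfolding glued_connected_def by (intro r_into_rtrancl) simp
qed

lemma glued_connected_right:
  assumes "{a, b} \<in> y"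
  shows "(glue_right a, glue_right b) \<in> glued_connected x y"
proof -
  have "{glue_right a, glue_right b} \<in> right_edges y"
    unfolding right_edges_def by (rule image_eqI[OF _ assms]) simp
  then show ?thesis
    unfolding glued_connected_def by (intro r_into_rtrancl) simp
qed

lemma glue_eq_iff [simp]:
  "glue_left a = glue_left b \<longleftrightarrow> a = b"
  "glue_right a = glue_right b \<longleftrightarrow> a = b"
  "outer a = outer b \<longleftrightarrow> a = b"
  "glue_right a \<noteq> GL i" "GL i \<noteq> glue_right a"
  "outer a \<noteq> GM i" "GM i \<noteq> outer a"
  "glue_left a \<noteq> GR i" "GR i \<noteq> glue_left a"
  by (cases a; cases b; simp)+

lemma glue_simps [simp]:
  "glue_left a = GL i \<longleftrightarrow> a = Lft i" "GL i = glue_left a \<longleftrightarrow> a = Lft i"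
  "glue_left a = GM i \<longleftrightarrow> a = Rgt i" "GM i = glue_left a \<longleftrightarrow> a = Rgt i"
  "glue_right a = GM i \<longleftrightarrow> a = Lft i" "GM i = glue_right a \<longleftrightarrow> a = Lft i"
  "outer a = GL i \<longleftrightarrow> a = Lft i" "GL i = outer a \<longleftrightarrow> a = Lft i"
  by (cases a; auto)+

lemma outer_eq_glue_right_iff: "outer a = glue_right b \<longleftrightarrow> a = b \<and> a \<in> range Rgt"
  by (cases a; cases b; auto)

text \<open>No edge of \<open>y\<close> reaches the outer left column, so the outer copies of
  \<open>fst g\<close> meet only edges of \<open>x\<close>, and these stay inside
  \<open>fst g\<close>. Hence multiplying from the right preserves the prescription.\<close>

lemma compose_touching:
  assumes g: "g \<in> generators n" and x: "{e \<in> x. e \<inter> fst g \<noteq> {}} = snd g"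
  shows "{e \<in> compose_diagrams n x y. e \<inter> fst g \<noteq> {}} = snd g"
proof (intro subset_antisym subsetI)
  fix e assume "e \<in> {e \<in> compose_diagrams n x y. e \<inter> fst g \<noteq> {}}"
  then obtain a b where e: "e = {a, b}" "a \<noteq> b" "(outer a, outer b) \<in> glued_connected x y" "a \<in> fst g"
    unfolding compose_diagrams_def using glued_connected_sym by blast
  have closed: "E \<subseteq> outer ` fst g"
    if "E \<in> left_edges x \<union> right_edges y" "E \<inter> outer ` fst g \<noteq> {}" for E
  proof -
    from that(2) obtain i where i: "Lft i \<in> fst g" "GL i \<in> E"
      using generator_fst[OF g] by (force simp: image_iff)
    then have "E \<notin> right_edges y" by (auto simp: right_edges_def)
    then have "E \<in> left_edges x" using that(1) by blast
    then obtain e where e: "e \<in> x" "E = glue_left ` e" unfolding left_edges_def by (rule imageE)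
    then have "Lft i \<in> e" using i by auto
    then have "e \<in> snd g" using e i x by blast
    then have "e = fst g" using generator_snd[OF g] by blast
    then show ?thesis using generator_fst[OF g] e(2) by (auto simp: image_iff)
  qed
  have "outer b \<in> outer ` fst g"
    by (rule glued_connected_closed[OF e(3)]) (use e(4) closed in auto)
  then have "b \<in> fst g" by auto
  with e show "e \<in> snd g" by (cases rule: generator_cases[OF g]) auto
next
  fix e assume e: "e \<in> snd g"
  with g obtain i where i: "Suc i < n" "e = {Lft i, Lft (Suc i)}" "fst g = e"
    by (cases rule: generator_cases) auto
  have "e \<in> x" using e x by blast
  then have "(outer (Lft i), outer (Lft (Suc i))) \<in> glued_connected x y"
    using glued_connected_left[of "Lft i" "Lft (Suc i)" x y] i by simp
  moreover have "Lft i \<in> nodes n" "Lft (Suc i) \<in> nodes n" "Lft i \<noteq> Lft (Suc i)"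
    using i(1) by (auto simp: nodes_def)
  ultimately have "e \<in> compose_diagrams n x y"
    unfolding compose_diagrams_def i(2) by blast
  then show "e \<in> {e \<in> compose_diagrams n x y. e \<inter> fst g \<noteq> {}}"
    using i by simp
qed

context
  fixes n :: nat and g :: "node set \<times> diagram"
  assumes g: "g \<in> generators n"
begin

lemma generator_left_edges:
  "left_edges (generator_diagram n g) =
    (`) glue_left ` snd g \<union> {{GL l, GM l} | l. l < n \<and> Lft l \<notin> fst g}"
proof -
  have "(`) glue_left ` {{Lft l, Rgt l} | l. l < n \<and> Lft l \<notin> fst g} = {{GL l, GM l} | l. l < n \<and> Lft l \<notin> fst g}"
    unfolding setcompr_eq_image image_image by simp
  then show ?thesis by (simp add: left_edges_def generator_diagram_def image_Un)
qed

text \<open>A left node is linked to its middle copy by a horizontal edge, while a right node has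
  the same image under \<open>outer\<close> and \<open>glue_right\<close>.\<close>

lemma glued_connected_horizontal:
  assumes "a \<in> nodes n" "a \<notin> fst g"
  shows "(outer a, glue_right a) \<in> glued_connected (generator_diagram n g) d"
proof (cases a)
  case (Lft l)
  then have "{Lft l, Rgt l} \<in> generator_diagram n g"
    using assms by (auto simp: generator_diagram_def nodes_def)
  from glued_connected_left[OF this] show ?thesis using Lft by simp
next
  case (Rgt l)
  then show ?thesis by (simp add: glued_connected_def)
qed

text \<open>Away from \<open>fst g\<close> the generator diagram looks like the identity, so gluing
  it on the left merely lengthens the edges of \<open>d\<close>.\<close>

lemma glued_connected_outer:
  assumes d: "d \<in> motzkin_diagrams n" and a: "a \<in> nodes n" "a \<notin> fst g" and b: "b \<in> nodes n" "b \<notin> fst g"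
    and "a \<noteq> b"
  shows "(outer a, outer b) \<in> glued_connected (generator_diagram n g) d \<longleftrightarrow> {a, b} \<in> d"
proof
  assume "{a, b} \<in> d"
  then show "(outer a, outer b) \<in> glued_connected (generator_diagram n g) d"
    using glued_connected_trans[OF glued_connected_trans[OF glued_connected_horizontal[OF a]
        glued_connected_right] glued_connected_sym[OF glued_connected_horizontal[OF b]]] by blast
next
  assume conn: "(outer a, outer b) \<in> glued_connected (generator_diagram n g) d"
  \<comment> \<open>\<open>B\<close> consists of \<open>a\<close> and its partner in
    \<open>d\<close>. \<open>Q\<close> collects their copies in the glued graph and is closed under
    its edges, so it bounds the component of \<open>a\<close>.\<close>
  define B where "B = {a} \<union> {b. {a, b} \<in> d}"
  define Q where "Q = glue_right ` B \<union> outer ` (B - fst g)"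
  have B: "e \<subseteq> B" if "e \<in> d" "u \<in> e" "u \<in> B" for e u
  proof -
    have "a \<in> e"
      using that motzkin_diagram_edge_unique[OF d, of e "{a, u}" u] by (auto simp: B_def)
    from d that(1) obtain v w where vw: "e = {v, w}" by (rule motzkin_diagram_edge)
    show ?thesis
      using \<open>a \<in> e\<close> that(1) unfolding vw B_def by (auto simp: insert_commute)
  qed
  have closed: "E \<subseteq> Q" if E: "E \<in> left_edges (generator_diagram n g) \<union> right_edges d" "E \<inter> Q \<noteq> {}" for E
    using E(1)
  proof
    assume "E \<in> left_edges (generator_diagram n g)"
    then consider e where "e \<in> snd g" "E = glue_left ` e" | l where "Lft l \<notin> fst g" "E = {GL l, GM l}"
      unfolding generator_left_edges by blast
    then show ?thesis
    proof cases
      case 1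
      \<comment> \<open>The prescribed edge has only outer copies of \<open>fst g\<close> as ends,
        and \<open>Q\<close> contains none of these.\<close>
      then have "E = GL ` {i. Lft i \<in> fst g}"
        using generator_snd[OF g] generator_fst[OF g] by (force simp: image_iff)
      then show ?thesis using E(2) by (auto simp: Q_def)
    next
      case 2
      then have "Lft l \<in> B" using E(2) by (auto simp: Q_def)
      then have "glue_right (Lft l) \<in> Q" "outer (Lft l) \<in> Q" using 2 unfolding Q_def by blast+
      then show ?thesis using 2 by simp
    qed
  next
    assume "E \<in> right_edges d"
    then obtain e where e: "e \<in> d" "E = glue_right ` e" by (auto simp: right_edges_def)
    with E(2) obtain u where u: "u \<in> e" "glue_right u \<in> Q" by blast
    then have "u \<in> B"
      unfolding Q_def by (metis DiffD1 UnE glue_eq_iff(2) imageE outer_eq_glue_right_iff)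
    with e u B show ?thesis unfolding Q_def by blast
  qed
  have "outer b \<in> Q"
    by (rule glued_connected_closed[OF conn _ closed]) (use a in \<open>auto simp: Q_def B_def\<close>)
  then have "b \<in> B"
    unfolding Q_def by (metis DiffD1 UnE glue_eq_iff(3) imageE outer_eq_glue_right_iff)
  then show "{a, b} \<in> d" using \<open>a \<noteq> b\<close> by (simp add: B_def)
qed

text \<open>A path that reaches the middle copy of a node of \<open>fst g\<close> is cut off from
  the left column, so the edges of \<open>d\<close> at \<open>fst g\<close> are lost and
  \<open>snd g\<close> takes their place.\<close>

lemma compose_generator:
  assumes d: "d \<in> motzkin_diagrams n"
  shows "compose_diagrams n (generator_diagram n g) d = snd g \<union> {e \<in> d. e \<inter> fst g = {}}"
proof -
  let ?p = "compose_diagrams n (generator_diagram n g) d"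
  have "{e \<in> ?p. e \<inter> fst g = {}} = {e \<in> d. e \<inter> fst g = {}}"
  proof (intro subset_antisym subsetI)
    fix e assume "e \<in> {e \<in> ?p. e \<inter> fst g = {}}"
    then obtain a b where "e = {a, b}" "a \<noteq> b" "a \<in> nodes n" "b \<in> nodes n" "a \<notin> fst g" "b \<notin> fst g"
      "(outer a, outer b) \<in> glued_connected (generator_diagram n g) d"
      unfolding compose_diagrams_def by blast
    then show "e \<in> {e \<in> d. e \<inter> fst g = {}}" using glued_connected_outer[OF d] by simp
  next
    fix e assume e: "e \<in> {e \<in> d. e \<inter> fst g = {}}"
    then obtain a b where ab: "e = {a, b}" "a \<noteq> b" "a \<in> nodes n" "b \<in> nodes n"
      using motzkin_diagram_edge[OF d, of e] by (metis (no_types, lifting) mem_Collect_eq)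
    with e have "(outer a, outer b) \<in> glued_connected (generator_diagram n g) d"
      using glued_connected_outer[OF d] by simp
    with ab e show "e \<in> {e \<in> ?p. e \<inter> fst g = {}}" unfolding compose_diagrams_def by blast
  qed
  moreover have "{e \<in> ?p. e \<inter> fst g \<noteq> {}} = snd g"
    by (rule compose_touching[OF g generator_diagram_touching[OF g]])
  ultimately show ?thesis by blast
qed

lemma compose_generator_id:
  assumes "d \<in> generated_diagrams n g"
  shows "compose_diagrams n (generator_diagram n g) d = d"
  using assms compose_generator[of d] by (auto simp: generated_diagrams_def)

text \<open>An edge in \<open>snd h\<close> is \<open>fst h\<close> itself and thus avoids
  \<open>fst g\<close>, so it survives; an edge in \<open>snd g\<close> is \<open>fst g\<close> and
  creates nothing new at \<open>fst h\<close>.\<close>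

lemma compose_generator_other:
  assumes "d \<in> motzkin_diagrams n" "{e \<in> d. e \<inter> fst h \<noteq> {}} = snd h" "h \<in> generators n"
    "fst g \<inter> fst h = {}"
  shows "{e \<in> compose_diagrams n (generator_diagram n g) d. e \<inter> fst h \<noteq> {}} = snd h"
  unfolding compose_generator[OF assms(1)]
  using assms(2,4) generator_snd[OF g] generator_snd[OF assms(3)] by blast

context
  fixes d assumes d: "d \<in> generated_diagrams n g"
begin

text \<open>Every other middle node is tied to the outer left column by a horizontal edge. The
  middle copy of \<open>fst g\<close> is a single node, or two nodes joined by the edge of
  \<open>d\<close>.\<close>

lemma middle_components_generator:
  "middle_components n (generator_diagram n g) d = {glue_right ` fst g}"
proof -
  let ?conn = "glued_connected (generator_diagram n g) d"
  have dm: "d \<in> motzkin_diagrams n" and dt: "{e \<in> d. e \<inter> fst g \<noteq> {}} = snd g"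
    using d by (auto simp: generated_diagrams_def)
  have range: "glue_right ` fst g \<subseteq> range GM" using generator_fst[OF g] by force
  have comp: "?conn `` {GM i} = glue_right ` fst g" if i: "Lft i \<in> fst g" for i
  proof (intro subset_antisym subsetI)
    have closed: "E \<subseteq> glue_right ` fst g"
      if E: "E \<in> left_edges (generator_diagram n g) \<union> right_edges d" "E \<inter> glue_right ` fst g \<noteq> {}" for E
    proof -
      obtain x where x: "x \<in> fst g" "glue_right x \<in> E" using E(2) by blast
      then obtain m where "x = Lft m" using generator_fst[OF g] by blast
      then obtain l where l: "GM l \<in> E" "Lft l \<in> fst g" using x by simp
      have "E \<notin> left_edges (generator_diagram n g)"
        unfolding generator_left_edges using l generator_snd[OF g] generator_fst[OF g] by auto
      then obtain e where e: "e \<in> d" "E = glue_right ` e" using E by (auto simp: right_edges_def)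
      then have "Lft l \<in> e" using l by auto
      then have "e \<in> snd g" using e l dt by blast
      then have "e = fst g" using generator_snd[OF g] by blast
      then show ?thesis using e by simp
    qed
    fix u assume "u \<in> ?conn `` {GM i}"
    then have "(GM i, u) \<in> ?conn" by simp
    then show "u \<in> glue_right ` fst g"
      by (rule glued_connected_closed[OF _ _ closed]) (use i in \<open>force+\<close>)
  next
    fix u assume "u \<in> glue_right ` fst g"
    then obtain x where x: "x \<in> fst g" "u = glue_right x" by blast
    show "u \<in> ?conn `` {GM i}"
    proof (cases "x = Lft i")
      case True
      then show ?thesis using x by (simp add: glued_connected_def)
    next
      case False
      then have "{Lft i, x} \<in> snd g" using i x by (cases rule: generator_cases[OF g]) auto
      then have "{Lft i, x} \<in> d" using dt by blast
      from glued_connected_right[OF this] show ?thesis using x by simp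
    qed
  qed
  have other: "\<not> ?conn `` {GM i} \<subseteq> range GM" if "i < n" "Lft i \<notin> fst g" for i
  proof -
    have "(GM i, GL i) \<in> ?conn"
      using glued_connected_sym[OF glued_connected_horizontal[of "Lft i" d]] that by (simp add: nodes_def)
    then show ?thesis by blast
  qed
  obtain i where i: "i < n" "Lft i \<in> fst g"
    using generator_fst[OF g] generator_fst_nonempty[OF g] by blast
  show ?thesis
  proof (intro subset_antisym subsetI)
    fix C assume "C \<in> middle_components n (generator_diagram n g) d"
    then show "C \<in> {glue_right ` fst g}"
      unfolding middle_components_def using comp other by blast
  next
    fix C assume "C \<in> {glue_right ` fst g}"
    then show "C \<in> middle_components n (generator_diagram n g) d"
      unfolding middle_components_def using comp[OF i(2)] range i(1) by blast
  qed
qed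

text \<open>Such a node has no edge from the generator diagram and at most one from
  \<open>d\<close>. So the middle component is an open path and never a loop.\<close>

lemma glued_degree_generator:
  assumes "Lft l \<in> fst g"
  shows "glued_degree (generator_diagram n g) d (GM l) \<noteq> 2"
proof -
  have dt: "{e \<in> d. e \<inter> fst g \<noteq> {}} = snd g"
    using d by (auto simp: generated_diagrams_def)
  have "{e \<in> left_edges (generator_diagram n g). GM l \<in> e} = {}"
    unfolding generator_left_edges using assms generator_snd[OF g] generator_fst[OF g] by auto
  moreover have "{e \<in> right_edges d. GM l \<in> e} \<subseteq> {glue_right ` fst g}"
  proof
    fix E assume "E \<in> {e \<in> right_edges d. GM l \<in> e}"
    then obtain e where e: "e \<in> d" "E = glue_right ` e" "Lft l \<in> e" by (auto simp: right_edges_def)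
    then have "e \<in> snd g" using assms dt by blast
    then show "E \<in> {glue_right ` fst g}" using generator_snd[OF g] e by blast
  qed
  then have "card {e \<in> right_edges d. GM l \<in> e} \<le> 1"
    using card_mono[of "{glue_right ` fst g}"] by auto
  ultimately show ?thesis unfolding glued_degree_def by (simp only: card.empty)
qed

lemma closed_loops_generator: "closed_loops n (generator_diagram n g) d = 0"
  and open_paths_generator: "open_paths n (generator_diagram n g) d = 1"
proof -
  obtain i where i: "Lft i \<in> fst g"
    using generator_fst[OF g] generator_fst_nonempty[OF g] by blast
  then have *: "GM i \<in> glue_right ` fst g" "glued_degree (generator_diagram n g) d (GM i) \<noteq> 2"
    using glued_degree_generator by force+
  then have "{C \<in> {glue_right ` fst g}. \<forall>a\<in>C. glued_degree (generator_diagram n g) d a = 2} = {}"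
    by blast
  then show "closed_loops n (generator_diagram n g) d = 0"
    unfolding closed_loops_def middle_components_generator by (simp only: card.empty)
  have "{C \<in> {glue_right ` fst g}. \<exists>a\<in>C. glued_degree (generator_diagram n g) d a \<noteq> 2} = {glue_right ` fst g}"
    using * by blast
  then show "open_paths n (generator_diagram n g) d = 1"
    unfolding open_paths_def middle_components_generator by simp
qed

end

end


section \<open>The identity diagram\<close>

lemma identity_diagram_in: "identity_diagram n \<in> motzkin_diagrams n"
proof -
  have "identity_diagram n \<subseteq> {{a, b} | a b. a \<in> nodes n \<and> b \<in> nodes n \<and> a \<noteq> b}"
  proof
    fix e assume "e \<in> identity_diagram n"
    then obtain l where "l < n" "e = {Lft l, Rgt l}" by (auto simp: identity_diagram_def)
    moreover from this have "Lft l \<in> nodes n" "Rgt l \<in> nodes n" "Lft l \<noteq> Rgt l" by (auto simp: nodes_def)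
    ultimately show "e \<in> {{a, b} | a b. a \<in> nodes n \<and> b \<in> nodes n \<and> a \<noteq> b}" by blast
  qed
  moreover have "pairwise disjnt (identity_diagram n)"
    by (auto simp: identity_diagram_def pairwise_def disjnt_def)
  moreover have "planar_diagram (identity_diagram n)"
    unfolding planar_diagram_def
  proof (rule notI, elim exE conjE)
    fix a b c e assume ac: "{a, c} \<in> identity_diagram n" and be: "{b, e} \<in> identity_diagram n"
      and o: "before a b" "before b c" "before c e"
    have edge: "\<exists>l. {u, v} = {Lft l, Rgt l}" if "{u, v} \<in> identity_diagram n" for u v
      using that by (auto simp: identity_diagram_def)
    show False
      using edge[OF ac] edge[OF be] o
      by (cases a; cases b; cases c; cases e) (auto simp: doubleton_eq_iff)
  qed
  ultimately show ?thesis by (simp add: motzkin_diagrams_def)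
qed

lemma permutation_like_identity: "permutation_like n (identity_diagram n)"
  by (auto simp: permutation_like_def identity_diagram_def nodes_def doubleton_eq_iff)

lemma generated_not_permutation_like:
  assumes "g \<in> generators n" "d \<in> generated_diagrams n g"
  shows "\<not> permutation_like n d"
  using assms(1)
proof (cases rule: generator_cases)
  case (missing j)
  then have "{e \<in> d. Lft j \<in> e} = {}"
    using generated_diagram_at[OF assms, of "Lft j"] by simp
  then have "Lft j \<notin> \<Union> d" by blast
  moreover have "Lft j \<in> nodes n" using missing by (simp add: nodes_def)
  ultimately show ?thesis by (auto simp: permutation_like_def)
next
  case (cap i)
  then have "{e \<in> d. Lft i \<in> e} = {{Lft i, Lft (Suc i)}}"
    using generated_diagram_at[OF assms, of "Lft i"] by simp
  then have "{Lft i, Lft (Suc i)} \<in> d" by blast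
  then show ?thesis by (auto simp: permutation_like_def)
qed

text \<open>An innermost edge between left nodes connects neighbours or encloses an unconnected node.\<close>

lemma left_arc_generated:
  assumes d: "d \<in> motzkin_diagrams n"
  shows "{Lft a, Lft c} \<in> d \<Longrightarrow> a < c \<Longrightarrow> \<exists>g\<in>generators n. d \<in> generated_diagrams n g"
proof (induction "c - a" arbitrary: a c rule: less_induct)
  case less
  have c: "c < n" using motzkin_diagram_nodes[OF d less.prems(1)] by (auto simp: nodes_def)
  have planar: "\<not> ({u, w} \<in> d \<and> {v, z} \<in> d \<and> before u v \<and> before v w \<and> before w z)" for u v w z
    using d unfolding motzkin_diagrams_def planar_diagram_def by blast
  show ?case
  proof (cases "c = Suc a")
    case True
    let ?e = "{Lft a, Lft (Suc a)}"
    have "{e \<in> d. e \<inter> ?e \<noteq> {}} = {?e}"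
    proof (intro subset_antisym subsetI)
      fix e assume "e \<in> {e \<in> d. e \<inter> ?e \<noteq> {}}"
      then obtain x where "e \<in> d" "x \<in> e" "x \<in> ?e" by blast
      then show "e \<in> {?e}"
        using motzkin_diagram_edge_unique[OF d, of e ?e x] less.prems(1) True by simp
    qed (use less.prems(1) True in auto)
    then have "d \<in> generated_diagrams n (?e, {?e})" using d by (simp add: generated_diagrams_def)
    moreover have "(?e, {?e}) \<in> generators n" using c True by (auto simp: generators_def)
    ultimately show ?thesis by blast
  next
    case False
    then have a: "Suc a < c" using less.prems by simp
    show ?thesis
    proof (cases "\<exists>e\<in>d. Lft (Suc a) \<in> e")
      case False
      then have "{e \<in> d. e \<inter> {Lft (Suc a)} \<noteq> {}} = {}" by blast
      then have "d \<in> generated_diagrams n ({Lft (Suc a)}, {})" using d by (simp add: generated_diagrams_def)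
      moreover have "({Lft (Suc a)}, {}) \<in> generators n" using a c by (auto simp: generators_def)
      ultimately show ?thesis by blast
    next
      case True
      then obtain e where e: "e \<in> d" "Lft (Suc a) \<in> e" by blast
      from motzkin_diagram_edge[OF d e(1)] obtain u v where "e = {u, v}" "u \<noteq> v" .
      then obtain z where z: "e = {Lft (Suc a), z}" "z \<noteq> Lft (Suc a)"
        using e(2) by (cases "u = Lft (Suc a)") (auto simp: insert_commute)
      have ez: "{Lft (Suc a), z} \<in> d" using e z by simp
      \<comment> \<open>The partner of node \<open>a + 1\<close> must be a left node strictly
        between \<open>a + 1\<close> and \<open>c\<close>, since any other choice crosses the edge
        from \<open>a\<close> to \<open>c\<close> or shares a node with it. This gives a shorter
        edge for the induction.\<close>
      show ?thesis
      proof (cases z)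
        case (Rgt j)
        then show ?thesis using planar[of "Lft a" "Lft c" "Lft (Suc a)" z] less.prems(1) ez a by simp
      next
        case (Lft j)
        have "z \<noteq> Lft a" "z \<noteq> Lft c"
          using motzkin_diagram_edge_unique[OF d less.prems(1) ez, of "Lft a"]
            motzkin_diagram_edge_unique[OF d less.prems(1) ez, of "Lft c"] a
          by (auto simp: doubleton_eq_iff)
        with Lft z(2) consider "j < a" | "Suc a < j" "j < c" | "c < j" by force
        then show ?thesis
        proof cases
          case 1
          then show ?thesis
            using planar[of "Lft j" "Lft (Suc a)" "Lft a" "Lft c"] less.prems(1) ez a Lft
            by (simp add: insert_commute)
        next
          case 2
          then show ?thesis using less.hyps[of j "Suc a"] ez Lft by simp
        next
          case 3
          then show ?thesis using planar[of "Lft a" "Lft c" "Lft (Suc a)" z] less.prems(1) ez a Lft by simp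
        qed
      qed
    qed
  qed
qed

text \<open>Without edges between left nodes and without unconnected left nodes, each left node
  \<open>i\<close> is joined to a right node \<open>s i\<close>. Planarity makes \<open>s\<close>
  strictly increasing on \<open>n\<close> numbers, so it is the identity.\<close>

lemma not_generated:
  assumes d: "d \<in> motzkin_diagrams n" and ng: "\<And>g. g \<in> generators n \<Longrightarrow> d \<notin> generated_diagrams n g"
  shows "d = identity_diagram n"
proof -
  have no_arc: "{Lft a, Lft c} \<notin> d" for a c
  proof
    assume e: "{Lft a, Lft c} \<in> d"
    then have "a \<noteq> c" using motzkin_diagram_no_loop[OF d] by blast
    then show False
      using left_arc_generated[OF d, of a c] left_arc_generated[OF d, of c a] e ng
      by (cases "a < c") (auto simp: insert_commute)
  qed
  have "\<exists>j. {Lft i, Rgt j} \<in> d" if i: "i < n" for i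
  proof -
    have "({Lft i}, {}) \<in> generators n" using i by (auto simp: generators_def)
    then have "d \<notin> generated_diagrams n ({Lft i}, {})" by (rule ng)
    then have "{e \<in> d. e \<inter> {Lft i} \<noteq> {}} \<noteq> {}" using d by (simp add: generated_diagrams_def)
    then obtain e where e: "e \<in> d" "Lft i \<in> e" by blast
    from motzkin_diagram_edge[OF d e(1)] obtain u v where "e = {u, v}" "u \<noteq> v" .
    then obtain z where z: "e = {Lft i, z}"
      using e(2) by (cases "u = Lft i") (auto simp: insert_commute)
    then show ?thesis using e(1) no_arc by (cases z) auto
  qed
  then obtain s where s: "\<And>i. i < n \<Longrightarrow> {Lft i, Rgt (s i)} \<in> d" by metis
  have s_less: "s i < n" if "i < n" for i
    using motzkin_diagram_nodes[OF d s[OF that]] by (auto simp: nodes_def)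
  have s_mono: "s i < s j" if "i < j" "j < n" for i j
  proof -
    have ij: "{Lft i, Rgt (s i)} \<in> d" "{Lft j, Rgt (s j)} \<in> d" using s that by auto
    have "s i \<noteq> s j"
      using motzkin_diagram_edge_unique[OF d ij, of "Rgt (s i)"] that by (auto simp: doubleton_eq_iff)
    moreover have "\<not> s j < s i"
    proof
      assume "s j < s i"
      then have "before (Lft i) (Lft j)" "before (Lft j) (Rgt (s i))" "before (Rgt (s i)) (Rgt (s j))"
        using that by simp_all
      with ij show False using d unfolding motzkin_diagrams_def planar_diagram_def by blast
    qed
    ultimately show ?thesis by simp
  qed
  have ge: "i \<le> s i" if "i < n" for i
    using that
  proof (induction i)
    case (Suc i)
    then show ?case using s_mono[of i "Suc i"] by simp
  qed simp
  \<comment> \<open>The upper bound is proved downwards from the last node, where it reads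
    \<open>s (n - 1) < n\<close>.\<close>
  have le: "s (n - Suc i) \<le> n - Suc i" if "i < n" for i
    using that
  proof (induction i)
    case 0
    then show ?case using s_less[of "n - 1"] by simp
  next
    case (Suc i)
    have "s (n - Suc (Suc i)) < s (n - Suc i)" using Suc.prems by (intro s_mono) auto
    then show ?case using Suc by simp
  qed
  have s_eq: "s i = i" if "i < n" for i
    using ge[OF that] le[of "n - Suc i"] that by simp
  show ?thesis
  proof (intro subset_antisym subsetI)
    fix e assume "e \<in> identity_diagram n"
    then show "e \<in> d" using s s_eq by (auto simp: identity_diagram_def)
  next
    fix e assume e: "e \<in> d"
    from motzkin_diagram_edge[OF d e] obtain u v where uv: "e = {u, v}" "u \<noteq> v" "u \<in> nodes n" "v \<in> nodes n" .
    define i where "i = (case u of Lft i \<Rightarrow> i | Rgt i \<Rightarrow> i)"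
    have i: "i < n" "u \<in> {Lft i, Rgt i}" using uv(3) by (auto simp: i_def nodes_def)
    \<comment> \<open>The horizontal edges use up all nodes, so \<open>e\<close> shares a node with
      one of them and equals it.\<close>
    then have "{Lft i, Rgt i} \<in> d" using s[of i] s_eq[of i] by simp
    then have "e = {Lft i, Rgt i}"
      using motzkin_diagram_edge_unique[OF d e, of "{Lft i, Rgt i}" u] i(2) uv(1) by blast
    then show "e \<in> identity_diagram n" using i(1) by (auto simp: identity_diagram_def)
  qed
qed

text \<open>Planarity leaves the identity as the only permutation, so the action on the trivial
  module reads off the coefficient of the identity diagram.\<close>

lemma permutation_like_iff:
  assumes "d \<in> motzkin_diagrams n"
  shows "permutation_like n d \<longleftrightarrow> d = identity_diagram n"
  using not_generated[OF assms] generated_not_permutation_like permutation_like_identity by blast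

text \<open>This makes the span of all generated diagrams the augmentation ideal.\<close>

lemma generated_diagrams_Union:
  "(\<Union>g\<in>generators n. generated_diagrams n g) = motzkin_diagrams n - {identity_diagram n}"
proof (intro subset_antisym subsetI)
  fix d assume "d \<in> (\<Union>g\<in>generators n. generated_diagrams n g)"
  then obtain g where g: "g \<in> generators n" "d \<in> generated_diagrams n g" by blast
  then have "d \<in> motzkin_diagrams n" by (simp add: generated_diagrams_def)
  then show "d \<in> motzkin_diagrams n - {identity_diagram n}"
    using generated_not_permutation_like[OF g] permutation_like_identity by auto
next
  fix d assume "d \<in> motzkin_diagrams n - {identity_diagram n}"
  then show "d \<in> (\<Union>g\<in>generators n. generated_diagrams n g)" using not_generated by blast
qed

section \<open>Right ideals of the Motzkin algebra\<close>

locale motzkin = cring k for k :: "('k, 'z) ring_scheme" (structure) +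
  fixes n :: nat and \<delta> \<epsilon> :: 'k
  assumes \<delta>_closed: "\<delta> \<in> carrier k" and \<epsilon>_unit: "\<epsilon> \<in> Units k"
begin

abbreviation "A \<equiv> motzkin_algebra k n \<delta> \<epsilon>"

text \<open>The span of \<open>S\<close>. Sums and intersections of such spans correspond to unions
  and intersections of sets of diagrams, which turns questions about these right ideals into
  combinatorics.\<close>

definition supported :: "diagram set \<Rightarrow> (diagram \<Rightarrow> 'k) set" where
  "supported S = {f \<in> carrier A. \<forall>d\<in>motzkin_diagrams n - S. f d = \<zero>}"

lemma carrier_A: "carrier A = motzkin_diagrams n \<rightarrow>\<^sub>E carrier k"
  and zero_A: "\<zero>\<^bsub>A\<^esub> = (\<lambda>d\<in>motzkin_diagrams n. \<zero>)"
  and add_A: "f \<oplus>\<^bsub>A\<^esub> h = (\<lambda>d\<in>motzkin_diagrams n. f d \<oplus> h d)"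
  by (simp_all add: motzkin_algebra_def)

lemma A_closed: "f \<in> carrier A \<Longrightarrow> d \<in> motzkin_diagrams n \<Longrightarrow> f d \<in> carrier k"
  unfolding carrier_A by (rule PiE_mem)

lemma mult_A:
  assumes "z \<in> motzkin_diagrams n"
  shows "(f \<otimes>\<^bsub>A\<^esub> h) z = finsum k
    (\<lambda>p. (f (fst p) \<otimes> h (snd p)) \<otimes>
       (\<delta> [^] closed_loops n (fst p) (snd p) \<otimes> \<epsilon> [^] open_paths n (fst p) (snd p)))
    {p \<in> motzkin_diagrams n \<times> motzkin_diagrams n. compose_diagrams n (fst p) (snd p) = z}"
proof -
  have "{(x, y). x \<in> motzkin_diagrams n \<and> y \<in> motzkin_diagrams n \<and> compose_diagrams n x y = z} =
      {p \<in> motzkin_diagrams n \<times> motzkin_diagrams n. compose_diagrams n (fst p) (snd p) = z}"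
    by auto
  then show ?thesis
    using assms by (simp add: motzkin_algebra_def case_prod_unfold)
qed

lemma mult_A_coeff_closed:
  "\<delta> [^] (i :: nat) \<otimes> \<epsilon> [^] (j :: nat) \<in> carrier k"
  using \<delta>_closed Units_closed[OF \<epsilon>_unit] by simp

lemma mult_A_zero:
  assumes f: "f \<in> carrier A" and h: "h \<in> carrier A" and z: "z \<in> motzkin_diagrams n"
    and zero: "\<And>x y. \<lbrakk>x \<in> motzkin_diagrams n; y \<in> motzkin_diagrams n; compose_diagrams n x y = z\<rbrakk> \<Longrightarrow>
      f x = \<zero> \<or> h y = \<zero>"
  shows "(f \<otimes>\<^bsub>A\<^esub> h) z = \<zero>"
  unfolding mult_A[OF z]
proof (rule add.finprod_one_eqI)
  fix p assume "p \<in> {p \<in> motzkin_diagrams n \<times> motzkin_diagrams n. compose_diagrams n (fst p) (snd p) = z}"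
  then have p: "fst p \<in> motzkin_diagrams n" "snd p \<in> motzkin_diagrams n"
    "compose_diagrams n (fst p) (snd p) = z" by auto
  have "f (fst p) \<otimes> h (snd p) = \<zero>"
    using zero[OF p] A_closed[OF f p(1)] A_closed[OF h p(2)] by auto
  then show "(f (fst p) \<otimes> h (snd p)) \<otimes> (\<delta> [^] closed_loops n (fst p) (snd p) \<otimes> \<epsilon> [^] open_paths n (fst p) (snd p)) = \<zero>"
    using mult_A_coeff_closed by simp
qed

lemma supported_Int: "supported (S \<inter> T) = supported S \<inter> supported T"
  by (auto simp: supported_def)

lemma supported_empty: "supported {} = {\<zero>\<^bsub>A\<^esub>}"
proof (intro subset_antisym subsetI)
  fix f assume "f \<in> supported {}"
  then have "f \<in> motzkin_diagrams n \<rightarrow>\<^sub>E carrier k" "\<And>d. d \<in> motzkin_diagrams n \<Longrightarrow> f d = \<zero>"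
    by (auto simp: supported_def carrier_A)
  then have "f = \<zero>\<^bsub>A\<^esub>" unfolding zero_A by (intro PiE_ext[of f _ "\<lambda>_. carrier k"]) auto
  then show "f \<in> {\<zero>\<^bsub>A\<^esub>}" by simp
qed (auto simp: supported_def carrier_A zero_A)

lemma supported_Un: "supported (S \<union> T) = supported S <+>\<^bsub>A\<^esub> supported T"
proof (intro subset_antisym subsetI)
  fix f assume f: "f \<in> supported (S \<union> T)"
  then have fc: "f \<in> motzkin_diagrams n \<rightarrow>\<^sub>E carrier k" by (simp add: supported_def carrier_A)
  \<comment> \<open>Diagrams in both sets are assigned to \<open>S\<close>.\<close>
  define f1 where "f1 = (\<lambda>d\<in>motzkin_diagrams n. if d \<in> S then f d else \<zero>)"
  define f2 where "f2 = (\<lambda>d\<in>motzkin_diagrams n. if d \<in> S then \<zero> else f d)"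
  have "f1 \<in> supported S" "f2 \<in> supported T"
    using f PiE_mem[OF fc] by (auto simp: supported_def carrier_A f1_def f2_def)
  moreover have "f = f1 \<oplus>\<^bsub>A\<^esub> f2"
    unfolding add_A
    by (rule PiE_ext[OF fc])
      (use PiE_mem[OF fc] in \<open>auto simp: f1_def f2_def\<close>)
  ultimately show "f \<in> supported S <+>\<^bsub>A\<^esub> supported T" unfolding set_add_def' by blast
next
  fix f assume "f \<in> supported S <+>\<^bsub>A\<^esub> supported T"
  then obtain f1 f2 where "f1 \<in> supported S" "f2 \<in> supported T" "f = f1 \<oplus>\<^bsub>A\<^esub> f2"
    unfolding set_add_def' by blast
  moreover from this have "f1 \<in> carrier A" "f2 \<in> carrier A" by (simp_all add: supported_def)
  ultimately show "f \<in> supported (S \<union> T)"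
    using A_closed by (auto simp: supported_def add_A carrier_A)
qed

text \<open>The factor \<open>inv \<epsilon>\<close> cancels the one open path that arises when the
  generator diagram is composed with a diagram that it generates.\<close>

definition generator_element :: "node set \<times> diagram \<Rightarrow> diagram \<Rightarrow> 'k" where
  "generator_element g = (\<lambda>d\<in>motzkin_diagrams n. if d = generator_diagram n g then inv \<epsilon> else \<zero>)"

lemma generator_element_supported:
  assumes "g \<in> generators n"
  shows "generator_element g \<in> supported (generated_diagrams n g)"
  using generator_diagram_generated[OF assms] \<epsilon>_unit
  by (auto simp: supported_def carrier_A generator_element_def)

lemma generator_element_unit:
  assumes ring: "ring A" and g: "g \<in> generators n" and f: "f \<in> supported (generated_diagrams n g)"
  shows "generator_element g \<otimes>\<^bsub>A\<^esub> f = f"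
proof -
  interpret A: ring A by fact
  let ?g = "generator_diagram n g" and ?e = "generator_element g"
  have fc: "f \<in> carrier A" using f by (simp add: supported_def)
  have ec: "?e \<in> carrier A" using generator_element_supported[OF g] by (simp add: supported_def)
  have "(?e \<otimes>\<^bsub>A\<^esub> f) z = f z" if z: "z \<in> motzkin_diagrams n" for z
  proof (cases "z \<in> generated_diagrams n g")
    case True
    let ?term = "\<lambda>p. (?e (fst p) \<otimes> f (snd p)) \<otimes>
       (\<delta> [^] closed_loops n (fst p) (snd p) \<otimes> \<epsilon> [^] open_paths n (fst p) (snd p))"
    let ?pairs = "{p \<in> motzkin_diagrams n \<times> motzkin_diagrams n. compose_diagrams n (fst p) (snd p) = z}"
    \<comment> \<open>Only one pair contributes: the left factor must be \<open>?g\<close>, and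
      composing \<open>?g\<close> with a generated diagram returns that diagram, so the right factor
      must be \<open>z\<close>.\<close>
    have "finsum k ?term {(?g, z)} = finsum k ?term ?pairs"
    proof (rule add.finprod_mono_neutral_cong_left)
      show "finite ?pairs"
        by (rule finite_subset[of _ "motzkin_diagrams n \<times> motzkin_diagrams n"])
          (auto simp: finite_motzkin_diagrams)
      show "{(?g, z)} \<subseteq> ?pairs"
        using generator_diagram_in[OF g] z compose_generator_id[OF g True] by simp
      show "?term \<in> ?pairs \<rightarrow> carrier k"
        using A_closed[OF ec] A_closed[OF fc] mult_A_coeff_closed by auto
      show "?term p = \<zero>" if p: "p \<in> ?pairs - {(?g, z)}" for p
      proof -
        have pm: "fst p \<in> motzkin_diagrams n" "snd p \<in> motzkin_diagrams n" using p by auto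
        have "?e (fst p) = \<zero> \<or> f (snd p) = \<zero>"
        proof (rule ccontr)
          assume *: "\<not> ?thesis"
          then have "fst p = ?g" using pm by (auto simp: generator_element_def split: if_splits)
          moreover have "snd p \<in> generated_diagrams n g"
            using * f pm by (auto simp: supported_def)
          ultimately have "p = (?g, z)"
            using p compose_generator_id[OF g, of "snd p"] by (auto simp: prod_eq_iff)
          then show False using p by simp
        qed
        then have "?e (fst p) \<otimes> f (snd p) = \<zero>"
          using A_closed[OF ec pm(1)] A_closed[OF fc pm(2)] by auto
        then show ?thesis using mult_A_coeff_closed by simp
      qed
    qed simp
    then have "(?e \<otimes>\<^bsub>A\<^esub> f) z = finsum k ?term {(?g, z)}"
      unfolding mult_A[OF z] by simp
    also have "\<dots> = ?term (?g, z)"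
      using A_closed[OF ec generator_diagram_in[OF g]] A_closed[OF fc z] mult_A_coeff_closed
      by (simp add: finsum_insert)
    \<comment> \<open>There is no loop and exactly one open path, so the weight is
      \<epsilon>.\<close>
    also have "\<dots> = (inv \<epsilon> \<otimes> f z) \<otimes> \<epsilon>"
      using closed_loops_generator[OF g True] open_paths_generator[OF g True] generator_diagram_in[OF g]
        \<epsilon>_unit by (simp add: generator_element_def Units_closed)
    also have "\<dots> = (inv \<epsilon> \<otimes> \<epsilon>) \<otimes> f z"
      using \<epsilon>_unit A_closed[OF fc z] Units_closed[OF \<epsilon>_unit] Units_inv_closed[OF \<epsilon>_unit]
      by (simp only: m_ac)
    also have "\<dots> = f z"
      using \<epsilon>_unit A_closed[OF fc z] by simp
    finally show ?thesis .
  next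
    case False
    then have "f z = \<zero>" using f z by (auto simp: supported_def)
    moreover have "(?e \<otimes>\<^bsub>A\<^esub> f) z = \<zero>"
    proof (rule mult_A_zero[OF ec fc z])
      fix x y assume xy: "x \<in> motzkin_diagrams n" "y \<in> motzkin_diagrams n" "compose_diagrams n x y = z"
      show "?e x = \<zero> \<or> f y = \<zero>"
      proof (rule ccontr)
        assume *: "\<not> ?thesis"
        then have "x = ?g" using xy by (auto simp: generator_element_def split: if_splits)
        moreover have "y \<in> generated_diagrams n g" using * f xy by (auto simp: supported_def)
        ultimately show False using compose_generator_id[OF g] xy(3) False by simp
      qed
    qed
    ultimately show ?thesis by simp
  qed
  moreover have "?e \<otimes>\<^bsub>A\<^esub> f \<in> motzkin_diagrams n \<rightarrow>\<^sub>E carrier k"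
    using A.m_closed[OF ec fc] by (simp add: carrier_A)
  ultimately show ?thesis
    using fc unfolding carrier_A by (intro PiE_ext[of _ _ "\<lambda>_. carrier k"]) auto
qed

text \<open>A right ideal need not be stable under multiplication from the left. Here it is, because
  the generator diagram keeps the prescription at the disjoint node set
  \<open>fst h\<close>.\<close>

lemma generator_element_mult_supported:
  assumes ring: "ring A" and g: "g \<in> generators n" and h: "h \<in> generators n" and disj: "fst g \<inter> fst h = {}"
    and f: "f \<in> supported (generated_diagrams n h)"
  shows "generator_element g \<otimes>\<^bsub>A\<^esub> f \<in> supported (generated_diagrams n h)"
proof -
  interpret A: ring A by fact
  have fc: "f \<in> carrier A" using f by (simp add: supported_def)
  have ec: "generator_element g \<in> carrier A"
    using generator_element_supported[OF g] by (simp add: supported_def)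
  have "(generator_element g \<otimes>\<^bsub>A\<^esub> f) z = \<zero>" if z: "z \<in> motzkin_diagrams n" "z \<notin> generated_diagrams n h" for z
  proof (rule mult_A_zero[OF ec fc z(1)])
    fix x y assume xy: "x \<in> motzkin_diagrams n" "y \<in> motzkin_diagrams n" "compose_diagrams n x y = z"
    show "generator_element g x = \<zero> \<or> f y = \<zero>"
    proof (rule ccontr)
      assume *: "\<not> ?thesis"
      then have x: "x = generator_diagram n g"
        using xy by (auto simp: generator_element_def split: if_splits)
      have "y \<in> generated_diagrams n h" using * f xy by (auto simp: supported_def)
      then have "{e \<in> y. e \<inter> fst h \<noteq> {}} = snd h" by (simp add: generated_diagrams_def)
      from compose_generator_other[OF g xy(2) this h disj] show False
        using z xy(3) x by (simp add: generated_diagrams_def)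
    qed
  qed
  then show ?thesis using A.m_closed[OF ec fc] by (simp add: supported_def)
qed

section \<open>Intersections and sums of the right ideals of the generators\<close>

definition common_diagrams :: "(node set \<times> diagram) set \<Rightarrow> diagram set" where
  "common_diagrams T = {d \<in> motzkin_diagrams n. \<forall>t\<in>T. d \<in> generated_diagrams n t}"

text \<open>A basis for the sum over \<open>F\<close> intersected with all ideals from
  \<open>T\<close>. Mayer-Vietoris along \<open>F\<close> stays within this family, since
  intersecting with one more ideal only enlarges \<open>T\<close>.\<close>

definition common_union_diagrams ::
  "(node set \<times> diagram) set \<Rightarrow> (node set \<times> diagram) set \<Rightarrow> diagram set" where
  "common_union_diagrams F T = (\<Union>g\<in>F. generated_diagrams n g) \<inter> common_diagrams T"

lemma common_diagrams_insert: "common_diagrams (insert g T) = generated_diagrams n g \<inter> common_diagrams T"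
  by (auto simp: common_diagrams_def generated_diagrams_def)

lemma compose_generated:
  assumes "g \<in> generators n" "x \<in> generated_diagrams n g" "compose_diagrams n x y \<in> motzkin_diagrams n"
  shows "compose_diagrams n x y \<in> generated_diagrams n g"
  using compose_touching[OF assms(1), of x y] assms(2,3) by (simp add: generated_diagrams_def)

lemma right_ideal_supported:
  assumes ring: "ring A"
    and S: "\<And>x y. \<lbrakk>x \<in> S; compose_diagrams n x y \<in> motzkin_diagrams n\<rbrakk> \<Longrightarrow> compose_diagrams n x y \<in> S"
  shows "right_ideal A (supported S)"
proof -
  interpret A: ring A by fact
  have "f \<otimes>\<^bsub>A\<^esub> h \<in> supported S" if f: "f \<in> supported S" and h: "h \<in> carrier A" for f h
  proof -
    have fc: "f \<in> carrier A" using f by (simp add: supported_def)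
    have "(f \<otimes>\<^bsub>A\<^esub> h) z = \<zero>" if z: "z \<in> motzkin_diagrams n" "z \<notin> S" for z
    proof (rule mult_A_zero[OF fc h z(1)])
      fix x y assume xy: "x \<in> motzkin_diagrams n" "y \<in> motzkin_diagrams n" "compose_diagrams n x y = z"
      then have "x \<notin> S" using S[of x y] z by auto
      then show "f x = \<zero> \<or> h y = \<zero>" using f xy(1) by (simp add: supported_def)
    qed
    then show ?thesis using A.m_closed[OF fc h] by (simp add: supported_def)
  qed
  moreover have "f \<oplus>\<^bsub>A\<^esub> h \<in> supported S" if "f \<in> supported S" "h \<in> supported S" for f h
    using that A.a_closed[of f h] by (auto simp: supported_def add_A)
  moreover have "\<zero>\<^bsub>A\<^esub> \<in> supported S"
    using A.zero_closed by (simp add: supported_def zero_A)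
  ultimately show ?thesis by (auto simp: right_ideal_def supported_def)
qed

lemma right_ideal_common:
  assumes "ring A" "T \<subseteq> generators n"
  shows "right_ideal A (supported (common_diagrams T))"
  using assms(2) compose_generated
  by (intro right_ideal_supported[OF assms(1)]) (auto simp: common_diagrams_def)

lemma right_ideal_common_union:
  assumes "ring A" "F \<subseteq> generators n" "T \<subseteq> generators n"
  shows "right_ideal A (supported (common_union_diagrams F T))"
proof (rule right_ideal_supported[OF assms(1)])
  fix x y assume xy: "x \<in> common_union_diagrams F T" "compose_diagrams n x y \<in> motzkin_diagrams n"
  then obtain g where "g \<in> F" "x \<in> generated_diagrams n g" "\<forall>t\<in>T. x \<in> generated_diagrams n t"
    unfolding common_union_diagrams_def common_diagrams_def by blast
  then have "compose_diagrams n x y \<in> generated_diagrams n g"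
    "\<forall>t\<in>T. compose_diagrams n x y \<in> generated_diagrams n t"
    using compose_generated[OF _ _ xy(2)] assms(2,3) by blast+
  then show "compose_diagrams n x y \<in> common_union_diagrams F T"
    using xy(2) \<open>g \<in> F\<close> unfolding common_union_diagrams_def common_diagrams_def by blast
qed

text \<open>If \<open>g\<close> is disjoint from all of \<open>T\<close>, the product of the unit
  \<open>e\<close> of \<open>g\<close> with the unit \<open>f\<close> of \<open>T\<close> works. It
  fixes \<open>u\<close> in the intersection since \<open>e (f u) = e u = u\<close>. It lies in the
  ideals of \<open>T\<close> because \<open>e\<close> preserves them, and in the ideal of
  \<open>g\<close> as a right multiple of \<open>e\<close>. If \<open>g\<close> shares a node with a
  member of \<open>T\<close>, the intersection is zero, with unit zero.\<close>

lemma common_diagrams_left_unit: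
  assumes ring: "ring A"
  shows "\<lbrakk>finite T; T \<noteq> {}; T \<subseteq> generators n\<rbrakk> \<Longrightarrow>
    \<exists>f\<in>supported (common_diagrams T). \<forall>u\<in>supported (common_diagrams T). f \<otimes>\<^bsub>A\<^esub> u = u"
proof (induction T rule: finite_ne_induct)
  case (singleton g)
  have "common_diagrams {g} = generated_diagrams n g"
    by (auto simp: common_diagrams_def generated_diagrams_def)
  then show ?case
    using generator_element_supported[of g] generator_element_unit[OF ring, of g] singleton by auto
next
  case (insert g T)
  interpret A: ring A by fact
  have g: "g \<in> generators n" and T: "T \<subseteq> generators n" using insert.prems by auto
  from insert.IH[OF T] obtain f where f: "f \<in> supported (common_diagrams T)"
    and fu: "\<And>u. u \<in> supported (common_diagrams T) \<Longrightarrow> f \<otimes>\<^bsub>A\<^esub> u = u" by blast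
  let ?e = "generator_element g"
  have fc: "f \<in> carrier A" using f by (simp add: supported_def)
  have ec: "?e \<in> carrier A" using generator_element_supported[OF g] by (simp add: supported_def)
  show ?case
  proof (cases "\<forall>t\<in>T. fst g \<inter> fst t = {}")
    case True
    have "?e \<otimes>\<^bsub>A\<^esub> f \<in> supported (generated_diagrams n t)" if t: "t \<in> T" for t
    proof (rule generator_element_mult_supported[OF ring g])
      show "t \<in> generators n" "fst g \<inter> fst t = {}" using t T True by auto
      show "f \<in> supported (generated_diagrams n t)"
        using f t by (auto simp: supported_def common_diagrams_def)
    qed
    then have "?e \<otimes>\<^bsub>A\<^esub> f \<in> supported (common_diagrams T)"
      using A.m_closed[OF ec fc] by (auto simp: supported_def common_diagrams_def)
    moreover have "right_ideal A (supported (generated_diagrams n g))"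
      using compose_generated[OF g] by (intro right_ideal_supported[OF ring])
    then have "?e \<otimes>\<^bsub>A\<^esub> f \<in> supported (generated_diagrams n g)"
      using generator_element_supported[OF g] fc by (auto simp: right_ideal_def)
    ultimately have "?e \<otimes>\<^bsub>A\<^esub> f \<in> supported (common_diagrams (insert g T))"
      by (simp add: common_diagrams_insert supported_Int)
    moreover have "(?e \<otimes>\<^bsub>A\<^esub> f) \<otimes>\<^bsub>A\<^esub> u = u" if "u \<in> supported (common_diagrams (insert g T))" for u
    proof -
      have u: "u \<in> supported (generated_diagrams n g)" "u \<in> supported (common_diagrams T)"
        using that by (simp_all add: common_diagrams_insert supported_Int)
      then have "u \<in> carrier A" by (simp add: supported_def)
      then have "(?e \<otimes>\<^bsub>A\<^esub> f) \<otimes>\<^bsub>A\<^esub> u = ?e \<otimes>\<^bsub>A\<^esub> (f \<otimes>\<^bsub>A\<^esub> u)" using ec fc by (simp add: A.m_assoc)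
      then show ?thesis using fu[OF u(2)] generator_element_unit[OF ring g u(1)] by simp
    qed
    ultimately show ?thesis by blast
  next
    case False
    then obtain t where t: "t \<in> T" "fst g \<inter> fst t \<noteq> {}" by blast
    then have "generated_diagrams n g \<inter> generated_diagrams n t = {}"
      using generators_disjoint[OF g, of t] T insert.hyps by blast
    then have "common_diagrams (insert g T) = {}" using t by (auto simp: common_diagrams_def)
    then show ?thesis by (simp add: supported_empty)
  qed
qed

lemma smult_trivial_module:
  assumes "f \<in> carrier A"
  shows "f \<odot>\<^bsub>trivial_module k n\<^esub> c = f (identity_diagram n) \<otimes> c"
proof -
  have "{d \<in> motzkin_diagrams n. permutation_like n d} = {identity_diagram n}"
    using permutation_like_iff identity_diagram_in by auto
  then show ?thesis
    using A_closed[OF assms identity_diagram_in] by (simp add: trivial_module_def finsum_insert)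
qed

lemma trivial_action_motzkin:
  assumes "left_module A (trivial_module k n)"
  shows "trivial_action A k (trivial_module k n) (\<lambda>f. f (identity_diagram n))"
proof (intro trivial_action.intro assms is_cring trivial_action_axioms.intro)
  show "a \<odot>\<^bsub>trivial_module k n\<^esub> c = a (identity_diagram n) \<otimes> c" if "a \<in> carrier A" for a c
    by (rule smult_trivial_module[OF that])
  show "a (identity_diagram n) \<in> carrier k" if "a \<in> carrier A" for a
    by (rule A_closed[OF that identity_diagram_in])
  show "\<exists>a\<in>carrier A. a (identity_diagram n) = c" if "c \<in> carrier k" for c
    using that identity_diagram_in
    by (intro bexI[of _ "\<lambda>d\<in>motzkin_diagrams n. c"]) (auto simp: carrier_A)
qed (simp_all add: trivial_module_def)

context
  fixes X :: "(diagram \<Rightarrow> 'k, 'p, 'k) augmented_complex"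
  assumes X: "projective_resolution A (trivial_module k n) X"
begin

text \<open>The ring axioms of \<open>A\<close> are contained in the assumption that
  \<open>X\<close> resolves a left module over \<open>A\<close>.\<close>

lemma ring_A: "ring A"
  using resolution_left_module[OF X] by (simp add: left_module_def)

text \<open>The identity coefficient of \<open>f\<close> is zero, so \<open>f\<close> acts as zero
  on the trivial module, as the general criterion demands.\<close>

lemma acyclic_supported_left_unit:
  assumes "right_ideal A (supported S)" "f \<in> supported S" "\<And>u. u \<in> supported S \<Longrightarrow> f \<otimes>\<^bsub>A\<^esub> u = u"
    and "identity_diagram n \<notin> S"
  shows "acyclic_ideal A X (supported S)"
proof (rule acyclic_ideal_left_unit[OF X assms(1-3)])
  fix c assume c: "c \<in> carrier (trivial_module k n)"
  have "f \<in> carrier A" "f (identity_diagram n) = \<zero>"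
    using assms(2,4) identity_diagram_in by (auto simp: supported_def)
  then show "f \<odot>\<^bsub>trivial_module k n\<^esub> c = \<zero>\<^bsub>trivial_module k n\<^esub>"
    using c by (simp add: smult_trivial_module) (simp add: trivial_module_def)
qed

lemma acyclic_common:
  assumes T: "finite T" "T \<noteq> {}" "T \<subseteq> generators n"
  shows "acyclic_ideal A X (supported (common_diagrams T))"
proof -
  obtain f where f: "f \<in> supported (common_diagrams T)"
    "\<And>u. u \<in> supported (common_diagrams T) \<Longrightarrow> f \<otimes>\<^bsub>A\<^esub> u = u"
    using common_diagrams_left_unit[OF ring_A T] by blast
  have "identity_diagram n \<notin> common_diagrams T"
    using T generated_diagrams_Union[of n] unfolding common_diagrams_def by blast
  then show ?thesis
    using acyclic_supported_left_unit[OF right_ideal_common[OF ring_A T(3)] f] by simp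
qed

lemma acyclic_common_union:
  "\<lbrakk>finite F; F \<subseteq> generators n; finite T; T \<subseteq> generators n\<rbrakk> \<Longrightarrow>
    acyclic_ideal A X (supported (common_union_diagrams F T))"
proof (induction F arbitrary: T rule: finite_induct)
  case empty
  interpret A: ring A by (rule ring_A)
  \<comment> \<open>The empty sum is the zero ideal, with left unit zero.\<close>
  have "right_ideal A (supported {})" by (intro right_ideal_supported[OF ring_A]) simp
  then have "acyclic_ideal A X (supported {})"
    by (rule acyclic_supported_left_unit[where f = "\<zero>\<^bsub>A\<^esub>"]) (simp_all add: supported_empty)
  then show ?case by (simp add: common_union_diagrams_def)
next
  case (insert g F)
  have g: "insert g T \<subseteq> generators n" "F \<subseteq> generators n" using insert.prems by auto
  have Un: "common_union_diagrams (insert g F) T = common_diagrams (insert g T) \<union> common_union_diagrams F T"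
    unfolding common_union_diagrams_def common_diagrams_insert by blast
  \<comment> \<open>Intersecting with the ideal of \<open>g\<close> moves \<open>g\<close> from the
    sum into the intersection; for this reason \<open>T\<close> is arbitrary in the
    induction.\<close>
  have Int: "common_diagrams (insert g T) \<inter> common_union_diagrams F T = common_union_diagrams F (insert g T)"
    unfolding common_union_diagrams_def common_diagrams_insert by blast
  show ?case
    unfolding Un supported_Un
  proof (rule acyclic_ideal_set_add[OF X])
    show "right_ideal A (supported (common_diagrams (insert g T)))"
      by (rule right_ideal_common[OF ring_A g(1)])
    show "right_ideal A (supported (common_union_diagrams F T))"
      by (rule right_ideal_common_union[OF ring_A g(2) insert.prems(3)])
    \<comment> \<open>\<open>insert g T\<close> is nonempty even for empty \<open>T\<close>, as
      \<open>acyclic_common\<close> requires.\<close>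
    show "acyclic_ideal A X (supported (common_diagrams (insert g T)))"
      using insert.prems g by (intro acyclic_common) auto
    show "acyclic_ideal A X (supported (common_union_diagrams F T))"
      using insert.prems g by (intro insert.IH) auto
    show "acyclic_ideal A X (supported (common_diagrams (insert g T)) \<inter> supported (common_union_diagrams F T))"
      unfolding supported_Int[symmetric] Int using insert.prems g by (intro insert.IH) auto
  qed
qed

theorem Tor_motzkin_trivial:
  assumes "1 \<le> q"
  shows "trivial_group (Tor A (trivial_module k n) X q)"
proof -
  interpret T: trivial_action A k "trivial_module k n" "\<lambda>f. f (identity_diagram n)"
    by (rule trivial_action_motzkin[OF resolution_left_module[OF X]])
  \<comment> \<open>With empty \<open>T\<close> no intersection is imposed, and the sum over all
    generators is spanned by the diagrams other than the identity.\<close>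
  have "common_union_diagrams (generators n) {} = motzkin_diagrams n - {identity_diagram n}"
    unfolding common_union_diagrams_def generated_diagrams_Union by (auto simp: common_diagrams_def)
  then have "supported (common_union_diagrams (generators n) {}) = T.augmentation_ideal"
    using identity_diagram_in by (auto simp: supported_def T.augmentation_ideal_def)
  then have "acyclic_ideal A X T.augmentation_ideal"
    using acyclic_common_union[of "generators n" "{}"] finite_generators by simp
  then show ?thesis by (rule T.tor_trivial[OF X _ assms])
qed

end

end

section \<open>The inclusion of algebras and the resulting comparison of Tor\<close>

lemma motzkin_inclusion_closed:
  assumes k: "cring k" and f: "f \<in> motzkin_diagrams (n - 1) \<rightarrow>\<^sub>E carrier k"
  shows "motzkin_inclusion k n f \<in> motzkin_diagrams n \<rightarrow>\<^sub>E carrier k"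
proof -
  interpret cring k by fact
  show ?thesis
    unfolding motzkin_inclusion_def using PiE_mem[OF f] by (auto intro!: finsum_closed)
qed

text \<open>The added edge joins nodes that smaller diagrams do not have, so adding it is injective,
  and only the smaller identity diagram yields the larger one. Thus the inclusion respects the
  augmentations.\<close>

lemma motzkin_inclusion_identity:
  assumes k: "cring k" and f: "f \<in> motzkin_diagrams (n - 1) \<rightarrow>\<^sub>E carrier k" and n: "1 \<le> n"
  shows "motzkin_inclusion k n f (identity_diagram n) = f (identity_diagram (n - 1))"
proof -
  interpret cring k by fact
  let ?e = "{Lft (n - 1), Rgt (n - 1)}"
  have notin: "?e \<notin> x" if "x \<in> motzkin_diagrams (n - 1)" for x
    using motzkin_diagram_nodes[OF that, of ?e] by (auto simp: nodes_def)
  have "{..<n} = insert (n - 1) {..<n - 1}" using n by auto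
  then have id: "identity_diagram n = insert ?e (identity_diagram (n - 1))"
    unfolding identity_diagram_def setcompr_eq_image lessThan_def[symmetric] by simp
  have "{x \<in> motzkin_diagrams (n - 1). insert ?e x = identity_diagram n} = {identity_diagram (n - 1)}"
    unfolding id using insert_ident[OF notin notin[OF identity_diagram_in]] identity_diagram_in by auto
  then show ?thesis
    using PiE_mem[OF f identity_diagram_in] identity_diagram_in[of n]
    by (simp add: motzkin_inclusion_def finsum_insert)
qed

theorem corollary10p3:
  fixes k :: "('k, 'z) ring_scheme" and \<delta> \<epsilon> v :: 'k and n :: nat
  assumes "cring k"
    and "\<epsilon> \<in> Units k"
    and "v \<in> Units k"
    and "\<delta> = v \<oplus>\<^bsub>k\<^esub> inv\<^bsub>k\<^esub> v"
  shows "(\<forall>(X :: (diagram \<Rightarrow> 'k, 'p, 'k) augmented_complex) q.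
            projective_resolution (motzkin_algebra k n \<delta> \<epsilon>) (trivial_module k n) X \<longrightarrow>
            1 \<le> q \<longrightarrow> (even n \<and> q + 2 \<le> n \<or> odd n \<and> q + 1 \<le> n) \<longrightarrow>
            trivial_group (Tor (motzkin_algebra k n \<delta> \<epsilon>) (trivial_module k n) X q))
       \<and> (\<forall>(X :: (diagram \<Rightarrow> 'k, 'p, 'k) augmented_complex)
             (Y :: (diagram \<Rightarrow> 'k, 'q, 'k) augmented_complex) f q.
            projective_resolution (motzkin_algebra k (n - 1) \<delta> \<epsilon>) (trivial_module k (n - 1)) X \<longrightarrow>
            projective_resolution (motzkin_algebra k n \<delta> \<epsilon>) (trivial_module k n) Y \<longrightarrow>
            chain_lift (motzkin_algebra k (n - 1) \<delta> \<epsilon>) (motzkin_inclusion k n) (\<lambda>c. c) X Y f \<longrightarrow>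
            q + 3 \<le> n \<longrightarrow>
            Tor_map (motzkin_algebra k n \<delta> \<epsilon>) (trivial_module k n) Y (\<lambda>c. c) f q
              \<in> iso (Tor (motzkin_algebra k (n - 1) \<delta> \<epsilon>) (trivial_module k (n - 1)) X q)
                    (Tor (motzkin_algebra k n \<delta> \<epsilon>) (trivial_module k n) Y q))"
proof -
  interpret k: cring k by fact
  have "\<delta> \<in> carrier k" using assms(4) k.Units_closed[OF assms(3)] k.Units_inv_closed[OF assms(3)] by simp
  then have mz: "motzkin k \<delta> \<epsilon>"
    using assms(1,2) by (intro motzkin.intro motzkin_axioms.intro)
  show ?thesis
  proof (intro conjI allI impI)
    fix X :: "(diagram \<Rightarrow> 'k, 'p, 'k) augmented_complex" and q :: nat
    assume "projective_resolution (motzkin_algebra k n \<delta> \<epsilon>) (trivial_module k n) X" "1 \<le> q"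
    then show "trivial_group (Tor (motzkin_algebra k n \<delta> \<epsilon>) (trivial_module k n) X q)"
      by (rule motzkin.Tor_motzkin_trivial[OF mz])
  next
    fix X :: "(diagram \<Rightarrow> 'k, 'p, 'k) augmented_complex"
      and Y :: "(diagram \<Rightarrow> 'k, 'q, 'k) augmented_complex" and f and q :: nat
    assume X: "projective_resolution (motzkin_algebra k (n - 1) \<delta> \<epsilon>) (trivial_module k (n - 1)) X"
      and Y: "projective_resolution (motzkin_algebra k n \<delta> \<epsilon>) (trivial_module k n) Y"
      and f: "chain_lift (motzkin_algebra k (n - 1) \<delta> \<epsilon>) (motzkin_inclusion k n) (\<lambda>c. c) X Y f"
      and q: "q + 3 \<le> n"
    interpret T: trivial_action_map "motzkin_algebra k (n - 1) \<delta> \<epsilon>" k "trivial_module k (n - 1)"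
      "\<lambda>f. f (identity_diagram (n - 1))" "motzkin_algebra k n \<delta> \<epsilon>" "trivial_module k n"
      "\<lambda>f. f (identity_diagram n)" "motzkin_inclusion k n"
    proof (intro trivial_action_map.intro trivial_action_map_axioms.intro)
      show "trivial_action (motzkin_algebra k (n - 1) \<delta> \<epsilon>) k (trivial_module k (n - 1))
          (\<lambda>f. f (identity_diagram (n - 1)))"
        by (rule motzkin.trivial_action_motzkin[OF mz resolution_left_module[OF X]])
      show "trivial_action (motzkin_algebra k n \<delta> \<epsilon>) k (trivial_module k n) (\<lambda>f. f (identity_diagram n))"
        by (rule motzkin.trivial_action_motzkin[OF mz resolution_left_module[OF Y]])
      fix a assume "a \<in> carrier (motzkin_algebra k (n - 1) \<delta> \<epsilon>)"
      then have a: "a \<in> motzkin_diagrams (n - 1) \<rightarrow>\<^sub>E carrier k" by (simp add: motzkin_algebra_def)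
      show "motzkin_inclusion k n a \<in> carrier (motzkin_algebra k n \<delta> \<epsilon>)"
        using motzkin_inclusion_closed[OF assms(1) a] by (simp add: motzkin_algebra_def)
      \<comment> \<open>The bound \<open>q + 3 \<le> n\<close> makes \<open>n\<close> positive, so
        \<open>n - 1\<close> is a true predecessor.\<close>
      show "motzkin_inclusion k n a (identity_diagram n) = a (identity_diagram (n - 1))"
        using q by (intro motzkin_inclusion_identity[OF assms(1) a]) simp
    qed
    \<comment> \<open>In degree 0 the augmentations identify both groups with \<open>k\<close>; in
      positive degrees both groups vanish.\<close>
    show "Tor_map (motzkin_algebra k n \<delta> \<epsilon>) (trivial_module k n) Y (\<lambda>c. c) f q
              \<in> iso (Tor (motzkin_algebra k (n - 1) \<delta> \<epsilon>) (trivial_module k (n - 1)) X q)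
                    (Tor (motzkin_algebra k n \<delta> \<epsilon>) (trivial_module k n) Y q)"
    proof (cases q)
      case 0
      then show ?thesis using T.Tor_map_iso_0[OF X Y f] by simp
    next
      case (Suc i)
      then have "1 \<le> q" by simp
      then show ?thesis
        by (intro T.Tor_map_iso_trivial[OF X Y f] motzkin.Tor_motzkin_trivial[OF mz X]
            motzkin.Tor_motzkin_trivial[OF mz Y])
    qed
  qed
qed

end
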